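(* Let $n\in\{2,3\}$ and let $\Gamma\subset\Gamma_\infty$ be a nonempty bounded relatively open set with $L:=\operatorname{diam}\Gamma$. For every $s\in\mathbb{R}$ the single-layer operator $S_k$ (defined on $\mathscr{D}(\Gamma)$) extends to a bounded linear operator $S_k:\tilde H^s(\Gamma)\to H^{s+1}(\Gamma)$, and there exists a constant $C>0$, independent of $k$ and $\Gamma$, such that for all $k>0$ and all $\phi\in\tilde H^s(\Gamma)$, $$\|S_k\phi\|_{H^{s+1}_k(\Gamma)}\le\begin{cases}C\big(1+(kL)^{1/2}\big)\|\phi\|_{\tilde H^s_k(\Gamma)},& n=3,\\ C\log\big(2+(kL)^{-1}\big)\big(1+(kL)^{1/2}\big)\|\phi\|_{\tilde H^s_k(\Gamma)},& n=2.\end{cases}$$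
   Context: $\Gamma_\infty:=\{\mathbf{x}\in\mathbb{R}^n:x_n=0\}$ is identified with $\mathbb{R}^{n-1}$ and $\Gamma$ with the corresponding open subset of $\mathbb{R}^{n-1}$; $\mathscr{D}(\Gamma)=C_0^\infty(\Gamma)$. Fourier transform: $\hat u(\boldsymbol{\xi})=(2\pi)^{-(n-1)/2}\int e^{-{\mathrm{i}}\boldsymbol{\xi}\cdot\mathbf{x}}u(\mathbf{x})\,\mathrm{d}\mathbf{x}$. For $k>0$, $s\in\mathbb{R}$, $H^s(\mathbb{R}^{n-1})$ is the Bessel potential space with the $k$-dependent norm $\|u\|_{H^s_k(\mathbb{R}^{n-1})}^2=\int(k^2+|\boldsymbol{\xi}|^2)^s|\hat u(\boldsymbol{\xi})|^2\,\mathrm{d}\boldsymbol{\xi}$. $H^s(\Gamma)$ is the space of restrictions $U|_\Gamma$ of $U\in H^s(\mathbb{R}^{n-1})$ with norm $\|u\|_{H^s_k(\Gamma)}=\inf\{\|U\|_{H^s_k(\mathbb{R}^{n-1})}:U|_\Gamma=u\}$. $\tilde H^s(\Gamma)$ is the closure of $\mathscr{D}(\Gamma)$ in $H^s(\mathbb{R}^{n-1})$ with norm $\|\cdot\|_{\tilde H^s_k(\Gamma)}:=\|\cdot\|_{H^s_k(\mathbb{R}^{n-1})}$. The fundamental solution is $\Phi(\mathbf{x},\mathbf{y})=e^{{\mathrm{i}} k|\mathbf{x}-\mathbf{y}|}/(4\pi|\mathbf{x}-\mathbf{y}|)$ ($n=3$), $\frac{{\mathrm{i}}}{4}H_0^{(1)}(k|\mathbf{x}-\mathbf{y}|)$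 ($n=2$). For $\phi\in\mathscr{D}(\Gamma)$, $S_k\phi(\mathbf{x})=\int_\Gamma\Phi(\mathbf{x},\mathbf{y})\phi(\mathbf{y})\,\mathrm{d}s(\mathbf{y})$, $\mathbf{x}\in\Gamma$. *)

theory Defs
  imports "HOL-Analysis.Analysis"
begin

text \<open>The hyperplane Gamma_infinity is identified with the Euclidean space 'a of
  dimension d = n - 1 (d = 1 or 2). Functions are complex valued.\<close>

fun iter_dderiv :: "'a::euclidean_space list \<Rightarrow> ('a \<Rightarrow> complex) \<Rightarrow> 'a \<Rightarrow> complex" where
  "iter_dderiv [] f = f"
| "iter_dderiv (v # vs) f = (\<lambda>x. frechet_derivative (iter_dderiv vs f) (at x) v)"

definition smooth_fun :: "('a::euclidean_space \<Rightarrow> complex) \<Rightarrow> bool" where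
  "smooth_fun f \<longleftrightarrow> (\<forall>vs x. iter_dderiv vs f differentiable (at x))"

definition test_funs :: "'a::euclidean_space set \<Rightarrow> ('a \<Rightarrow> complex) set" where
  "test_funs \<Gamma> = {\<phi>. smooth_fun \<phi> \<and> compact (closure {x. \<phi> x \<noteq> 0})
                        \<and> closure {x. \<phi> x \<noteq> 0} \<subseteq> \<Gamma>}"

definition fourier :: "('a::euclidean_space \<Rightarrow> complex) \<Rightarrow> 'a \<Rightarrow> complex" where
  "fourier u \<xi> = complex_of_real ((2 * pi) powr (- real DIM('a) / 2)) *
      integral\<^sup>L lborel (\<lambda>x. cis (- (\<xi> \<bullet> x)) * u x)"

text \<open>An element of H^s(R^(n-1)) is represented by its Fourier transform U.\<close>
definition Hs_space :: "real \<Rightarrow> ('a::euclidean_space \<Rightarrow> complex) set" where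
  "Hs_space s = {U. U \<in> borel_measurable lborel \<and>
      integrable lborel (\<lambda>\<xi>. (1 + (norm \<xi>)\<^sup>2) powr s * (cmod (U \<xi>))\<^sup>2)}"

definition Hs_norm :: "real \<Rightarrow> real \<Rightarrow> ('a::euclidean_space \<Rightarrow> complex) \<Rightarrow> real" where
  "Hs_norm k s U = sqrt (integral\<^sup>L lborel (\<lambda>\<xi>. (k\<^sup>2 + (norm \<xi>)\<^sup>2) powr s * (cmod (U \<xi>))\<^sup>2))"

definition tHs :: "real \<Rightarrow> 'a::euclidean_space set \<Rightarrow> ('a \<Rightarrow> complex) set" where
  "tHs s \<Gamma> = {U \<in> Hs_space s. \<forall>\<epsilon>>0. \<exists>\<phi>\<in>test_funs \<Gamma>.
                  Hs_norm 1 s (\<lambda>\<xi>. U \<xi> - fourier \<phi> \<xi>) < \<epsilon>}"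

text \<open>Distributions on Gamma are represented as (anti)linear functionals on D(Gamma).
  The restriction of U in H^s(R^(n-1)) to Gamma acts by psi \<mapsto> <U, psi> (L2 pairing,
  computed on the Fourier side by Plancherel).\<close>
definition restr_Hs :: "('a::euclidean_space \<Rightarrow> complex) \<Rightarrow> ('a \<Rightarrow> complex) \<Rightarrow> complex" where
  "restr_Hs U \<psi> = integral\<^sup>L lborel (\<lambda>\<xi>. U \<xi> * cnj (fourier \<psi> \<xi>))"

definition fun_distr :: "'a::euclidean_space set \<Rightarrow> ('a \<Rightarrow> complex) \<Rightarrow> ('a \<Rightarrow> complex) \<Rightarrow> complex" where
  "fun_distr \<Gamma> f \<psi> = (LINT x:\<Gamma>|lborel. f x * cnj (\<psi> x))"

definition extensions :: "real \<Rightarrow> 'a::euclidean_space set \<Rightarrow> (('a \<Rightarrow> complex) \<Rightarrow> complex)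
     \<Rightarrow> ('a \<Rightarrow> complex) set" where
  "extensions s \<Gamma> v = {U \<in> Hs_space s. \<forall>\<psi>\<in>test_funs \<Gamma>. v \<psi> = restr_Hs U \<psi>}"

definition HsG :: "real \<Rightarrow> 'a::euclidean_space set \<Rightarrow> (('a \<Rightarrow> complex) \<Rightarrow> complex) set" where
  "HsG s \<Gamma> = {v. extensions s \<Gamma> v \<noteq> {}}"

definition HsG_norm :: "real \<Rightarrow> real \<Rightarrow> 'a::euclidean_space set
     \<Rightarrow> (('a \<Rightarrow> complex) \<Rightarrow> complex) \<Rightarrow> real" where
  "HsG_norm k s \<Gamma> v = Inf (Hs_norm k s ` extensions s \<Gamma> v)"

definition bessel_J0 :: "real \<Rightarrow> real" where
  "bessel_J0 x = (\<Sum>m. (-1) ^ m * (x / 2) ^ (2 * m) / (fact m)\<^sup>2)"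

definition bessel_Y0 :: "real \<Rightarrow> real" where
  "bessel_Y0 x = (2 / pi) * (ln (x / 2) + euler_mascheroni) * bessel_J0 x
     + (2 / pi) * (\<Sum>m. (-1) ^ m * harm (Suc m) * (x / 2) ^ (2 * Suc m) / (fact (Suc m))\<^sup>2)"

definition hankel10 :: "real \<Rightarrow> complex" where
  "hankel10 x = Complex (bessel_J0 x) (bessel_Y0 x)"

text \<open>Fundamental solution; DIM('a) = n - 1.\<close>
definition fund_sol :: "real \<Rightarrow> 'a::euclidean_space \<Rightarrow> 'a \<Rightarrow> complex" where
  "fund_sol k x y =
     (if DIM('a) = 2
      then cis (k * dist x y) / complex_of_real (4 * pi * dist x y)
      else \<i> / 4 * hankel10 (k * dist x y))"

definition single_layer :: "real \<Rightarrow> 'a::euclidean_space set \<Rightarrow> ('a \<Rightarrow> complex) \<Rightarrow> 'a \<Rightarrow> complex" where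
  "single_layer k \<Gamma> \<phi> x = (LINT y:\<Gamma>|lborel. fund_sol k x y * \<phi> y)"

end

theory Submission
  imports Defs "HOL-Probability.Characteristic_Functions" "HOL-Probability.Sinc_Integral" "HOL-Real_Asymp.Real_Asymp"
begin

text \<open>
  On the bounded set $\Gamma$ the operator $S_k$ coincides with convolution with the fundamental solution cut
  off sharply at distance $L$ (the diameter of $\Gamma$), hence with a Fourier multiplier $m$, and
  everything reduces to the pointwise bound of $|m(\xi)|$ by a constant times
  $(1 + (kL)^{1/2}) / (k^2 + |\xi|^2)^{1/2}$, with an additional logarithm in dimension one.
  After rescaling, $m$ is a one-dimensional oscillatory integral
  of a solution of Bessel's equation over $[0, kL]$: in dimension one the solution is the Hankel function itself,
  in dimension two it is the angular mean of the plane wave. Only two facts about the solution are used: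
  the decay $x^{-1/2}$, which follows from the monotonicity of an energy, and its behaviour at $0$. For
  $|\xi| \le k$ the decay suffices (after one integration by parts in dimension two), and for
  $|\xi| \ge k$ the factor $1/|\xi|$ is gained by integrating by parts (in dimension two with the help of Bessel's
  equation).
\<close>

section \<open>Oscillatory integrals of solutions of Bessel's equation\<close>

text \<open>The multiplier m depends on \<Gamma> only through L, because differences of points of
  \<Gamma> have norm at most L; this makes the constant uniform. Multiplication by m gains one order
  in the k-dependent norms for every s at once, with the same constant, and restricting m U to
  \<Gamma> defines the extended operator directly, without a density argument. The delicate
  frequencies are those with |\<xi>| near k, where the plane wave and the kernel oscillate in step.
  No cancellation beyond one integration by parts is sought there: integrating x^(-1/2) over [0, kL]
  produces the factor (kL)^(1/2). The logarithm has another origin. Y_0 behaves like (2/pi) ln x at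
  0, so the boundary term at x = kL is of size ln (2 + 1/(kL)) when kL is small. The derivative of
  Y_0 is not integrable at 0, but its singular part (2/pi)/x, paired with sin (s x), integrates to a
  sine integral, which is bounded. The sharp cut-off costs only boundary terms and leaves an exact
  solution of Bessel's equation inside the interval.\<close>

lemmas lint_cong = Bochner_Integration.integral_cong[OF refl]

lemma integrable_dominated:
  fixes f :: "'a \<Rightarrow> 'b::{banach, second_countable_topology}"
  assumes "integrable M g" "f \<in> borel_measurable M" "\<And>x. norm (f x) \<le> g x"
  shows "integrable M f"
  using assms(1,2)
  by (rule Bochner_Integration.integrable_bound) (use assms(3) in \<open>auto intro: order_trans[OF _ abs_ge_self]\<close>)

text \<open>The potential 1 + 1 / (4 x^2) of the equation for \<open>sqrt x * w x\<close> decreases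
  in x, so the energy cannot grow. A bounded energy of that function means decay x^(-1/2) of w and
  w' themselves.\<close>

lemma bessel_ode_decay:
  fixes w w' :: "real \<Rightarrow> real"
  assumes Dw: "\<And>x. x > 0 \<Longrightarrow> (w has_real_derivative w' x) (at x)"
    and Dw': "\<And>x. x > 0 \<Longrightarrow> (w' has_real_derivative - w' x / x - w x) (at x)"
    and M: "\<bar>w 1\<bar> \<le> M" "\<bar>w' 1\<bar> \<le> M"
    and x: "x \<ge> 1"
  shows "\<bar>w x\<bar> \<le> 3 * M / sqrt x" "\<bar>w' x\<bar> \<le> 3 * M / sqrt x"
proof -
  \<comment> \<open>\<open>E\<close> is the energy of \<open>v x = sqrt x * w x\<close>, which satisfies \<open>v'' + (1 + 1 / (4 * x^2)) * v = 0\<close>.\<close>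
  define E where "E x = x * (w' x)^2 + w x * w' x + x * (w x)^2 + (w x)^2 / (2 * x)" for x
  have M0: "M \<ge> 0" using M by linarith
  have DE: "(E has_real_derivative - (w y)\<^sup>2 / (2 * y^2)) (at y)" if y: "y > 0" for y
  proof -
    have "(E has_real_derivative
        (w' y)^2 + y * (2 * w' y * (- w' y / y - w y)) + (w' y * w' y + w y * (- w' y / y - w y))
        + ((w y)^2 + y * (2 * w y * w' y)) + (2 * w y * w' y * (2 * y) - (w y)^2 * 2) / (2 * y)^2) (at y)" (is "(_ has_real_derivative ?D) _")
      unfolding E_def using y
      by (auto intro!: derivative_eq_intros Dw Dw' simp: power2_eq_square)
    also have "?D = - (w y)\<^sup>2 / (2 * y^2)"
      using y by (simp add: field_simps power2_eq_square)
    finally show ?thesis .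
  qed
  have "E x \<le> E 1"
  proof (rule DERIV_nonpos_imp_nonincreasing[OF x])
    fix y :: real assume "1 \<le> y"
    then have "(E has_real_derivative - (w y)\<^sup>2 / (2 * y^2)) (at y)" by (intro DE) auto
    then show "\<exists>z. (E has_real_derivative z) (at y) \<and> z \<le> 0"
      by (intro exI[of _ "- (w y)\<^sup>2 / (2 * y^2)"]) simp
  qed
  have prod1: "w y * w' y \<le> ((w y)^2 + (w' y)^2) / 2" "- (w y * w' y) \<le> ((w y)^2 + (w' y)^2) / 2" for y
    using sum_squares_bound[of "w y" "w' y"] sum_squares_bound[of "- w y" "w' y"] by auto
  have sq: "(w 1)^2 \<le> M^2" "(w' 1)^2 \<le> M^2"
    using M by (auto simp: abs_le_square_iff[symmetric] M0)
  \<comment> \<open>The sum gives 7/2; the value is rounded up to 9/2 so that twice it is the square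
    of 3.\<close>
  have "E 1 \<le> 9/2 * M^2"
      proof -
    have "s1 + p + s2 + s2 / 2 \<le> 9/2 * m" if "p \<le> (s2 + s1) / 2" "s2 \<le> m" "s1 \<le> m" "0 \<le> m" for p s1 s2 m :: real
      using that by simp
    from this[OF prod1(1)[of 1] sq zero_le_power2] show ?thesis unfolding E_def by simp
  qed
  \<comment> \<open>For x \<ge> 1 the mixed term \<open>w x * w' x\<close> consumes at most half of
    the two main terms.\<close>
  moreover have "E x \<ge> (x / 2) * ((w x)^2 + (w' x)^2)"
  proof -
    have "(x - 1) / 2 * ((w x)^2 + (w' x)^2) \<ge> 0" "(w x)^2 / (2 * x) \<ge> 0"
      using x by auto
    then show ?thesis using prod1(2)[of x] unfolding E_def by (simp add: field_simps)
  qed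
  ultimately have "x * ((w x)^2 + (w' x)^2) \<le> 9 * M^2" using \<open>E x \<le> E 1\<close> by simp
  moreover have "x * (w x)^2 \<ge> 0" "x * (w' x)^2 \<ge> 0" using x by auto
  ultimately have "x * (w x)^2 \<le> 9 * M^2" "x * (w' x)^2 \<le> 9 * M^2" by (auto simp: distrib_left)
  then have "(sqrt x * w x)^2 \<le> (3 * M)^2" "(sqrt x * w' x)^2 \<le> (3 * M)^2"
    using x by (auto simp: power_mult_distrib)
  then have "\<bar>sqrt x * w x\<bar> \<le> 3 * M" "\<bar>sqrt x * w' x\<bar> \<le> 3 * M"
    using abs_le_square_iff[of "sqrt x * w x" "3 * M"] abs_le_square_iff[of "sqrt x * w' x" "3 * M"] M0 by auto
  then show "\<bar>w x\<bar> \<le> 3 * M / sqrt x" "\<bar>w' x\<bar> \<le> 3 * M / sqrt x"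
    using x by (auto simp: abs_mult field_simps)
qed

section \<open>Elementary estimates for oscillatory integrals\<close>

lemma has_integral_inverse_sqrt:
  assumes "a \<ge> 0"
  shows "((\<lambda>x. 1 / sqrt x) has_integral 2 * sqrt a) {0..a}"
proof -
  have "((\<lambda>x. 1 / sqrt x) has_integral 2 * sqrt a - 2 * sqrt 0) {0..a}"
    by (rule fundamental_theorem_of_calculus_interior)
       (use assms in \<open>auto intro!: continuous_intros derivative_eq_intros
          simp: has_real_derivative_iff_has_vector_derivative[symmetric] field_simps\<close>)
  then show ?thesis by simp
qed

lemma has_vector_derivative_cis:
  "(cis has_vector_derivative \<i> * cis x) (at x)"
proof -
  have "((\<lambda>x. cis x) has_derivative (\<lambda>t. (t * 1) *\<^sub>R (\<i> * cis x))) (at x)"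
    by (rule derivative_eq_intros | simp)+
  then show ?thesis by (simp add: has_vector_derivative_def)
qed

text \<open>The regimes s \<le> 1 and s \<ge> 1 yield bounds of size 1 and 1/s. Both are brought, at
  the price of a factor 2, to the form that becomes the Sobolev weight when s is |\<xi>| /
  k.\<close>

lemma sqrt_one_plus_square_bounds:
  fixes s :: real
  assumes "s \<ge> 0"
  shows "s \<le> 1 \<Longrightarrow> 1 \<le> 2 / sqrt (1 + s^2)" "s \<ge> 1 \<Longrightarrow> 1 / s \<le> 2 / sqrt (1 + s^2)"
proof -
  show "1 \<le> 2 / sqrt (1 + s^2)" if "s \<le> 1"
  proof -
    have "s^2 \<le> 1" using that assms by (simp add: power_le_one_iff abs_square_le_1)
    then have "sqrt (1 + s^2) \<le> sqrt 4" by (intro real_sqrt_le_mono) simp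
    moreover have "sqrt (1 + s^2) > 0" by (simp add: add_pos_nonneg)
    ultimately show ?thesis by (simp only: le_divide_eq) simp
  qed
  show "1 / s \<le> 2 / sqrt (1 + s^2)" if "s \<ge> 1"
  proof -
    have "1 \<le> s^2" using that by simp
    then have "sqrt (1 + s^2) \<le> sqrt ((2 * s)^2)" by (intro real_sqrt_le_mono) (simp add: power_mult_distrib)
    also have "\<dots> = 2 * s" using that by (subst real_sqrt_abs) simp
    finally have "sqrt (1 + s^2) \<le> 2 * s" .
    moreover have "sqrt (1 + s^2) > 0" by (simp add: add_pos_nonneg)
    ultimately have "2 / (2 * s) \<le> 2 / sqrt (1 + s^2)" using that by (intro divide_left_mono) auto
    then show ?thesis by simp
  qed
qed

lemma norm_integral_le_inverse_sqrt:
  fixes f :: "real \<Rightarrow> 'b::euclidean_space"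
  assumes "a \<ge> 0" "f integrable_on {0..a}" "\<And>x. 0 < x \<Longrightarrow> x \<le> a \<Longrightarrow> norm (f x) \<le> B / sqrt x"
  shows "norm (integral {0..a} f) \<le> 2 * B * sqrt a"
proof -
  \<comment> \<open>Since \<open>B / sqrt 0\<close> is 0, the pointwise bound can be used on the
    closed interval only after the value at 0 has been replaced by 0.\<close>
  define g where "g x = (if x = 0 then 0 else f x)" for x
  have "integral {0..a} f = integral {0..a} g"
    by (rule integral_spike[of "{0}"]) (auto simp: g_def)
  moreover have "g integrable_on {0..a}"
    by (rule integrable_spike[OF assms(2), of "{0}"]) (auto simp: g_def)
  then have "norm (integral {0..a} g) \<le> integral {0..a} (\<lambda>x. B * (1 / sqrt x))"
    using has_integral_mult_right[OF has_integral_inverse_sqrt[OF assms(1)], of B]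
    by (intro integral_norm_bound_integral) (auto simp: g_def intro!: assms(3))
  moreover have "integral {0..a} (\<lambda>x. B * (1 / sqrt x)) = B * (2 * sqrt a)"
    using has_integral_mult_right[OF has_integral_inverse_sqrt[OF assms(1)], of B] by (rule integral_unique)
  ultimately show ?thesis by simp
qed

text \<open>For dimension two, where w is the angular mean. For s \<le> 1 the exponential is
  integrated and w differentiated; for s \<ge> 1 Bessel's equation expresses w through derivatives
  of w', and the chain rule gains the factor 1/s.\<close>

lemma norm_integral_cis_bessel_le:
  fixes w w' :: "real \<Rightarrow> real"
  assumes Dw: "\<And>x. (w has_real_derivative w' x) (at x)"
    and cw': "continuous_on UNIV w'"
    and Dw': "\<And>x. x > 0 \<Longrightarrow> (w' has_real_derivative - w' x / x - w x) (at x)"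
    and B: "\<And>x. x \<ge> 0 \<Longrightarrow> \<bar>w x\<bar> \<le> B"
           "\<And>x. x \<ge> 0 \<Longrightarrow> \<bar>w' x\<bar> \<le> B" "\<And>x. x \<ge> 0 \<Longrightarrow> \<bar>w' x\<bar> \<le> B * x" "\<And>x. x > 0 \<Longrightarrow> \<bar>w' x\<bar> \<le> B / sqrt x"
    and a: "a \<ge> 0" and s: "s \<ge> 0"
  shows "cmod (integral {0..a} (\<lambda>x. cis x * of_real (w (s * x)))) \<le> 16 * B * (1 + sqrt a) / sqrt (1 + s^2)"
proof -
  have B0: "B \<ge> 0" using B(1)[of 0] by simp
  have cw: "continuous_on UNIV w" using Dw by (meson DERIV_isCont continuous_at_imp_continuous_on)
  note [continuous_intros] = continuous_on_compose2[OF cw] continuous_on_compose2[OF cw']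
  have vd: "((\<lambda>x. complex_of_real (w (s * x))) has_vector_derivative of_real (s * w' (s * x))) (at x)" for x
    using DERIV_chain2[OF Dw DERIV_cmult_Id[of s x]]
    by (intro has_vector_derivative_of_real) (simp add: mult.commute)
  have intw: "(\<lambda>x. cis x * of_real (w (s * x))) integrable_on {0..a}"
    by (intro integrable_continuous_real continuous_intros) auto
  have intw': "(\<lambda>x. cis x * of_real (w' (s * x))) integrable_on {0..a}"
    by (intro integrable_continuous_real continuous_intros) auto
  have sw': "\<bar>w' (s * x)\<bar> \<le> (B / sqrt s) / sqrt x" if "x > 0" "s > 0" for x
    using B(4)[of "s * x"] that by (simp add: real_sqrt_mult)
  have iw': "cmod (integral {0..a} (\<lambda>x. cis x * of_real (w' (s * x)))) \<le> 2 * (B / sqrt s) * sqrt a" if "s > 0"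
    using sw' that by (intro norm_integral_le_inverse_sqrt a intw') (auto simp: norm_mult)
  show ?thesis
  proof (cases "s \<le> 1")
    case True
    \<comment> \<open>The decay of w alone would give sqrt (a / s), which blows up as s tends to 0.
      Differentiating \<open>w (s * x)\<close> yields a factor s that outweighs the 1 / sqrt s
      coming from the decay of w'.\<close>
    have "((\<lambda>x. cis x * of_real (w (s * x)) + of_real s * (cis x * of_real (w' (s * x))) / \<i>) has_integral
           cis a * of_real (w (s * a)) / \<i> - cis 0 * of_real (w (s * 0)) / \<i>) {0..a}"
    proof (rule fundamental_theorem_of_calculus[OF a])
      fix x assume "x \<in> {0..a}"
      have "((\<lambda>x. cis x * complex_of_real (w (s * x)) / \<i>) has_vector_derivative
         (cis x * of_real (s * w' (s * x)) + \<i> * cis x * of_real (w (s * x))) / \<i>) (at x)"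
        by (intro has_vector_derivative_divide has_vector_derivative_mult vd has_vector_derivative_cis)
      moreover have "(cis x * of_real (s * w' (s * x)) + \<i> * cis x * of_real (w (s * x))) / \<i> =
        cis x * of_real (w (s * x)) + of_real s * (cis x * of_real (w' (s * x))) / \<i>"
        by (simp add: field_simps)
      ultimately show "((\<lambda>x. cis x * complex_of_real (w (s * x)) / \<i>) has_vector_derivative
        cis x * of_real (w (s * x)) + of_real s * (cis x * of_real (w' (s * x))) / \<i>) (at x within {0..a})"
        by (auto intro: has_vector_derivative_at_within)
    qed
    moreover have "((\<lambda>x. of_real s * (cis x * of_real (w' (s * x))) / \<i>) has_integral
        of_real s * integral {0..a} (\<lambda>x. cis x * of_real (w' (s * x))) / \<i>) {0..a}"
      by (intro has_integral_divide has_integral_mult_right integrable_integral intw')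
    ultimately have "((\<lambda>x. cis x * of_real (w (s * x))) has_integral
           (cis a * of_real (w (s * a)) / \<i> - cis 0 * of_real (w (s * 0)) / \<i>)
           - of_real s * integral {0..a} (\<lambda>x. cis x * of_real (w' (s * x))) / \<i>) {0..a}"
      by (drule_tac has_integral_diff) auto
    then have "integral {0..a} (\<lambda>x. cis x * of_real (w (s * x))) =
           (cis a * of_real (w (s * a)) / \<i> - cis 0 * of_real (w (s * 0)) / \<i>)
           - of_real s * integral {0..a} (\<lambda>x. cis x * of_real (w' (s * x))) / \<i>"
      by (rule integral_unique)
    also have "cmod \<dots> \<le> (\<bar>w (s * a)\<bar> + \<bar>w 0\<bar>) + s * cmod (integral {0..a} (\<lambda>x. cis x * of_real (w' (s * x))))"
      using s by (intro norm_triangle_ineq4[THEN order_trans] add_mono) (auto simp: norm_mult norm_divide)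
    also have "\<dots> \<le> (B + B) + 2 * B * sqrt a"
    proof (intro add_mono B)
      show "s * cmod (integral {0..a} (\<lambda>x. cis x * of_real (w' (s * x)))) \<le> 2 * B * sqrt a"
      proof (cases "s = 0")
        case False
        then have "s > 0" using s by simp
        have "s * cmod (integral {0..a} (\<lambda>x. cis x * of_real (w' (s * x)))) \<le> s * (2 * (B / sqrt s) * sqrt a)"
          using iw'[OF \<open>s > 0\<close>] s by (intro mult_left_mono) auto
        also have "\<dots> = sqrt s * (2 * B * sqrt a)" using \<open>s > 0\<close>
          by (simp add: field_simps)
        also have "\<dots> \<le> 1 * (2 * B * sqrt a)"
          using True s B0 a by (intro mult_right_mono) auto
        finally show ?thesis by simp
      qed (use B0 a in auto)
    qed (use a s in auto)
    \<comment> \<open>The 8 is dictated by the case s \<ge> 1, where the boundary terms contribute 2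
      and the integral of w'/x contributes 6. Passing to the common denominator doubles it to
      16.\<close>
    also have "\<dots> \<le> 8 * B * (1 + sqrt a) * 1" using B0 a by (simp add: algebra_simps)
    also have "\<dots> \<le> 8 * B * (1 + sqrt a) * (2 / sqrt (1 + s^2))"
      using sqrt_one_plus_square_bounds(1)[OF s True] B0 a by (intro mult_left_mono) auto
    finally show ?thesis by simp
  next
    case False
    then have s1: "s \<ge> 1" "s > 0" by auto
    \<comment> \<open>\<open>R\<close> is the derivative of \<open>- cis x * w' (s * x)\<close>,
      rewritten by Bessel's equation. Its first term is s times the wanted integrand; the other two
      are controlled by the bounds on w'.\<close>
    define R where "R x = of_real s * (cis x * of_real (w (s * x))) + cis x * of_real (w' (s * x) / x)
        - \<i> * (cis x * of_real (w' (s * x)))" for x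
    have R: "(R has_integral (- cis a * of_real (w' (s * a)) - - cis 0 * of_real (w' (s * 0)))) {0..a}"
    proof (rule fundamental_theorem_of_calculus_interior[OF a])
      show "continuous_on {0..a} (\<lambda>x. - cis x * complex_of_real (w' (s * x)))"
        by (intro continuous_intros) auto
      fix x assume x: "x \<in> {0<..<a}"
      have "((\<lambda>x. complex_of_real (w' (s * x))) has_vector_derivative of_real (s * (- w' (s * x) / (s * x) - w (s * x)))) (at x)"
        using x s1 DERIV_chain2[OF Dw' DERIV_cmult_Id[of s x]]
        by (intro has_vector_derivative_of_real) (simp add: mult.commute)
      then have "((\<lambda>x. - (cis x * complex_of_real (w' (s * x)))) has_vector_derivative
          - (cis x * of_real (s * (- w' (s * x) / (s * x) - w (s * x))) + \<i> * cis x * of_real (w' (s * x)))) (at x)"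
        by (intro has_vector_derivative_minus has_vector_derivative_mult has_vector_derivative_cis)
      moreover have "- (cis x * of_real (s * (- w' (s * x) / (s * x) - w (s * x))) + \<i> * cis x * of_real (w' (s * x))) = R x"
        using x s1 by (simp add: R_def field_simps)
      ultimately show "((\<lambda>x. - cis x * complex_of_real (w' (s * x))) has_vector_derivative R x) (at x)"
        by simp
    qed
    define q where "q x = cis x * complex_of_real (w' (s * x) / x)" for x
    have intR: "R integrable_on {0..a}" using R by blast
    \<comment> \<open>Continuity of \<open>q\<close> at 0 is not at hand; its integrability is
      inherited from \<open>R\<close>, which is integrable as a derivative.\<close>
    have "(\<lambda>x. R x - of_real s * (cis x * of_real (w (s * x))) + \<i> * (cis x * of_real (w' (s * x)))) integrable_on {0..a}"
      by (intro integrable_add integrable_diff intR integrable_on_mult_right intw intw')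
    then have intq: "q integrable_on {0..a}" by (simp add: R_def q_def[abs_def])
    have q: "cmod (integral {0..a} q) \<le> 6 * B"
    proof -
      \<comment> \<open>With y = s x, w'(y)/y is bounded for y \<le> 1 and decays like y^(-3/2) for
        y > 1. The function (1 + y)^(-3/2) majorises both regimes up to the factor 3 \<ge> 2^(3/2),
        and its explicit primitive gives a bound independent of s.\<close>
      have hi: "((\<lambda>x. 3 * B * s * (1 / (sqrt (1 + s * x)) ^ 3)) has_integral
           (- 6 * B / sqrt (1 + s * a) - (- 6 * B / sqrt (1 + s * 0)))) {0..a}"
      proof (rule fundamental_theorem_of_calculus[OF a])
        fix x assume "x \<in> {0..a}"
        then have "s * x \<ge> 0" using s by auto
        then have "((\<lambda>x. - 6 * B / sqrt (1 + s * x)) has_real_derivative 3 * B * s * (1 / (sqrt (1 + s * x)) ^ 3)) (at x)"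
          by (auto intro!: derivative_eq_intros simp: power3_eq_cube field_simps)
        then show "((\<lambda>x. - 6 * B / sqrt (1 + s * x)) has_vector_derivative 3 * B * s * (1 / (sqrt (1 + s * x)) ^ 3)) (at x within {0..a})"
          by (simp add: has_real_derivative_iff_has_vector_derivative has_vector_derivative_at_within)
      qed
      have "cmod (integral {0..a} q) \<le> integral {0..a} (\<lambda>x. 3 * B * s * (1 / (sqrt (1 + s * x)) ^ 3))"
      proof (rule integral_norm_bound_integral[OF intq])
        show "(\<lambda>x. 3 * B * s * (1 / (sqrt (1 + s * x)) ^ 3)) integrable_on {0..a}" using hi by blast
        fix x assume x: "x \<in> {0..a}"
        show "cmod (q x) \<le> 3 * B * s * (1 / (sqrt (1 + s * x)) ^ 3)"
        proof (cases "x = 0")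
          case True
          then show ?thesis using B0 s by (simp add: q_def)
        next
          case False
          then have x0: "x > 0" using x by simp
          define y where "y = s * x"
          have y0: "y > 0" using x0 s1 by (simp add: y_def)
          have sq: "sqrt (1 + y) \<le> sqrt 2 * (if y \<le> 1 then 1 else sqrt y)"
            using y0 by (auto simp flip: real_sqrt_mult)
          have p3: "(sqrt 2) ^ 3 \<le> (3::real)"
            using real_sqrt_le_mono[of 8 9] by (simp add: real_sqrt_power[symmetric])
          have "(sqrt (1 + y)) ^ 3 \<le> (sqrt 2) ^ 3 * (if y \<le> 1 then 1 else sqrt y) ^ 3"
            using power_mono[OF sq, of 3] y0 by (simp add: power_mult_distrib)
          also have "\<dots> \<le> 3 * (if y \<le> 1 then 1 else sqrt y) ^ 3"
            using p3 y0 by (intro mult_right_mono) auto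
          finally have s3: "(sqrt (1 + y)) ^ 3 \<le> 3 * (if y \<le> 1 then 1 else sqrt y) ^ 3" .
          have "\<bar>w' y\<bar> / y \<le> B * (1 / (if y \<le> 1 then 1 else sqrt y) ^ 3)"
          proof (cases "y \<le> 1")
            case True
            then show ?thesis using B(3)[of y] y0 by (simp add: field_simps)
          next
            case False
            have "sqrt y ^ 3 = y * sqrt y" using y0 by (simp add: power3_eq_cube)
            then show ?thesis using B(4)[of y] y0 False by (simp add: field_simps)
          qed
          also have "\<dots> \<le> B * (3 / (sqrt (1 + y)) ^ 3)"
            using s3 y0 B0 by (intro mult_left_mono) (auto simp: field_simps)
          finally have "\<bar>w' y\<bar> / y \<le> B * (3 / (sqrt (1 + y)) ^ 3)" .
          then have "s * (\<bar>w' y\<bar> / y) \<le> s * (B * (3 / (sqrt (1 + y)) ^ 3))"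
            using s1 by (intro mult_left_mono) auto
          moreover have "cmod (q x) = s * (\<bar>w' y\<bar> / y)"
            using x0 s1 by (simp add: q_def y_def norm_mult norm_divide)
          ultimately show ?thesis by (simp add: y_def mult_ac)
        qed
      qed
      also have "\<dots> = - 6 * B / sqrt (1 + s * a) - (- 6 * B / sqrt (1 + s * 0))"
        using hi by (rule integral_unique)
      also have "\<dots> \<le> 6 * B" using B0 a s by simp
      finally show ?thesis .
    qed
    have "(R has_integral of_real s * integral {0..a} (\<lambda>x. cis x * of_real (w (s * x))) + integral {0..a} q
         - \<i> * integral {0..a} (\<lambda>x. cis x * of_real (w' (s * x)))) {0..a}"
      unfolding R_def q_def[symmetric]
      by (intro has_integral_diff has_integral_add has_integral_mult_right integrable_integral intw intw' intq)
    then have eq: "of_real s * integral {0..a} (\<lambda>x. cis x * of_real (w (s * x))) =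
        (- cis a * of_real (w' (s * a)) + of_real (w' 0)) - integral {0..a} q
        + \<i> * integral {0..a} (\<lambda>x. cis x * of_real (w' (s * x)))"
      using has_integral_unique[OF R] by (simp add: algebra_simps)
    have "s * cmod (integral {0..a} (\<lambda>x. cis x * of_real (w (s * x)))) =
       cmod (of_real s * integral {0..a} (\<lambda>x. cis x * of_real (w (s * x))))"
      using s by (simp add: norm_mult)
    also have "\<dots> \<le> (\<bar>w' (s * a)\<bar> + \<bar>w' 0\<bar>) + cmod (integral {0..a} q)
        + cmod (integral {0..a} (\<lambda>x. cis x * of_real (w' (s * x))))"
      unfolding eq
      by (intro norm_triangle_ineq[THEN order_trans] norm_triangle_ineq4[THEN order_trans] add_mono) (auto simp: norm_mult)
    also have "\<dots> \<le> (B + B) + 6 * B + 2 * B * sqrt a"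
    proof (intro add_mono B q)
      have "2 * (B / sqrt s) * sqrt a \<le> 2 * (B / 1) * sqrt a"
        using s1 a B0 by (intro mult_right_mono mult_left_mono divide_left_mono) auto
      then show "cmod (integral {0..a} (\<lambda>x. cis x * of_real (w' (s * x)))) \<le> 2 * B * sqrt a"
        using iw' s1 by simp
    qed (use a s in auto)
    also have "\<dots> \<le> 8 * B * (1 + sqrt a)" using B0 a by (simp add: algebra_simps)
    finally have "cmod (integral {0..a} (\<lambda>x. cis x * of_real (w (s * x)))) \<le> 8 * B * (1 + sqrt a) * (1 / s)"
      using s1 by (simp add: field_simps)
    also have "\<dots> \<le> 8 * B * (1 + sqrt a) * (2 / sqrt (1 + s^2))"
      using sqrt_one_plus_square_bounds(2)[OF s s1(1)] B0 a by (intro mult_left_mono) auto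
    finally show ?thesis by simp
  qed
qed

text \<open>For dimension one, where w is J_0 (c = 0) or Y_0 (c = 2/pi). The non-integrable part c /
  x of the derivative meets \<open>sin (s * x)\<close> after the integration by parts and becomes a
  sine integral; the remainder b is integrable. For s \<ge> 1 the logarithmic bound on w is used
  only at the endpoint a.\<close>

lemma abs_integral_cos_log_le:
  fixes w b :: "real \<Rightarrow> real"
  assumes Dw: "\<And>x. x > 0 \<Longrightarrow> (w has_real_derivative c / x + b x) (at x)"
    and meas: "w \<in> borel_measurable borel"
    and B: "\<And>x. x > 0 \<Longrightarrow> \<bar>w x\<bar> \<le> B / sqrt x" "\<And>x. x > 0 \<Longrightarrow> \<bar>w x\<bar> \<le> B * ln (2 + 1 / x)"
           "\<And>x. x > 0 \<Longrightarrow> \<bar>b x\<bar> \<le> B / sqrt x" "\<bar>c\<bar> \<le> B"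
    and S: "\<And>x. \<bar>Si x\<bar> \<le> S"
    and a: "a > 0" and s: "s \<ge> 0"
  shows "\<bar>integral {0..a} (\<lambda>x. w x * cos (s * x))\<bar> \<le> B * (10 + 4 * S) * (ln (2 + 1 / a) * (1 + sqrt a)) / sqrt (1 + s^2)"
proof -
  have B0: "B \<ge> 0" using B(4) by linarith
  have S0: "S \<ge> 0" using S[of 0] by linarith
  define l where "l = ln (2 + 1 / a)"
  \<comment> \<open>A lower bound on the logarithm lets every term free of it be multiplied by 2
    l.\<close>
  have "1/2 \<le> ln (2::real)" using ln2_ge_two_thirds by simp
  also have "ln 2 \<le> l" unfolding l_def using a by (subst ln_le_cancel_iff) (auto simp: add_pos_pos)
  finally have l: "2 * l \<ge> 1" by simp
  have l1: "1 * (1 + sqrt a) \<le> 2 * l * (1 + sqrt a)" using l a by (intro mult_right_mono) auto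
  have intw: "(\<lambda>x. w x * cos (s * x)) integrable_on {0..a}"
  proof -
    \<comment> \<open>As w is only measurable and arbitrary at 0, integrability comes from the
      majorant B / sqrt x, whose value at 0 is 0; hence the modified value there.\<close>
    define v where "v x = (if x \<le> 0 then 0 else w x * cos (s * x))" for x
    have "v integrable_on {0..a}"
    proof (rule measurable_bounded_by_integrable_imp_integrable)
      have "v \<in> borel_measurable borel" unfolding v_def using meas by measurable
      then show "v \<in> borel_measurable (lebesgue_on {0..a})"
        by (simp add: measurable_completion measurable_restrict_space1)
      show "(\<lambda>x. B * (1 / sqrt x)) integrable_on {0..a}"
        using has_integral_mult_right[OF has_integral_inverse_sqrt[of a], of B] a by (auto intro: has_integral_integrable)
      fix x assume "x \<in> {0..a}"
      moreover have "\<bar>w x\<bar> * \<bar>cos (s * x)\<bar> \<le> (B / sqrt x) * 1" if "x > 0"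
        by (rule mult_mono) (use that B(1) abs_cos_le_one B0 in auto)
      ultimately show "norm (v x) \<le> B * (1 / sqrt x)" using B0 by (auto simp: v_def abs_mult)
    qed auto
    then show ?thesis by (rule integrable_spike[of _ _ "{0}"]) (auto simp: v_def)
  qed
  show ?thesis
  proof (cases "s \<le> 1")
    case True
    have "norm (integral {0..a} (\<lambda>x. w x * cos (s * x))) \<le> 2 * B * sqrt a"
    proof (rule norm_integral_le_inverse_sqrt[OF _ intw])
      fix x :: real assume "0 < x"
      then have "\<bar>w x\<bar> * \<bar>cos (s * x)\<bar> \<le> (B / sqrt x) * 1"
        by (intro mult_mono) (use B(1) abs_cos_le_one B0 in auto)
      then show "norm (w x * cos (s * x)) \<le> B / sqrt x" by (simp add: abs_mult)
    qed (use a in auto)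
    also have "\<dots> \<le> 2 * B * (1 * (1 + sqrt a))" using B0 by (intro mult_left_mono) auto
    also have "\<dots> \<le> 2 * B * (2 * l * (1 + sqrt a)) * 1" using l1 B0 by (simp only: mult_1_right) (intro mult_left_mono, auto)
    also have "\<dots> \<le> 2 * B * (2 * l * (1 + sqrt a)) * (2 / sqrt (1 + s^2))"
      using sqrt_one_plus_square_bounds(1)[OF s True] B0 a l by (intro mult_left_mono) auto
    also have "\<dots> = (B * (l * (1 + sqrt a))) * 8 / sqrt (1 + s^2)" by simp
    also have "\<dots> \<le> (B * (l * (1 + sqrt a))) * (10 + 4 * S) / sqrt (1 + s^2)"
      using B0 l a S0 by (intro divide_right_mono mult_left_mono) auto
    finally show ?thesis by (simp add: l_def mult_ac)
  next
    case False
    then have s1: "s \<ge> 1" "s > 0" by auto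
    \<comment> \<open>The term with \<open>Si\<close> removes c / x from the derivative of w, so
      that \<open>A\<close> differentiates to the wanted integrand plus
      \<open>b x * sin (s * x) / s\<close>.\<close>
    define A where "A x = (w x * sin (s * x) - c * Si (s * x)) / s" for x
    have Si0: "Si 0 = 0" using Si_neg[of 0] by simp
    have "((\<lambda>x. w x * cos (s * x) + b x * sin (s * x) / s) has_integral A a - A 0) {0..a}"
    proof (rule fundamental_theorem_of_calculus_interior)
      have dA: "(A has_real_derivative w x * cos (s * x) + b x * sin (s * x) / s) (at x)" if "x > 0" for x
      proof -
        have "(A has_real_derivative ((c / x + b x) * sin (s * x) + w x * (cos (s * x) * s)
             - c * (sinc (s * x) * s)) / s) (at x)" (is "(_ has_real_derivative ?D) _")
          unfolding A_def using s1 that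
          by (auto intro!: derivative_eq_intros Dw DERIV_chain2[OF DERIV_Si])
        also have "?D = w x * cos (s * x) + b x * sin (s * x) / s"
          using s1 that by (simp add: field_simps)
        finally show ?thesis .
      qed
      then show "(A has_vector_derivative w x * cos (s * x) + b x * sin (s * x) / s) (at x)" if "x \<in> {0<..<a}" for x
        using that by (simp add: has_real_derivative_iff_has_vector_derivative)
      have "continuous (at x within {0..a}) A" if x: "x \<in> {0..a}" for x
      proof (cases "x = 0")
        case False
        then show ?thesis using dA[of x] x by (auto intro: DERIV_isCont continuous_at_imp_continuous_at_within)
      next
        case True
        \<comment> \<open>Although w may be unbounded at 0, \<open>w x * sin (s * x)\<close> is of
          size sqrt x. The arbitrary value \<open>w 0\<close> does no harm, being multiplied by sin
          0.\<close>
        have t: "((\<lambda>x. w x * sin (s * x)) \<longlongrightarrow> 0) (at 0 within {0..a})"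
        proof (rule tendsto_0_le[where K = 1])
          show "((\<lambda>x. B * s * sqrt x) \<longlongrightarrow> 0) (at 0 within {0..a})"
            by (rule tendsto_eq_intros | simp)+
          have "norm (w y * sin (s * y)) \<le> norm (B * s * sqrt y) * 1" if "y > 0" for y
          proof -
            have "\<bar>w y\<bar> * \<bar>sin (s * y)\<bar> \<le> B / sqrt y * \<bar>s * y\<bar>"
              by (intro mult_mono B abs_sin_x_le_abs_x) (use B0 that in auto)
            also have "\<dots> = B * s * sqrt y" using that s1 by (simp add: field_simps)
            finally show ?thesis using B0 s1 that by (simp add: abs_mult)
          qed
          then show "\<forall>\<^sub>F x in at 0 within {0..a}. norm (w x * sin (s * x)) \<le> norm (B * s * sqrt x) * 1"
            by (auto simp: eventually_at_filter less_le)
        qed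
        have "((\<lambda>x. Si (s * x)) \<longlongrightarrow> Si (s * 0)) (at 0 within {0..a})"
          by (rule isCont_tendsto_compose[OF isCont_Si]) (rule tendsto_eq_intros | simp)+
        then have "(A \<longlongrightarrow> (0 - c * Si (s * 0)) / s) (at 0 within {0..a})"
          unfolding A_def using s1 by (intro tendsto_intros t) auto
        then show ?thesis using True by (simp add: continuous_within A_def)
      qed
      then show "continuous_on {0..a} A" by (simp add: continuous_on_eq_continuous_within)
    qed (use a in auto)
    moreover have "A 0 = 0" by (simp add: A_def Si0)
    ultimately have hi: "((\<lambda>x. w x * cos (s * x) + b x * sin (s * x) / s) has_integral A a) {0..a}" by simp
    define I where "I = integral {0..a} (\<lambda>x. w x * cos (s * x))"
    have hb: "((\<lambda>x. b x * sin (s * x) / s) has_integral A a - I) {0..a}"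
      using has_integral_diff[OF hi integrable_integral[OF intw]] by (simp add: I_def)
    have "norm (integral {0..a} (\<lambda>x. b x * sin (s * x) / s)) \<le> 2 * (B / s) * sqrt a"
    proof (rule norm_integral_le_inverse_sqrt)
      show "(\<lambda>x. b x * sin (s * x) / s) integrable_on {0..a}" using hb by blast
      fix x :: real assume x: "0 < x"
      have "\<bar>b x\<bar> * \<bar>sin (s * x)\<bar> \<le> (B / sqrt x) * 1"
        by (rule mult_mono) (use B(3) x abs_sin_le_one B0 in auto)
      then have "\<bar>b x\<bar> * \<bar>sin (s * x)\<bar> / s \<le> (B / sqrt x) / s"
        using s1 by (intro divide_right_mono) auto
      then show "norm (b x * sin (s * x) / s) \<le> B / s / sqrt x"
        using s1 by (simp add: abs_mult mult.commute)
    qed (use a in auto)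
    then have 1: "\<bar>A a - I\<bar> \<le> 2 * B * sqrt a / s" by (simp only: integral_unique[OF hb]) simp
    have "\<bar>w a * sin (s * a)\<bar> \<le> (B * l) * 1"
      unfolding abs_mult by (rule mult_mono) (use B(2)[OF a] abs_sin_le_one B0 l in \<open>auto simp: l_def[symmetric]\<close>)
    moreover have "\<bar>c * Si (s * a)\<bar> \<le> B * S" unfolding abs_mult by (rule mult_mono) (use B S B0 in auto)
    ultimately have "\<bar>w a * sin (s * a) - c * Si (s * a)\<bar> \<le> B * l + B * S" by linarith
    then have 2: "\<bar>A a\<bar> \<le> (B * l + B * S) / s"
      using s1 by (simp add: A_def divide_right_mono)
    have "\<bar>I\<bar> \<le> (B * l + B * S) / s + 2 * B * sqrt a / s" using 1 2 by linarith
    also have "\<dots> = B * (l + S * 1 + 2 * sqrt a) / s" by (simp add: add_divide_distrib algebra_simps)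
    \<comment> \<open>Because 1 \<le> 2 l, the term 2 sqrt a is at most 4 l sqrt a and S is at most
      2 S l (1 + sqrt a); the 5 leaves room for the term l as well.\<close>
    also have "\<dots> \<le> B * ((5 + 2 * S) * (l * (1 + sqrt a))) / s"
    proof (intro divide_right_mono mult_left_mono)
      have "S * 1 \<le> S * (2 * l * (1 + sqrt a))" using l1 S0 a by (intro mult_left_mono) (smt (verit) real_sqrt_ge_zero)
      moreover have "sqrt a * 1 \<le> sqrt a * (2 * l)" using l a by (intro mult_left_mono) auto
      moreover have "(5 + 2 * S) * (l * (1 + sqrt a)) = 5 * l + 5 / 2 * (sqrt a * (2 * l)) + S * (2 * l * (1 + sqrt a))"
        by (simp add: algebra_simps)
      ultimately show "l + S * 1 + 2 * sqrt a \<le> (5 + 2 * S) * (l * (1 + sqrt a))"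
        using l a real_sqrt_ge_zero[of a] by linarith
    qed (use B0 s1 in auto)
    also have "\<dots> = (B * ((5 + 2 * S) * (l * (1 + sqrt a)))) * (1 / s)" by simp
    also have "\<dots> \<le> (B * ((5 + 2 * S) * (l * (1 + sqrt a)))) * (2 / sqrt (1 + s^2))"
      using sqrt_one_plus_square_bounds(2)[OF s s1(1)] B0 S0 l a by (intro mult_left_mono) auto
    also have "\<dots> = B * (10 + 4 * S) * (l * (1 + sqrt a)) / sqrt (1 + s^2)"
      by (simp add: algebra_simps add_divide_distrib)
    finally show ?thesis by (simp add: I_def l_def)
  qed
qed

section \<open>The Bessel functions $J_0$ and $Y_0$\<close>

text \<open>In the variable y = x^2 / 4 Bessel's equation becomes y h'' + h' + h = 0, whose regular
  solution is entire, so that the equation is a recursion for coefficients. The inhomogeneity r is 0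
  for J_0; for the regular part of Y_0 it is the differentiated series of J_0.\<close>

lemma entire_bessel_ode:
  fixes c r :: "nat \<Rightarrow> real"
  assumes c: "\<And>y. summable (\<lambda>n. c n * y ^ n)"
    and rec: "\<And>n. real (Suc n) ^ 2 * c (Suc n) + c n + r n = 0"
  shows "y * (\<Sum>n. diffs (diffs c) n * y ^ n) + (\<Sum>n. diffs c n * y ^ n) + (\<Sum>n. c n * y ^ n)
          + (\<Sum>n. r n * y ^ n) = 0"
proof -
  have d: "\<And>y. summable (\<lambda>n. diffs c n * y ^ n)" by (rule termdiff_converges_all[OF c])
  have dd: "\<And>y. summable (\<lambda>n. diffs (diffs c) n * y ^ n)" by (rule termdiff_converges_all[OF d])
  have "(\<lambda>n. diffs (diffs c) n * y ^ n * y) sums ((\<Sum>n. diffs (diffs c) n * y ^ n) * y)"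
    by (intro sums_mult2 summable_sums dd)
  then have "(\<lambda>n. (\<lambda>n. real n * diffs c n * y ^ n) (Suc n)) sums ((\<Sum>n. diffs (diffs c) n * y ^ n) * y)"
    by (simp add: diffs_def mult_ac)
  then have 1: "(\<lambda>n. real n * diffs c n * y ^ n) sums (y * (\<Sum>n. diffs (diffs c) n * y ^ n))"
    by (subst (asm) sums_Suc_iff) (simp add: mult.commute)
  have "(\<lambda>n. real n * diffs c n * y ^ n + diffs c n * y ^ n + c n * y ^ n) sums
    (y * (\<Sum>n. diffs (diffs c) n * y ^ n) + (\<Sum>n. diffs c n * y ^ n) + (\<Sum>n. c n * y ^ n))"
    by (intro sums_add 1 summable_sums c d)
  moreover have "real n * diffs c n * y ^ n + diffs c n * y ^ n + c n * y ^ n = - (r n * y ^ n)" for n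
  proof -
    have "real n * diffs c n * y ^ n + diffs c n * y ^ n + c n * y ^ n
       = (real (Suc n) ^ 2 * c (Suc n) + c n + r n) * y ^ n - r n * y ^ n"
      by (simp add: diffs_def algebra_simps power2_eq_square)
    then show ?thesis using rec by simp
  qed
  ultimately have "(\<lambda>n. - (r n * y ^ n)) sums
    (y * (\<Sum>n. diffs (diffs c) n * y ^ n) + (\<Sum>n. diffs c n * y ^ n) + (\<Sum>n. c n * y ^ n))" by simp
  from sums_minus[OF this] show ?thesis by (simp add: sums_iff)
qed

definition j_coeff :: "nat \<Rightarrow> real" where
  "j_coeff n = (-1) ^ n / (fact n)^2"

text \<open>Coefficients of what remains of pi/2 Y_0 after removal of (ln (x/2) + gamma) J_0.
  Compared with \<open>bessel_Y0\<close> the index is shifted by one; the term n = 0 vanishes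
  because \<open>harm 0\<close> is 0.\<close>

definition y_coeff :: "nat \<Rightarrow> real" where
  "y_coeff n = (-1) ^ Suc n * harm n / (fact n)^2"

lemma summable_if_fact_bound:
  fixes c :: "nat \<Rightarrow> real"
  assumes "\<And>n. \<bar>c n\<bar> \<le> 1 / fact n"
  shows "summable (\<lambda>n. c n * y ^ n)"
proof (rule summable_comparison_test'[where N = 0])
  show "summable (\<lambda>n. inverse (fact n) * \<bar>y\<bar> ^ n)" by (rule summable_exp)
  show "norm (c n * y ^ n) \<le> inverse (fact n) * \<bar>y\<bar> ^ n" for n
    using mult_right_mono[OF assms[of n], of "\<bar>y\<bar> ^ n"] by (simp add: abs_mult power_abs divide_simps)
qed

lemma summable_j_coeff: "summable (\<lambda>n. j_coeff n * y ^ n)"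
proof (rule summable_if_fact_bound)
  fix n show "\<bar>j_coeff n\<bar> \<le> 1 / fact n"
    using fact_ge_1[of n, where 'a = real] by (simp add: j_coeff_def power2_eq_square divide_simps)
qed

lemma harm_le_of_nat: "harm n \<le> (of_nat n :: real)"
proof (induction n)
  case (Suc n)
  have "inverse (real (Suc n)) \<le> 1" by (simp add: divide_simps)
  then show ?case using Suc by (simp add: harm_Suc)
qed (simp add: harm_def)

lemma summable_y_coeff: "summable (\<lambda>n. y_coeff n * y ^ n)"
proof (rule summable_if_fact_bound)
  fix n
  have "harm n \<le> (fact n :: real)"
    using harm_le_of_nat[of n] fact_ge_self[of n] by (metis of_nat_fact of_nat_le_iff order_trans)
  moreover have "harm n \<ge> (0::real)" by (rule harm_nonneg)
  ultimately show "\<bar>y_coeff n\<bar> \<le> 1 / fact n"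
    by (simp add: y_coeff_def power2_eq_square abs_mult divide_simps)
qed

definition j_ser :: "real \<Rightarrow> real" where "j_ser y = (\<Sum>n. j_coeff n * y ^ n)"
definition j_ser' :: "real \<Rightarrow> real" where "j_ser' y = (\<Sum>n. diffs j_coeff n * y ^ n)"
definition j_ser'' :: "real \<Rightarrow> real" where "j_ser'' y = (\<Sum>n. diffs (diffs j_coeff) n * y ^ n)"
definition y_ser :: "real \<Rightarrow> real" where "y_ser y = (\<Sum>n. y_coeff n * y ^ n)"
definition y_ser' :: "real \<Rightarrow> real" where "y_ser' y = (\<Sum>n. diffs y_coeff n * y ^ n)"
definition y_ser'' :: "real \<Rightarrow> real" where "y_ser'' y = (\<Sum>n. diffs (diffs y_coeff) n * y ^ n)"

lemma DERIV_ser: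
  "(j_ser has_real_derivative j_ser' y) (at y)" "(j_ser' has_real_derivative j_ser'' y) (at y)"
  "(y_ser has_real_derivative y_ser' y) (at y)" "(y_ser' has_real_derivative y_ser'' y) (at y)"
  unfolding j_ser_def[abs_def] j_ser'_def[abs_def] j_ser''_def y_ser_def[abs_def] y_ser'_def[abs_def] y_ser''_def
  by (intro termdiffs_strong_converges_everywhere termdiff_converges_all summable_j_coeff summable_y_coeff)+

lemma j_ser_ode: "y * j_ser'' y + j_ser' y + j_ser y = 0"
proof -
  have "real (Suc n) ^ 2 * j_coeff (Suc n) + j_coeff n + 0 = 0" for n
    by (simp add: j_coeff_def power_mult_distrib del: of_nat_Suc)
  from entire_bessel_ode[OF summable_j_coeff this, of y] show ?thesis
    by (simp add: j_ser_def j_ser'_def j_ser''_def)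
qed

text \<open>The extra term \<open>j_ser'\<close> compensates the logarithm: Bessel's operator
  applied to ln (x/2) J_0 leaves 2 J_0' / x, which is \<open>j_ser' (x^2 / 4)\<close>.\<close>

lemma y_ser_ode: "y * y_ser'' y + y_ser' y + y_ser y + j_ser' y = 0"
proof -
  have "real (Suc n) ^ 2 * y_coeff (Suc n) + y_coeff n + diffs j_coeff n = 0" for n
    by (simp add: y_coeff_def j_coeff_def diffs_def harm_Suc power_mult_distrib del: of_nat_Suc)
       (simp add: field_simps power2_eq_square del: of_nat_Suc)
  from entire_bessel_ode[OF summable_y_coeff this, of y] show ?thesis
    by (simp add: y_ser_def y_ser'_def y_ser''_def j_ser'_def)
qed

lemma half_power: "(x / 2) ^ (2 * m) = (x^2 / 4 :: real) ^ m"
  by (simp add: power_mult power_divide)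

lemma bessel_J0_eq: "bessel_J0 x = j_ser (x^2 / 4)"
  by (simp add: bessel_J0_def j_ser_def j_coeff_def half_power)

lemma bessel_Y0_eq: "bessel_Y0 x = 2 / pi * ((ln (x / 2) + euler_mascheroni) * j_ser (x^2 / 4) + y_ser (x^2 / 4))"
proof -
  have "y_ser (x^2 / 4) = (\<Sum>m. y_coeff (Suc m) * (x^2 / 4) ^ Suc m)"
    unfolding y_ser_def using suminf_split_head[OF summable_y_coeff[of "x^2 / 4"]]
    by (simp add: y_coeff_def harm_def)
  also have "\<dots> = (\<Sum>m. (-1) ^ m * harm (Suc m) * (x / 2) ^ (2 * Suc m) / (fact (Suc m))^2)"
    by (intro suminf_cong) (simp add: y_coeff_def half_power del: fact_Suc mult_Suc_right power_Suc, simp)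
  finally show ?thesis
    by (simp add: bessel_Y0_def bessel_J0_eq[symmetric] algebra_simps del: fact_Suc power_Suc mult_Suc_right)
qed

section \<open>Derivatives of J_0 and Y_0 and their differential equation\<close>

definition J0' :: "real \<Rightarrow> real" where "J0' x = x / 2 * j_ser' (x^2 / 4)"
definition Y0' :: "real \<Rightarrow> real" where
  "Y0' x = 2 / pi * (j_ser (x^2 / 4) / x + (ln (x / 2) + euler_mascheroni) * J0' x + x / 2 * y_ser' (x^2 / 4))"

lemma DERIV_sq4:
  assumes "\<And>y. (h has_real_derivative h' y) (at y)"
  shows "((\<lambda>x. h (x^2 / 4)) has_real_derivative (x / 2 * h' (x^2 / 4))) (at x)"
proof -
  have "((\<lambda>x. x^2 / 4) has_real_derivative x / 2) (at x)"
    by (auto intro!: derivative_eq_intros)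
  from DERIV_chain2[OF assms this] show ?thesis by (simp add: mult.commute)
qed

lemma DERIV_J0: "(bessel_J0 has_real_derivative J0' x) (at x)"
  using DERIV_sq4[OF DERIV_ser(1)] by (simp add: bessel_J0_eq[abs_def] J0'_def)

lemma DERIV_J0':
  assumes "x > 0"
  shows "(J0' has_real_derivative - J0' x / x - bessel_J0 x) (at x)"
proof -
  have "(J0' has_real_derivative (1 / 2 * j_ser' (x^2 / 4) + x / 2 * (x / 2 * j_ser'' (x^2 / 4)))) (at x)"
    unfolding J0'_def[abs_def]
    by (rule derivative_eq_intros DERIV_sq4[OF DERIV_ser(2)] refl | simp)+
  moreover have "1 / 2 * j_ser' (x^2 / 4) + x / 2 * (x / 2 * j_ser'' (x^2 / 4)) = - J0' x / x - bessel_J0 x"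
    using j_ser_ode[of "x^2 / 4"] assms by (simp add: J0'_def bessel_J0_eq field_simps power2_eq_square)
  ultimately show ?thesis by simp
qed

lemma DERIV_Y0:
  assumes "x > 0"
  shows "(bessel_Y0 has_real_derivative Y0' x) (at x)"
proof -
  have "((\<lambda>x. 2 / pi * ((ln (x / 2) + euler_mascheroni) * bessel_J0 x + y_ser (x^2 / 4)))
     has_real_derivative 2 / pi * ((1 / x) * bessel_J0 x + (ln (x / 2) + euler_mascheroni) * J0' x + x / 2 * y_ser' (x^2 / 4))) (at x)"
    using assms by (auto intro!: derivative_eq_intros DERIV_sq4[OF DERIV_ser(3)] DERIV_J0)
  then show ?thesis by (simp add: bessel_Y0_eq[abs_def] Y0'_def bessel_J0_eq)
qed

lemma DERIV_Y0':
  assumes "x > 0"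
  shows "(Y0' has_real_derivative - Y0' x / x - bessel_Y0 x) (at x)"
proof -
  have "((\<lambda>x. 2 / pi * (bessel_J0 x / x + (ln (x / 2) + euler_mascheroni) * J0' x + x / 2 * y_ser' (x^2 / 4)))
     has_real_derivative 2 / pi * ((J0' x * x - bessel_J0 x) / (x * x)
        + ((1 / x) * J0' x + (ln (x / 2) + euler_mascheroni) * (- J0' x / x - bessel_J0 x))
        + (1 / 2 * y_ser' (x^2 / 4) + x / 2 * (x / 2 * y_ser'' (x^2 / 4))))) (at x)" (is "(_ has_real_derivative ?D) _")
    using assms by (auto intro!: derivative_eq_intros DERIV_sq4[OF DERIV_ser(4)] DERIV_J0 DERIV_J0' simp: mult_ac)
  moreover have "?D = - Y0' x / x - bessel_Y0 x"
  proof -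
    define l where "l = ln (x / 2) + euler_mascheroni"
    have y: "x / 2 * (x / 2 * y_ser'' (x^2 / 4)) = - y_ser' (x^2 / 4) - y_ser (x^2 / 4) - j_ser' (x^2 / 4)"
      using y_ser_ode[of "x^2 / 4"] by (simp add: power2_eq_square)
    show ?thesis unfolding y l_def[symmetric] Y0'_def bessel_Y0_eq
      using assms by (simp add: bessel_J0_eq J0'_def field_simps)
  qed
  ultimately show ?thesis by (simp add: Y0'_def[abs_def] bessel_J0_eq)
qed

text \<open>Estimates near 0 are read off the power series; their values at x = 1 serve as the
  initial data from which \<open>bessel_ode_decay\<close> continues them to all x > 1.\<close>

lemma bessel_global_bounds:
  fixes w w' :: "real \<Rightarrow> real"
  assumes Dw: "\<And>x. x > 0 \<Longrightarrow> (w has_real_derivative w' x) (at x)"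
    and Dw': "\<And>x. x > 0 \<Longrightarrow> (w' has_real_derivative - w' x / x - w x) (at x)"
    and M: "\<And>x. 0 < x \<Longrightarrow> x \<le> 1 \<Longrightarrow> \<bar>w x\<bar> \<le> M / sqrt x"
           "\<And>x. 0 < x \<Longrightarrow> x \<le> 1 \<Longrightarrow> \<bar>w x\<bar> \<le> M * ln (2 + 1 / x)"
           "\<And>x. 0 < x \<Longrightarrow> x \<le> 1 \<Longrightarrow> \<bar>w' x - c / x\<bar> \<le> M / sqrt x"
  obtains B where "\<And>x. x > 0 \<Longrightarrow> \<bar>w x\<bar> \<le> B / sqrt x" "\<And>x. x > 0 \<Longrightarrow> \<bar>w x\<bar> \<le> B * ln (2 + 1 / x)"
    "\<And>x. x > 0 \<Longrightarrow> \<bar>w' x - c / x\<bar> \<le> B / sqrt x" "\<bar>c\<bar> \<le> B"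
proof -
  \<comment> \<open>At x = 1 only w' - c is controlled by M, so |c| has to be added.\<close>
  define N where "N = M + \<bar>c\<bar>"
  have M0: "M \<ge> 0" using M(1)[of 1] by simp
  have N0: "N \<ge> 0" using M0 by (simp add: N_def)
  have "\<bar>w 1\<bar> \<le> N" "\<bar>w' 1\<bar> \<le> N" using M(1)[of 1] M(3)[of 1] by (auto simp: N_def)
  note decay = bessel_ode_decay[OF Dw Dw' this]
  \<comment> \<open>The decay lemma gives 3 N; the logarithm is only known to be at least 1/2, which
    doubles the constant.\<close>
  show ?thesis
  proof (rule that[of "6 * N"])
    have MN: "M \<le> 6 * N" and cN: "\<bar>c\<bar> \<le> N" using M0 by (auto simp: N_def)
    show "\<bar>c\<bar> \<le> 6 * N" using cN N0 by simp
    fix x :: real assume x: "x > 0"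
    show "\<bar>w x\<bar> \<le> 6 * N / sqrt x"
    proof (cases "x \<le> 1")
      case True
      then show ?thesis using order_trans[OF M(1)[OF x True] divide_right_mono[OF MN]] x by simp
    next
      case False
      then have "\<bar>w x\<bar> \<le> 3 * N / sqrt x" using decay(1)[of x] by simp
      also have "\<dots> \<le> 6 * N / sqrt x" using N0 x by (intro divide_right_mono) auto
      finally show ?thesis .
    qed
    have l: "ln (2 + 1 / x) \<ge> 1 / 2"
    proof -
      have "ln 2 \<le> ln (2 + 1 / x)" using x by (subst ln_le_cancel_iff) (auto simp: add_pos_pos)
      then show ?thesis using ln2_ge_two_thirds by simp
    qed
    show "\<bar>w x\<bar> \<le> 6 * N * ln (2 + 1 / x)"
    proof (cases "x \<le> 1")
      case True
      then show ?thesis using order_trans[OF M(2)[OF x True] mult_right_mono[OF MN]] l by simp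
    next
      case False
      then have "\<bar>w x\<bar> \<le> 3 * N / sqrt x" using decay(1)[of x] by simp
      also have "\<dots> \<le> 3 * N / 1" using N0 False by (intro divide_left_mono) auto
      also have "\<dots> \<le> 6 * N * ln (2 + 1 / x)" using mult_left_mono[OF l, of "6 * N"] N0 by simp
      finally show ?thesis .
    qed
    show "\<bar>w' x - c / x\<bar> \<le> 6 * N / sqrt x"
    proof (cases "x \<le> 1")
      case True
      then show ?thesis using order_trans[OF M(3)[OF x True] divide_right_mono[OF MN]] x by simp
    next
      case False
      then have "\<bar>w' x\<bar> \<le> 3 * N / sqrt x" using decay(2)[of x] by simp
      moreover have "\<bar>c / x\<bar> \<le> N / sqrt x"
      proof -
        have "sqrt x * 1 \<le> sqrt x * sqrt x" using False by (intro mult_left_mono) auto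
        then have "sqrt x \<le> x" using x by simp
        then have "\<bar>c\<bar> / x \<le> N / sqrt x" using cN N0 x by (intro frac_le) auto
        then show ?thesis using x by simp
      qed
      moreover have "3 * N / sqrt x + N / sqrt x \<le> 6 * N / sqrt x"
        using N0 x by (simp add: add_divide_distrib[symmetric] divide_right_mono)
      ultimately show ?thesis by linarith
    qed
  qed
qed

text \<open>The two facts about J_0 and Y_0 that leave this part: the pointwise bound makes the
  cut-off kernel integrable, the integral bound estimates its multiplier.\<close>

definition log_bessel_bound :: "real \<Rightarrow> (real \<Rightarrow> real) \<Rightarrow> bool" where
  "log_bessel_bound C w \<longleftrightarrow> C > 0 \<and> (\<forall>x>0. \<bar>w x\<bar> \<le> C / sqrt x) \<and>
     (\<forall>a>0. \<forall>s\<ge>0. \<bar>integral {0..a} (\<lambda>x. w x * cos (s * x))\<bar> \<le> C * (ln (2 + 1 / a) * (1 + sqrt a)) / sqrt (1 + s^2))"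

lemma bessel_log_bound:
  assumes Dw: "\<And>x. x > 0 \<Longrightarrow> (w has_real_derivative w' x) (at x)"
    and Dw': "\<And>x. x > 0 \<Longrightarrow> (w' has_real_derivative - w' x / x - w x) (at x)"
    and M: "\<And>x. 0 < x \<Longrightarrow> x \<le> 1 \<Longrightarrow> \<bar>w x\<bar> \<le> M / sqrt x"
           "\<And>x. 0 < x \<Longrightarrow> x \<le> 1 \<Longrightarrow> \<bar>w x\<bar> \<le> M * ln (2 + 1 / x)"
           "\<And>x. 0 < x \<Longrightarrow> x \<le> 1 \<Longrightarrow> \<bar>w' x - c / x\<bar> \<le> M / sqrt x"
    and meas: "w \<in> borel_measurable borel"
  shows "\<exists>C. log_bessel_bound C w"
proof (rule bessel_global_bounds[OF Dw Dw' M])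
  fix B assume B: "\<And>x. x > 0 \<Longrightarrow> \<bar>w x\<bar> \<le> B / sqrt x" "\<And>x. x > 0 \<Longrightarrow> \<bar>w x\<bar> \<le> B * ln (2 + 1 / x)"
    "\<And>x. x > 0 \<Longrightarrow> \<bar>w' x - c / x\<bar> \<le> B / sqrt x" "\<bar>c\<bar> \<le> B"
  obtain S where S: "\<And>x. \<bar>Si x\<bar> \<le> S" using bounded_Si by blast
  have S0: "S \<ge> 0" using S[of 0] by linarith
  have B0: "B \<ge> 0" using B(4) by linarith
  \<comment> \<open>The summand 1 makes C positive even if B is 0.\<close>
  define C where "C = B * (10 + 4 * S) + 1"
  have "B * 1 \<le> B * (10 + 4 * S)" using S0 B0 by (intro mult_left_mono) auto
  then have C: "C > 0" "B \<le> C" "B * (10 + 4 * S) \<le> C" using B0 by (auto simp: C_def)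
  have "\<bar>w x\<bar> \<le> C / sqrt x" if "x > 0" for x
    using B(1)[OF that] divide_right_mono[OF C(2), of "sqrt x"] that by simp
  moreover have "\<bar>integral {0..a} (\<lambda>x. w x * cos (s * x))\<bar> \<le> C * (ln (2 + 1 / a) * (1 + sqrt a)) / sqrt (1 + s^2)"
    if a: "a > 0" and s: "s \<ge> 0" for a s
  proof -
    have "ln (2 + 1 / a) \<ge> 0" using a by (intro ln_ge_zero) (simp add: add_increasing2)
    then have pos: "ln (2 + 1 / a) * (1 + sqrt a) \<ge> 0" using a by simp
    have "\<bar>integral {0..a} (\<lambda>x. w x * cos (s * x))\<bar> \<le> B * (10 + 4 * S) * (ln (2 + 1 / a) * (1 + sqrt a)) / sqrt (1 + s^2)"
      by (rule abs_integral_cos_log_le[where b = "\<lambda>x. w' x - c / x", OF _ meas B S a s]) (simp_all add: Dw)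
    also have "\<dots> \<le> C * (ln (2 + 1 / a) * (1 + sqrt a)) / sqrt (1 + s^2)"
      by (intro divide_right_mono mult_right_mono C pos) auto
    finally show ?thesis .
  qed
  ultimately show ?thesis using C(1) unfolding log_bessel_bound_def by blast
qed assumption+

lemma borel_measurable_J0 [measurable]: "bessel_J0 \<in> borel_measurable borel"
  unfolding bessel_J0_def[abs_def] by measurable

lemma borel_measurable_Y0 [measurable]: "bessel_Y0 \<in> borel_measurable borel"
  unfolding bessel_Y0_def[abs_def] by measurable

lemma abs_ln_le_inverse_sqrt:
  assumes "0 < x" "x \<le> (1::real)"
  shows "\<bar>ln x\<bar> \<le> 2 / sqrt x"
proof -
  have "ln (1 / sqrt x) \<le> 1 / sqrt x"
    using assms ln_le_minus_one[of "1 / sqrt x"] by simp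
  moreover have "ln (1 / sqrt x) = - ln x / 2" using assms by (simp add: ln_div ln_sqrt)
  ultimately have "- ln x \<le> 2 * (1 / sqrt x)" by linarith
  then show ?thesis using assms by simp
qed

text \<open>For 0 < x \<le> 1 the argument x^2 / 4 of the series stays in the compact interval
  [0, 1/4].\<close>

lemma ser_bounded:
  obtains M where "M \<ge> 1" "\<And>y. 0 \<le> y \<Longrightarrow> y \<le> 1/4 \<Longrightarrow> \<bar>j_ser y\<bar> \<le> M" "\<And>y. 0 \<le> y \<Longrightarrow> y \<le> 1/4 \<Longrightarrow> \<bar>j_ser' y\<bar> \<le> M"
    "\<And>y. 0 \<le> y \<Longrightarrow> y \<le> 1/4 \<Longrightarrow> \<bar>y_ser y\<bar> \<le> M" "\<And>y. 0 \<le> y \<Longrightarrow> y \<le> 1/4 \<Longrightarrow> \<bar>y_ser' y\<bar> \<le> M"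
proof -
  have ex: "\<exists>M. \<forall>y. 0 \<le> y \<and> y \<le> 1/4 \<longrightarrow> \<bar>h y\<bar> \<le> M" if "\<And>y. isCont h y" for h :: "real \<Rightarrow> real"
    by (rule isCont_bounded) (use that in auto)
  obtain M1 where M1: "\<forall>y. 0 \<le> y \<and> y \<le> 1/4 \<longrightarrow> \<bar>j_ser y\<bar> \<le> M1" using ex[OF DERIV_isCont[OF DERIV_ser(1)]] by blast
  obtain M2 where M2: "\<forall>y. 0 \<le> y \<and> y \<le> 1/4 \<longrightarrow> \<bar>j_ser' y\<bar> \<le> M2" using ex[OF DERIV_isCont[OF DERIV_ser(2)]] by blast
  obtain M3 where M3: "\<forall>y. 0 \<le> y \<and> y \<le> 1/4 \<longrightarrow> \<bar>y_ser y\<bar> \<le> M3" using ex[OF DERIV_isCont[OF DERIV_ser(3)]] by blast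
  obtain M4 where M4: "\<forall>y. 0 \<le> y \<and> y \<le> 1/4 \<longrightarrow> \<bar>y_ser' y\<bar> \<le> M4" using ex[OF DERIV_isCont[OF DERIV_ser(4)]] by blast
  define M where "M = 1 + \<bar>M1\<bar> + \<bar>M2\<bar> + \<bar>M3\<bar> + \<bar>M4\<bar>"
  show ?thesis
    by (rule that[of M]) (use M1 M2 M3 M4 in \<open>force simp: M_def\<close>)+
qed

lemma sq4_bounds: "0 < x \<Longrightarrow> x \<le> (1::real) \<Longrightarrow> 0 \<le> x^2 / 4 \<and> x^2 / 4 \<le> 1/4"
  by (simp add: power_le_one_iff)

lemma bessel_J0_bound: "\<exists>C. log_bessel_bound C bessel_J0"
proof -
  obtain M where M: "M \<ge> 1" "\<And>y. 0 \<le> y \<Longrightarrow> y \<le> 1/4 \<Longrightarrow> \<bar>j_ser y\<bar> \<le> M" "\<And>y. 0 \<le> y \<Longrightarrow> y \<le> 1/4 \<Longrightarrow> \<bar>j_ser' y\<bar> \<le> M"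
    by (rule ser_bounded) (blast intro: that)
  have J: "\<bar>bessel_J0 x\<bar> \<le> M" and J': "\<bar>J0' x\<bar> \<le> M" and s: "1 / sqrt x \<ge> 1" and l: "ln (2 + 1 / x) \<ge> 1 / 2" if x: "0 < x" "x \<le> 1" for x
  proof -
    show "\<bar>bessel_J0 x\<bar> \<le> M" using M(2) sq4_bounds[OF x] by (simp add: bessel_J0_eq)
    have "x / 2 * \<bar>j_ser' (x^2 / 4)\<bar> \<le> 1 * M"
      by (rule mult_mono) (use M sq4_bounds[OF x] x in auto)
    then show "\<bar>J0' x\<bar> \<le> M" using x by (simp add: J0'_def abs_mult)
    show "1 / sqrt x \<ge> 1" using x by simp
    have "ln 2 \<le> ln (2 + 1 / x)" using x by (subst ln_le_cancel_iff) (auto simp: add_pos_pos)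
    then show "ln (2 + 1 / x) \<ge> 1 / 2" using ln2_ge_two_thirds by simp
  qed
  have s2: "2 * M / sqrt x \<ge> M" "2 * M * ln (2 + 1 / x) \<ge> M" if x: "0 < x" "x \<le> 1" for x
    using mult_left_mono[OF s[OF x], of "2 * M"] mult_left_mono[OF l[OF x], of "2 * M"] M(1) by auto
  show ?thesis
  proof (rule bessel_log_bound[OF DERIV_J0 DERIV_J0', of "2 * M" 0])
    fix x :: real assume x: "0 < x" "x \<le> 1"
    show "\<bar>bessel_J0 x\<bar> \<le> 2 * M / sqrt x" by (rule order_trans[OF J[OF x] s2(1)[OF x]])
    show "\<bar>bessel_J0 x\<bar> \<le> 2 * M * ln (2 + 1 / x)" by (rule order_trans[OF J[OF x] s2(2)[OF x]])
    show "\<bar>J0' x - 0 / x\<bar> \<le> 2 * M / sqrt x" using order_trans[OF J'[OF x] s2(1)[OF x]] by simp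
  qed (assumption | rule borel_measurable_J0)+
qed

text \<open>Near 0 both Y_0 and Y_0' - (2/pi)/x are of size |ln x| + 1, which is bounded by a
  multiple of 1 / sqrt x and by a multiple of ln (2 + 1/x). The decay for x > 1 comes from the
  differential equation.\<close>

lemma bessel_Y0_bound: "\<exists>C. log_bessel_bound C bessel_Y0"
proof -
  obtain M where M: "M \<ge> 1" "\<And>y. 0 \<le> y \<Longrightarrow> y \<le> 1/4 \<Longrightarrow> \<bar>j_ser y\<bar> \<le> M" "\<And>y. 0 \<le> y \<Longrightarrow> y \<le> 1/4 \<Longrightarrow> \<bar>j_ser' y\<bar> \<le> M"
    "\<And>y. 0 \<le> y \<Longrightarrow> y \<le> 1/4 \<Longrightarrow> \<bar>y_ser y\<bar> \<le> M" "\<And>y. 0 \<le> y \<Longrightarrow> y \<le> 1/4 \<Longrightarrow> \<bar>y_ser' y\<bar> \<le> M"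
    by (rule ser_bounded) (blast intro: that)
  have p: "2 / pi \<le> 1" using pi_ge_two by simp
  have p0: "\<bar>2 / pi\<bar> = 2 / pi" by simp
  have aux: "\<bar>bessel_Y0 x\<bar> \<le> M * (\<bar>ln x\<bar> + 2)" "\<bar>Y0' x - (2 / pi) / x\<bar> \<le> M * (\<bar>ln x\<bar> + 3)"
    if x: "0 < x" "x \<le> 1" for x
  proof -
    have y: "0 \<le> x^2 / 4" "x^2 / 4 \<le> 1/4" using sq4_bounds[OF x] by auto
    have "\<bar>euler_mascheroni - ln 2\<bar> \<le> (1::real)"
      using euler_mascheroni_pos euler_mascheroni_less_13_over_22 ln_2_less_1 ln2_ge_two_thirds by auto
    then have L: "\<bar>ln (x / 2) + euler_mascheroni\<bar> \<le> \<bar>ln x\<bar> + 1"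
      using x abs_triangle_ineq[of "ln x" "euler_mascheroni - ln 2"] by (simp add: ln_div algebra_simps)
    have "\<bar>bessel_Y0 x\<bar> = 2 / pi * \<bar>(ln (x / 2) + euler_mascheroni) * j_ser (x^2 / 4) + y_ser (x^2 / 4)\<bar>"
      by (simp only: bessel_Y0_eq abs_mult p0)
    also have "\<dots> \<le> 1 * ((\<bar>ln x\<bar> + 1) * M + M)"
    proof (rule mult_mono[OF p])
      have "\<bar>(ln (x / 2) + euler_mascheroni) * j_ser (x^2 / 4)\<bar> \<le> (\<bar>ln x\<bar> + 1) * M"
        unfolding abs_mult by (rule mult_mono[OF L M(2)[OF y]]) auto
      then show "\<bar>(ln (x / 2) + euler_mascheroni) * j_ser (x^2 / 4) + y_ser (x^2 / 4)\<bar> \<le> (\<bar>ln x\<bar> + 1) * M + M"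
        using M(4)[OF y] by linarith
    qed auto
    finally show "\<bar>bessel_Y0 x\<bar> \<le> M * (\<bar>ln x\<bar> + 2)" by (simp add: algebra_simps)
    have J': "\<bar>J0' x\<bar> \<le> M"
    proof -
      have "x / 2 * \<bar>j_ser' (x^2 / 4)\<bar> \<le> 1 * M"
        by (rule mult_mono) (use M y x in auto)
      then show ?thesis using x by (simp add: J0'_def abs_mult)
    qed
    \<comment> \<open>Only the exact coefficient 2/pi cancels the pole: \<open>j_ser 0\<close> is 1,
      and by the mean value theorem the difference is of order x^2, so the quotient by x stays
      bounded.\<close>
    have j0: "\<bar>(j_ser (x^2 / 4) - 1) / x\<bar> \<le> M"
    proof -
      have "j_ser 0 = 1" by (simp add: j_ser_def powser_zero) (simp add: j_coeff_def)
      moreover obtain z where "0 < z" "z < x^2 / 4" "j_ser (x^2 / 4) - j_ser 0 = (x^2 / 4 - 0) * j_ser' z"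
        using MVT2[of 0 "x^2 / 4" j_ser j_ser'] DERIV_ser(1) x by auto
      moreover from this have "(x^2 / 4) * \<bar>j_ser' z\<bar> \<le> (x^2 / 4) * M"
        by (intro mult_left_mono M(3)) (use y in auto)
      ultimately have e: "j_ser (x^2 / 4) - 1 = (x^2 / 4) * j_ser' z" and le: "(x^2 / 4) * \<bar>j_ser' z\<bar> \<le> (x^2 / 4) * M"
        by simp_all
      have "\<bar>j_ser (x^2 / 4) - 1\<bar> = (x^2 / 4) * \<bar>j_ser' z\<bar>"
        unfolding e abs_mult using y by simp
      with le have "\<bar>j_ser (x^2 / 4) - 1\<bar> \<le> M * (x^2 / 4)" by (simp add: mult.commute)
      also have "\<dots> \<le> M * (x * 1)" using M x by (intro mult_left_mono) (auto simp: power2_eq_square)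
      finally have "\<bar>j_ser (x^2 / 4) - 1\<bar> \<le> M * x" by simp
      then show ?thesis using x by (simp add: pos_divide_le_eq)
    qed
    have "Y0' x - (2 / pi) / x = 2 / pi * ((j_ser (x^2 / 4) - 1) / x + (ln (x / 2) + euler_mascheroni) * J0' x + x / 2 * y_ser' (x^2 / 4))"
      by (simp add: Y0'_def diff_divide_distrib algebra_simps)
    also have "\<bar>\<dots>\<bar> = 2 / pi * \<bar>(j_ser (x^2 / 4) - 1) / x + (ln (x / 2) + euler_mascheroni) * J0' x + x / 2 * y_ser' (x^2 / 4)\<bar>"
      by (simp only: abs_mult[of "2 / pi"] p0)
    also have "\<dots> \<le> 1 * (M + (\<bar>ln x\<bar> + 1) * M + 1 * M)"
    proof (rule mult_mono[OF p])
      have "\<bar>(ln (x / 2) + euler_mascheroni) * J0' x\<bar> \<le> (\<bar>ln x\<bar> + 1) * M"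
        unfolding abs_mult by (rule mult_mono[OF L J']) auto
      moreover have "\<bar>x / 2 * y_ser' (x^2 / 4)\<bar> \<le> 1 * M"
        unfolding abs_mult by (rule mult_mono[OF _ M(5)[OF y]]) (use x in auto)
      ultimately show "\<bar>(j_ser (x^2 / 4) - 1) / x + (ln (x / 2) + euler_mascheroni) * J0' x + x / 2 * y_ser' (x^2 / 4)\<bar>
          \<le> M + (\<bar>ln x\<bar> + 1) * M + 1 * M"
        using j0 by linarith
    qed auto
    finally show "\<bar>Y0' x - (2 / pi) / x\<bar> \<le> M * (\<bar>ln x\<bar> + 3)" by (simp add: algebra_simps)
  qed
  have ls: "M * (\<bar>ln x\<bar> + 3) \<le> 7 * M / sqrt x" if x: "0 < x" "x \<le> 1" for x
  proof -
    have "1 \<le> 1 / sqrt x" using x by simp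
    then have "\<bar>ln x\<bar> + 3 \<le> 7 * (1 / sqrt x)" using abs_ln_le_inverse_sqrt[OF x] by linarith
    from mult_left_mono[OF this, of M] show ?thesis using M(1) by (simp add: mult_ac)
  qed
  \<comment> \<open>Source of the 7: with l = ln (2 + 1/x) one has |ln x| \<le> l and, as l \<ge>
    1/2, also 3 \<le> 6 l.\<close>
  have ll: "M * (\<bar>ln x\<bar> + 3) \<le> 7 * M * ln (2 + 1 / x)" if x: "0 < x" "x \<le> 1" for x
  proof -
    have "ln 2 \<le> ln (2 + 1 / x)" using x by (subst ln_le_cancel_iff) (auto simp: add_pos_pos)
    then have "ln (2 + 1 / x) \<ge> 1 / 2" using ln2_ge_two_thirds by simp
    moreover have "ln (1 / x) \<le> ln (2 + 1 / x)" using x by (subst ln_le_cancel_iff) (auto simp: add_pos_pos)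
    moreover have "ln (1 / x) = \<bar>ln x\<bar>" using x ln_le_zero_iff[of x] by (subst ln_div) auto
    ultimately have "\<bar>ln x\<bar> + 3 \<le> 7 * ln (2 + 1 / x)" by linarith
    from mult_left_mono[OF this, of M] show ?thesis using M(1) by (simp add: mult_ac)
  qed
  have M23: "M * (\<bar>ln x\<bar> + 2) \<le> M * (\<bar>ln x\<bar> + 3)" for x using M(1) by (intro mult_left_mono) auto
  show ?thesis
  proof (rule bessel_log_bound[OF DERIV_Y0 DERIV_Y0', of "7 * M" "2 / pi"])
    fix x :: real assume x: "0 < x" "x \<le> 1"
    show "\<bar>bessel_Y0 x\<bar> \<le> 7 * M / sqrt x"
      by (rule order_trans[OF order_trans[OF aux(1)[OF x] M23] ls[OF x]])
    show "\<bar>bessel_Y0 x\<bar> \<le> 7 * M * ln (2 + 1 / x)"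
      by (rule order_trans[OF order_trans[OF aux(1)[OF x] M23] ll[OF x]])
    show "\<bar>Y0' x - 2 / pi / x\<bar> \<le> 7 * M / sqrt x"
      by (rule order_trans[OF aux(2)[OF x] ls[OF x]])
  qed (assumption | rule borel_measurable_Y0)+
qed

lemma log_bessel_bound_mono: "log_bessel_bound C w \<Longrightarrow> C \<le> D \<Longrightarrow> log_bessel_bound D w"
proof -
  assume C: "log_bessel_bound C w" and D: "C \<le> D"
  have "C / sqrt x \<le> D / sqrt x" if "x > 0" for x using D that by (intro divide_right_mono) auto
  moreover have "C * (ln (2 + 1 / a) * (1 + sqrt a)) / sqrt (1 + s^2) \<le> D * (ln (2 + 1 / a) * (1 + sqrt a)) / sqrt (1 + s^2)"
    if "a > 0" for a s :: real
    using D that by (intro divide_right_mono mult_right_mono mult_nonneg_nonneg ln_ge_zero) (auto simp: add_increasing2)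
  ultimately show ?thesis using C D unfolding log_bessel_bound_def by (meson less_le_trans order_trans)
qed

section \<open>Polar coordinates\<close>

lemma lborel_DIM1:
  assumes "DIM('a::euclidean_space) = 1"
  obtains b :: "'a::euclidean_space" where "Basis = {b}" "lborel = distr lborel borel (\<lambda>t::real. t *\<^sub>R b)"
proof -
  obtain b :: 'a where b: "Basis = {b}" using assms by (auto simp: card_1_singleton_iff)
  then have "b \<in> Basis" by (metis insertI1)
  then have bb: "b \<bullet> b = 1" by simp
  have "(lborel :: 'a measure) = distr lborel borel (\<lambda>t::real. t *\<^sub>R b)"
  proof (rule lborel_eqI)
    fix l u :: 'a assume le: "\<And>b. b \<in> Basis \<Longrightarrow> l \<bullet> b \<le> u \<bullet> b"
    have "(\<lambda>t::real. t *\<^sub>R b) -` box l u = {l \<bullet> b<..<u \<bullet> b}"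
      unfolding box_def b using bb by auto
    moreover have "l \<bullet> b \<le> u \<bullet> b" by (rule le) (simp add: b)
    ultimately show "emeasure (distr lborel borel (\<lambda>t::real. t *\<^sub>R b)) (box l u) = ennreal (\<Prod>b\<in>Basis. (u - l) \<bullet> b)"
      unfolding b by (subst emeasure_distr) (auto simp: inner_diff_left)
  qed simp
  with b show thesis by (rule that)
qed

lemma lborel_DIM2:
  assumes "DIM('a::euclidean_space) = 2"
  obtains b c :: "'a::euclidean_space" where "Basis = {b, c}" "b \<noteq> c"
    "lborel = distr (lborel \<Otimes>\<^sub>M lborel) borel (\<lambda>(s::real, t::real). s *\<^sub>R b + t *\<^sub>R c)"
proof -
  obtain b c :: 'a where b: "Basis = {b, c}" "b \<noteq> c" using assms by (auto simp: card_2_iff)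
  then have "b \<in> Basis" "c \<in> Basis" by (metis insertI1 insertI2)+
  then have bb: "b \<bullet> b = 1" "c \<bullet> c = 1" "b \<bullet> c = 0" "c \<bullet> b = 0" using b(2) by (simp_all add: inner_Basis)
  have "(lborel :: 'a measure) = distr (lborel \<Otimes>\<^sub>M lborel) borel (\<lambda>(s::real, t::real). s *\<^sub>R b + t *\<^sub>R c)"
  proof (rule lborel_eqI)
    fix l u :: 'a assume le: "\<And>b. b \<in> Basis \<Longrightarrow> l \<bullet> b \<le> u \<bullet> b"
    have lu: "l \<bullet> b \<le> u \<bullet> b" "l \<bullet> c \<le> u \<bullet> c" by (rule le, simp add: b)+
    have "(\<lambda>(s::real, t::real). s *\<^sub>R b + t *\<^sub>R c) -` box l u = {l \<bullet> b<..<u \<bullet> b} \<times> {l \<bullet> c<..<u \<bullet> c}"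
      unfolding box_def b(1) using bb by (auto simp: inner_add_left)
    then have "emeasure (distr (lborel \<Otimes>\<^sub>M lborel) borel (\<lambda>(s::real, t::real). s *\<^sub>R b + t *\<^sub>R c)) (box l u)
       = emeasure (lborel \<Otimes>\<^sub>M lborel) ({l \<bullet> b<..<u \<bullet> b} \<times> {l \<bullet> c<..<u \<bullet> c})"
      by (subst emeasure_distr) (auto simp: space_pair_measure)
    also have "\<dots> = ennreal ((u - l) \<bullet> b) * ennreal ((u - l) \<bullet> c)"
      using lu by (subst lborel.emeasure_pair_measure_Times) (auto simp: inner_diff_left)
    also have "\<dots> = ennreal (\<Prod>b\<in>Basis. (u - l) \<bullet> b)"
      unfolding b(1) using lu b(2) by (simp add: ennreal_mult inner_diff_left)
    finally show "emeasure (distr (lborel \<Otimes>\<^sub>M lborel) borel (\<lambda>(s::real, t::real). s *\<^sub>R b + t *\<^sub>R c)) (box l u)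
       = ennreal (\<Prod>b\<in>Basis. (u - l) \<bullet> b)" .
  qed simp
  with b show thesis by (rule that)
qed

text \<open>Polar coordinates in which the angle is replaced by its cotangent $u$ and the radius $r$ carries a sign:
  only linear substitutions in one variable are needed.\<close>
lemma nn_integral_polar:
  fixes f :: "real \<times> real \<Rightarrow> ennreal"
  assumes [measurable]: "f \<in> borel_measurable (lborel \<Otimes>\<^sub>M lborel)"
  shows "(\<integral>\<^sup>+z. f z \<partial>(lborel \<Otimes>\<^sub>M lborel)) =
    (\<integral>\<^sup>+(u, r). ennreal (\<bar>r\<bar> / (1 + u^2)) * f (r * u / sqrt (1 + u^2), r / sqrt (1 + u^2)) \<partial>(lborel \<Otimes>\<^sub>M lborel))"
proof -
  have "(\<integral>\<^sup>+z. f z \<partial>(lborel \<Otimes>\<^sub>M lborel)) = (\<integral>\<^sup>+t. \<integral>\<^sup>+s. f (s, t) \<partial>lborel \<partial>lborel)"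
    by (rule lborel_pair.nn_integral_snd[symmetric]) measurable
  also have "\<dots> = (\<integral>\<^sup>+t. \<integral>\<^sup>+u. ennreal \<bar>t\<bar> * f (t * u, t) \<partial>lborel \<partial>lborel)"
  proof (rule nn_integral_cong_AE)
    \<comment> \<open>For fixed t the substitution is s = t u, which degenerates only on the null
      set t = 0.\<close>
    have "AE t in lborel. t \<noteq> (0::real)" by (rule AE_lborel_singleton)
    then show "AE t in lborel. (\<integral>\<^sup>+s. f (s, t) \<partial>lborel) = (\<integral>\<^sup>+u. ennreal \<bar>t\<bar> * f (t * u, t) \<partial>lborel)"
    proof eventually_elim
      case (elim t)
      have "(\<integral>\<^sup>+s. f (s, t) \<partial>lborel) = ennreal \<bar>t\<bar> * (\<integral>\<^sup>+u. f (0 + t * u, t) \<partial>lborel)"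
        by (rule nn_integral_real_affine[OF _ elim]) measurable
      then show ?case by (simp add: nn_integral_cmult)
    qed
  qed
  also have "\<dots> = (\<integral>\<^sup>+u. \<integral>\<^sup>+t. ennreal \<bar>t\<bar> * f (t * u, t) \<partial>lborel \<partial>lborel)"
    by (rule lborel_pair.Fubini') measurable
  also have "\<dots> = (\<integral>\<^sup>+u. \<integral>\<^sup>+r. ennreal (\<bar>r\<bar> / (1 + u^2)) * f (r * u / sqrt (1 + u^2), r / sqrt (1 + u^2)) \<partial>lborel \<partial>lborel)"
  proof (rule nn_integral_cong)
    \<comment> \<open>For fixed u the substitution is t = r / sqrt (1 + u^2), after which |r| is the
      distance to the origin. Its Jacobian and the factor |t| combine to |r| / (1 + u^2).\<close>
    fix u :: real
    have c: "1 + u^2 > 0" by (simp add: add_pos_nonneg)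
    then have c0: "1 / sqrt (1 + u^2) \<noteq> 0" by simp
    have "(\<integral>\<^sup>+t. ennreal \<bar>t\<bar> * f (t * u, t) \<partial>lborel)
      = ennreal \<bar>1 / sqrt (1 + u^2)\<bar> * (\<integral>\<^sup>+r. ennreal \<bar>0 + 1 / sqrt (1 + u^2) * r\<bar> *
           f ((0 + 1 / sqrt (1 + u^2) * r) * u, 0 + 1 / sqrt (1 + u^2) * r) \<partial>lborel)"
      by (rule nn_integral_real_affine[OF _ c0]) measurable
    also have "\<dots> = (\<integral>\<^sup>+r. ennreal \<bar>1 / sqrt (1 + u^2)\<bar> * (ennreal \<bar>1 / sqrt (1 + u^2) * r\<bar> *
           f (1 / sqrt (1 + u^2) * r * u, 1 / sqrt (1 + u^2) * r)) \<partial>lborel)"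
      by (subst nn_integral_cmult[symmetric]) simp_all
    also have "\<dots> = (\<integral>\<^sup>+r. ennreal (\<bar>r\<bar> / (1 + u^2)) * f (r * u / sqrt (1 + u^2), r / sqrt (1 + u^2)) \<partial>lborel)"
    proof (rule nn_integral_cong)
      fix r :: real
      have "ennreal \<bar>1 / sqrt (1 + u^2)\<bar> * ennreal \<bar>1 / sqrt (1 + u^2) * r\<bar> = ennreal (\<bar>r\<bar> / (1 + u^2))"
        using c by (subst ennreal_mult[symmetric]) (auto simp: abs_mult)
      then show "ennreal \<bar>1 / sqrt (1 + u^2)\<bar> * (ennreal \<bar>1 / sqrt (1 + u^2) * r\<bar> *
           f (1 / sqrt (1 + u^2) * r * u, 1 / sqrt (1 + u^2) * r))
         = ennreal (\<bar>r\<bar> / (1 + u^2)) * f (r * u / sqrt (1 + u^2), r / sqrt (1 + u^2))"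
        by (simp add: mult.assoc[symmetric])
    qed
    finally show "(\<integral>\<^sup>+t. ennreal \<bar>t\<bar> * f (t * u, t) \<partial>lborel) =
      (\<integral>\<^sup>+r. ennreal (\<bar>r\<bar> / (1 + u^2)) * f (r * u / sqrt (1 + u^2), r / sqrt (1 + u^2)) \<partial>lborel)" .
  qed
  also have "\<dots> = (\<integral>\<^sup>+(u, r). ennreal (\<bar>r\<bar> / (1 + u^2)) * f (r * u / sqrt (1 + u^2), r / sqrt (1 + u^2)) \<partial>(lborel \<Otimes>\<^sub>M lborel))"
    by (subst lborel.nn_integral_fst[symmetric]) (auto intro!: borel_measurable_times_ennreal measurable_compose[OF _ assms] simp: case_prod_beta)
  finally show ?thesis .
qed

text \<open>An identity of measures serves integrability and complex-valued integrals alike, whereas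
  the substitution itself was proved for nonnegative integrands.\<close>

lemma lborel_polar:
  assumes "DIM('a::euclidean_space) = 2"
  obtains b c :: "'a::euclidean_space" where "Basis = {b, c}" "b \<noteq> c"
    "lborel = distr (density (lborel \<Otimes>\<^sub>M lborel) (\<lambda>(u, r). ennreal (\<bar>r\<bar> / (1 + u^2)))) borel
       (\<lambda>(u::real, r::real). (r / sqrt (1 + u^2)) *\<^sub>R (u *\<^sub>R b + c))"
proof -
  obtain b c :: 'a where b: "Basis = {b, c}" "b \<noteq> c"
    and eq: "lborel = distr (lborel \<Otimes>\<^sub>M lborel) borel (\<lambda>(s::real, t::real). s *\<^sub>R b + t *\<^sub>R c)"
    using lborel_DIM2[OF assms] by blast
  have "(lborel :: 'a measure) = distr (density (lborel \<Otimes>\<^sub>M lborel) (\<lambda>(u, r). ennreal (\<bar>r\<bar> / (1 + u^2)))) borel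
       (\<lambda>(u::real, r::real). (r / sqrt (1 + u^2)) *\<^sub>R (u *\<^sub>R b + c))" (is "_ = ?D")
  proof (rule measure_eqI)
    fix A :: "'a set" assume "A \<in> sets lborel"
    then have [measurable]: "A \<in> sets borel" by simp
    have "emeasure lborel A = (\<integral>\<^sup>+z. indicator A z \<partial>lborel)" by simp
    also have "\<dots> = (\<integral>\<^sup>+z. indicator A (case z of (s, t) \<Rightarrow> s *\<^sub>R b + t *\<^sub>R c) \<partial>(lborel \<Otimes>\<^sub>M lborel))"
      by (subst eq, subst nn_integral_distr) auto
    also have "\<dots> = (\<integral>\<^sup>+(u, r). ennreal (\<bar>r\<bar> / (1 + u^2)) * indicator A ((r * u / sqrt (1 + u^2)) *\<^sub>R b + (r / sqrt (1 + u^2)) *\<^sub>R c)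
          \<partial>(lborel \<Otimes>\<^sub>M lborel))"
      by (subst nn_integral_polar) (auto simp: case_prod_beta)
    also have "\<dots> = (\<integral>\<^sup>+z. (case z of (u, r) \<Rightarrow> ennreal (\<bar>r\<bar> / (1 + u^2))) *
          indicator A (case z of (u, r) \<Rightarrow> (r / sqrt (1 + u^2)) *\<^sub>R (u *\<^sub>R b + c)) \<partial>(lborel \<Otimes>\<^sub>M lborel))"
      by (intro nn_integral_cong) (auto simp: scaleR_add_right)
    also have "\<dots> = (\<integral>\<^sup>+z. indicator A z \<partial>?D)"
      by (subst nn_integral_distr, measurable, subst nn_integral_density) (auto simp: case_prod_beta)
    also have "\<dots> = emeasure ?D A" by simp
    finally show "emeasure lborel A = emeasure ?D A" .
  qed simp
  with b show thesis by (rule that)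
qed

section \<open>The angular measure and differentiation under the integral\<close>

lemma integrable_inverse_1_plus_sq: "integrable lborel (\<lambda>u::real. 1 / (1 + u^2))"
  and integral_inverse_1_plus_sq: "(LBINT u. 1 / (1 + u^2)) = pi"
  using integrable_inverse_1_plus_square LBINT_inverse_1_plus_square
  by (simp_all add: set_integrable_def interval_lebesgue_integral_def set_lebesgue_integral_def inverse_eq_divide)

lemma cis_approx: "cmod (cis x - 1 - \<i> * of_real x) \<le> x^2 / 2"
  using iexp_approx1[of x 1] by (simp add: cis_conv_exp power2_eq_square algebra_simps)

text \<open>Taylor's formula bounds the error of the difference quotient by |h| times the integral
  of |g|, so the limit follows from one explicit estimate instead of a convergence theorem.\<close>

lemma has_vector_derivative_integral_cis:
  fixes g p :: "real \<Rightarrow> real"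
  assumes g: "integrable lborel g" and [measurable]: "p \<in> borel_measurable borel" and p: "\<And>u. \<bar>p u\<bar> \<le> 1"
  shows "((\<lambda>y. LBINT u. of_real (g u) * cis (y * p u)) has_vector_derivative
     (LBINT u. \<i> * (of_real (g u * p u) * cis (y * p u)))) (at y)"
proof -
  have [measurable]: "g \<in> borel_measurable borel" using g by auto
  define F where "F y = (LBINT u. of_real (g u) * cis (y * p u))" for y
  define D where "D = (LBINT u. \<i> * (of_real (g u * p u) * cis (y * p u)))"
  have gp: "\<bar>g u * p u\<bar> \<le> \<bar>g u\<bar>" for u using mult_left_mono[OF p[of u], of "\<bar>g u\<bar>"] by (simp add: abs_mult)
  have int1: "integrable lborel (\<lambda>u. complex_of_real (g u) * cis (y * p u))" for y
    by (rule Bochner_Integration.integrable_bound[OF g]) (auto simp: norm_mult cis_conv_exp)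
  have int2: "integrable lborel (\<lambda>u. \<i> * (complex_of_real (g u * p u) * cis (y * p u)))" for y
    by (rule Bochner_Integration.integrable_bound[OF g]) (use gp in \<open>auto simp: norm_mult abs_mult cis_conv_exp\<close>)
  have est: "cmod (F (y + h) - F y - h *\<^sub>R D) \<le> (LBINT u. \<bar>g u\<bar>) * h^2" for h
  proof -
    have "F (y + h) - F y - h *\<^sub>R D = (LBINT u. of_real (g u) * cis ((y + h) * p u) - of_real (g u) * cis (y * p u)
        - h *\<^sub>R (\<i> * (of_real (g u * p u) * cis (y * p u))))"
      unfolding F_def D_def
      by (simp only: Bochner_Integration.integral_diff integral_scaleR_right int1 int2
           Bochner_Integration.integrable_diff integrable_scaleR_right)
    also have "cmod \<dots> \<le> (LBINT u. \<bar>g u\<bar> * h^2)"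
    proof (rule Bochner_Integration.integral_norm_bound_integral)
      show "integrable lborel (\<lambda>u. \<bar>g u\<bar> * h^2)" using g by auto
      fix u
      have e: "of_real (g u) * cis ((y + h) * p u) - of_real (g u) * cis (y * p u)
        - h *\<^sub>R (\<i> * (of_real (g u * p u) * cis (y * p u)))
        = of_real (g u) * cis (y * p u) * (cis (h * p u) - 1 - \<i> * of_real (h * p u))"
        by (simp add: distrib_right cis_mult[symmetric] scaleR_conv_of_real algebra_simps)
      have "cmod (cis (h * p u) - 1 - \<i> * of_real (h * p u)) \<le> (h * p u)^2 / 2" by (rule cis_approx)
      also have "\<dots> \<le> h^2"
      proof -
        have "(p u)^2 \<le> 1" using p[of u] by (simp add: abs_square_le_1)
        then have "h^2 * (p u)^2 \<le> h^2 * 1" by (intro mult_left_mono) auto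
        moreover have "0 \<le> h^2 * (p u)^2" by simp
        ultimately show ?thesis unfolding power_mult_distrib by linarith
      qed
      finally show "cmod (of_real (g u) * cis ((y + h) * p u) - of_real (g u) * cis (y * p u)
        - h *\<^sub>R (\<i> * (of_real (g u * p u) * cis (y * p u)))) \<le> \<bar>g u\<bar> * h^2"
        unfolding e by (simp add: norm_mult mult_left_mono)
    qed (intro Bochner_Integration.integrable_diff integrable_scaleR_right int1 int2)
    also have "\<dots> = (LBINT u. \<bar>g u\<bar>) * h^2" by simp
    finally show ?thesis .
  qed
  have "(F has_vector_derivative D) (at y)"
    unfolding has_vector_derivative_def has_derivative_at
  proof
    show "bounded_linear (\<lambda>x. x *\<^sub>R D)" by (rule bounded_linear_scaleR_left)
    show "(\<lambda>h. norm (F (y + h) - F y - h *\<^sub>R D) / norm h) \<midarrow>0\<rightarrow> 0"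
    proof (rule tendsto_0_le[where K = 1])
      show "((\<lambda>h::real. (LBINT u. \<bar>g u\<bar>) * \<bar>h\<bar>) \<longlongrightarrow> 0) (at 0)"
        by (rule tendsto_eq_intros | simp)+
      show "\<forall>\<^sub>F h in at 0. norm (norm (F (y + h) - F y - h *\<^sub>R D) / norm h) \<le> norm ((LBINT u. \<bar>g u\<bar>) * \<bar>h\<bar>) * 1"
      proof (rule eventually_at_filter[THEN iffD2], rule always_eventually, intro allI impI)
        fix h :: real assume "h \<noteq> 0"
        have "cmod (F (y + h) - F y - h *\<^sub>R D) / \<bar>h\<bar> \<le> (LBINT u. \<bar>g u\<bar>) * h^2 / \<bar>h\<bar>"
          using est[of h] by (intro divide_right_mono) auto
        also have "\<dots> = (LBINT u. \<bar>g u\<bar>) * \<bar>h\<bar>"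
          using \<open>h \<noteq> 0\<close> by (simp add: power2_eq_square del: abs_mult_self_eq flip: abs_mult_self_eq[of h])
        finally show "norm (norm (F (y + h) - F y - h *\<^sub>R D) / norm h) \<le> norm ((LBINT u. \<bar>g u\<bar>) * \<bar>h\<bar>) * 1"
          by (simp add: abs_mult)
      qed
    qed
  qed
  then show ?thesis by (simp add: F_def[abs_def] D_def)
qed

section \<open>The angular mean of a plane wave\<close>

text \<open>The component of the direction $(v_1, v_2)$ along the direction with cotangent $u$, and the
  integral of $\cos (y \cos \theta)$ over a half circle in the coordinate $u$, which carries the measure $du / (1 + u^2)$.\<close>
definition cot_proj :: "real \<Rightarrow> real \<Rightarrow> real \<Rightarrow> real" where
  "cot_proj v1 v2 u = (v1 * u + v2) / sqrt (1 + u^2)"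

definition angular_mean :: "real \<Rightarrow> real \<Rightarrow> real \<Rightarrow> real" where
  "angular_mean v1 v2 y = (LBINT u. cos (y * cot_proj v1 v2 u) / (1 + u^2))"

text \<open>\<open>cot_proj v1 v2\<close> is the cosine of the angle to the unit vector (v1, v2);
  rotating that vector by a right angle gives the corresponding sine.\<close>

lemma abs_cot_proj_le:
  assumes "v1^2 + v2^2 = 1"
  shows "\<bar>cot_proj v1 v2 u\<bar> \<le> 1"
    and "(cot_proj v1 v2 u)^2 + (cot_proj (- v2) v1 u)^2 = 1"
proof -
  have c: "1 + u^2 > 0" by (simp add: add_pos_nonneg)
  have "(v1 * u + v2)^2 + (- v2 * u + v1)^2 = (v1^2 + v2^2) * (1 + u^2)"
    by (simp add: power2_eq_square algebra_simps)
  then have "(v1 * u + v2)^2 + (- v2 * u + v1)^2 = 1 + u^2" using assms by simp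
  then have "((v1 * u + v2)^2 + (- v2 * u + v1)^2) / (1 + u^2) = 1" using c by simp
  then show eq: "(cot_proj v1 v2 u)^2 + (cot_proj (- v2) v1 u)^2 = 1"
    using c by (simp only: cot_proj_def power_divide add_divide_distrib[symmetric] real_sqrt_pow2 less_imp_le)
  then have "(cot_proj v1 v2 u)^2 \<le> 1" using zero_le_power2[of "cot_proj (- v2) v1 u"] by linarith
  then show "\<bar>cot_proj v1 v2 u\<bar> \<le> 1" by (simp add: abs_square_le_1)
qed

text \<open>As du / (1 + u^2) is up to sign the element of angle, differentiation rotates (v1, v2)
  by a right angle.\<close>

lemma DERIV_cot_proj:
  "(cot_proj v1 v2 has_real_derivative cot_proj (- v2) v1 u / (1 + u^2)) (at u)"
proof -
  have c: "1 + u^2 > 0" by (simp add: add_pos_nonneg)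
  define s where "s = sqrt (1 + u^2)"
  have s: "s > 0" "s * s = 1 + u^2" using c by (simp_all add: s_def)
  have "((\<lambda>u. sqrt (1 + u^2)) has_real_derivative u / s) (at u)"
    unfolding s_def using c by (auto intro!: derivative_eq_intros simp: divide_simps)
  moreover have "((\<lambda>u. v1 * u + v2) has_real_derivative v1) (at u)"
    by (auto intro!: derivative_eq_intros)
  ultimately have "((\<lambda>u. (v1 * u + v2) / sqrt (1 + u^2)) has_real_derivative
     (v1 * s - (v1 * u + v2) * (u / s)) / (s * s)) (at u)"
    using s(1) unfolding s_def by (intro DERIV_divide) auto
  moreover have "v1 * s - (v1 * u + v2) * (u / s) = (- v2 * u + v1) / s"
  proof -
    have "v1 * s - (v1 * u + v2) * (u / s) = (v1 * (s * s) - (v1 * u + v2) * u) / s"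
      using s(1) by (simp add: field_simps)
    also have "\<dots> = (- v2 * u + v1) / s" unfolding s(2) by (simp add: algebra_simps power2_eq_square)
    finally show ?thesis .
  qed
  ultimately show ?thesis unfolding s(2) by (simp add: cot_proj_def[abs_def] s_def)
qed

lemma continuous_cot_proj: "continuous_on UNIV (cot_proj v1 v2)"
  using DERIV_cot_proj by (meson DERIV_isCont continuous_at_imp_continuous_on)

lemma measurable_cot_proj [measurable]: "cot_proj v1 v2 \<in> borel_measurable borel"
  by (rule borel_measurable_continuous_onI[OF continuous_cot_proj])

lemma tendsto_cot_proj:
  "(cot_proj v1 v2 \<longlongrightarrow> v1) at_top" "(cot_proj v1 v2 \<longlongrightarrow> - v1) at_bot"
proof -
  have eq: "cot_proj v1 v2 u = v1 * (u / sqrt (1 + u^2)) + v2 * (1 / sqrt (1 + u^2))" for u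
    by (simp add: cot_proj_def add_divide_distrib)
  have "((\<lambda>u::real. u / sqrt (1 + u^2)) \<longlongrightarrow> 1) at_top" "((\<lambda>u::real. 1 / sqrt (1 + u^2)) \<longlongrightarrow> 0) at_top"
    "((\<lambda>u::real. u / sqrt (1 + u^2)) \<longlongrightarrow> - 1) at_bot" "((\<lambda>u::real. 1 / sqrt (1 + u^2)) \<longlongrightarrow> 0) at_bot"
    by real_asymp+
  note l = this
  show "(cot_proj v1 v2 \<longlongrightarrow> v1) at_top" "(cot_proj v1 v2 \<longlongrightarrow> - v1) at_bot"
    unfolding eq by (rule tendsto_eq_intros l refl | simp)+
qed

text \<open>With w the angular mean this is y (w + w'') + w' = 0, Bessel's equation, with the
  derivatives still under the integral sign.\<close>

lemma integral_cot_proj_ode: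
  assumes v: "v1^2 + v2^2 = 1"
  shows "(LBINT u. (y * (1 - (cot_proj v1 v2 u)^2) * cos (y * cot_proj v1 v2 u)
     - cot_proj v1 v2 u * sin (y * cot_proj v1 v2 u)) / (1 + u^2)) = 0"
proof -
  define p where "p = cot_proj v1 v2"
  define q where "q = cot_proj (- v2) v1"
  define f where "f u = (y * (1 - (p u)^2) * cos (y * p u) - p u * sin (y * p u)) / (1 + u^2)" for u
  have c: "1 + u^2 \<noteq> 0" for u :: real by (smt (verit) zero_le_power2)
  have pq: "(p u)^2 + (q u)^2 = 1" and p1: "\<bar>p u\<bar> \<le> 1" for u
    using abs_cot_proj_le[OF v] by (auto simp: p_def q_def)
  have [measurable]: "p \<in> borel_measurable borel" by (simp add: p_def)
  have cp: "isCont p u" for u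
    unfolding p_def by (rule DERIV_isCont[OF DERIV_cot_proj])
  have fb: "\<bar>f u\<bar> \<le> (\<bar>y\<bar> + 1) * (1 / (1 + u^2))" for u
  proof -
    have "\<bar>1 - (p u)^2\<bar> \<le> 1" using pq[of u] p1[of u] by (smt (verit) zero_le_power2)
    then have "\<bar>y\<bar> * \<bar>1 - (p u)^2\<bar> * \<bar>cos (y * p u)\<bar> \<le> \<bar>y\<bar> * 1 * 1"
      by (intro mult_mono) auto
    then have 1: "\<bar>y * (1 - (p u)^2) * cos (y * p u)\<bar> \<le> \<bar>y\<bar>" by (simp add: abs_mult)
    have "\<bar>p u\<bar> * \<bar>sin (y * p u)\<bar> \<le> 1 * 1" using p1 by (intro mult_mono) auto
    then have 2: "\<bar>p u * sin (y * p u)\<bar> \<le> 1" by (simp add: abs_mult)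
    have "\<bar>y * (1 - (p u)^2) * cos (y * p u) - p u * sin (y * p u)\<bar> \<le> \<bar>y\<bar> + 1"
      using 1 2 by linarith
    then have "\<bar>y * (1 - (p u)^2) * cos (y * p u) - p u * sin (y * p u)\<bar> / (1 + u^2) \<le> (\<bar>y\<bar> + 1) / (1 + u^2)"
      by (intro divide_right_mono) auto
    moreover have "\<bar>1 + u^2\<bar> = 1 + u^2" by simp
    ultimately show ?thesis unfolding f_def abs_divide by simp
  qed
  have fi: "integrable lborel f"
  proof (rule integrable_dominated[OF integrable_mult_right[OF integrable_inverse_1_plus_sq]])
    show "f \<in> borel_measurable lborel" unfolding f_def by measurable
    show "norm (f u) \<le> (\<bar>y\<bar> + 1) * (1 / (1 + u^2))" for u unfolding real_norm_def by (rule fb)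
  qed
  \<comment> \<open>The integrand is a total derivative, and its primitive has the same limit at both ends.\<close>
  define F where "F u = q u * sin (y * p u)" for u
  have "(LBINT u=-\<infinity>..\<infinity>. f u) = (- v2) * sin (y * v1) - v2 * sin (y * (- v1))"
  proof (rule interval_integral_FTC_integrable[where F = F])
    fix u :: real
    have "(F has_real_derivative (cot_proj (- v1) (- v2) u / (1 + u^2)) * sin (y * p u)
        + q u * (cos (y * p u) * (y * (q u / (1 + u^2))))) (at u)"
      unfolding F_def p_def q_def
      by (auto intro!: derivative_eq_intros DERIV_cot_proj)
    moreover have "cot_proj (- v1) (- v2) u = - p u"
      unfolding p_def cot_proj_def minus_divide_left by (simp add: algebra_simps)
    moreover have "(q u)^2 = 1 - (p u)^2" using pq[of u] by simp
    then have "(- p u / (1 + u^2)) * sin (y * p u) + q u * (cos (y * p u) * (y * (q u / (1 + u^2)))) = f u"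
      unfolding f_def by (simp add: diff_divide_distrib power2_eq_square flip: \<open>(q u)^2 = 1 - (p u)^2\<close>)
    ultimately show "(F has_vector_derivative f u) (at u)"
      by (simp add: has_real_derivative_iff_has_vector_derivative)
    show "isCont f u" unfolding f_def using c by (intro continuous_intros cp) auto
  next
    show "set_integrable lborel (einterval (- \<infinity>) \<infinity>) f" using fi by (simp add: set_integrable_def)
    have "(F \<longlongrightarrow> v2 * sin (y * (- v1))) at_bot"
      unfolding F_def p_def q_def using tendsto_cot_proj(2)[of v1 v2] tendsto_cot_proj(2)[of "- v2" v1]
      by (intro tendsto_intros) auto
    then show "((F \<circ> real_of_ereal) \<longlongrightarrow> v2 * sin (y * (- v1))) (at_right (- \<infinity>))"
      by (simp add: ereal_tendsto_simps)
    have "(F \<longlongrightarrow> (- v2) * sin (y * v1)) at_top"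
      unfolding F_def p_def q_def using tendsto_cot_proj(1)[of v1 v2] tendsto_cot_proj(1)[of "- v2" v1]
      by (intro tendsto_intros) auto
    then show "((F \<circ> real_of_ereal) \<longlongrightarrow> (- v2) * sin (y * v1)) (at_left \<infinity>)"
      by (simp add: ereal_tendsto_simps)
  qed simp
  then have "(LBINT u. f u) = 0"
    by (simp add: interval_lebesgue_integral_def set_lebesgue_integral_def)
  then show ?thesis by (simp add: f_def p_def)
qed

text \<open>The moments G n, integrals of p^n e^(i y p) over the half circle, satisfy (G n)' = i G
  (n + 1). Hence w = Re (G 0), w' = - Im (G 1), w'' = - Re (G 2), and every bound reduces to |p|
  \<le> 1 and total mass pi. Classically w is pi J_0, but the power series does not enter.\<close>

lemma angular_mean_bessel:
  assumes v: "v1^2 + v2^2 = 1"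
  obtains w' where "\<And>x. (angular_mean v1 v2 has_real_derivative w' x) (at x)"
    "continuous_on UNIV w'"
    "\<And>x. x > 0 \<Longrightarrow> (w' has_real_derivative - w' x / x - angular_mean v1 v2 x) (at x)"
    "\<And>x. \<bar>angular_mean v1 v2 x\<bar> \<le> pi" "\<And>x. \<bar>w' x\<bar> \<le> pi" "\<And>x. \<bar>w' x\<bar> \<le> pi * \<bar>x\<bar>"
proof -
  define p where "p = cot_proj v1 v2"
  have p1: "\<bar>p u\<bar> \<le> 1" for u using abs_cot_proj_le[OF v] by (auto simp: p_def)
  have [measurable]: "p \<in> borel_measurable borel" by (simp add: p_def)
  define g where "g n u = p u ^ n / (1 + u^2)" for n :: nat and u
  have [measurable]: "g n \<in> borel_measurable borel" for n unfolding g_def by measurable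
  have gb: "\<bar>g n u\<bar> \<le> 1 / (1 + u^2)" for n u
  proof -
    have "\<bar>p u ^ n\<bar> \<le> 1" using p1[of u] by (simp add: power_abs power_le_one)
    then have "\<bar>p u ^ n\<bar> / (1 + u^2) \<le> 1 / (1 + u^2)" by (intro divide_right_mono) auto
    moreover have "\<bar>1 + u^2\<bar> = 1 + u^2" by simp
    ultimately show ?thesis unfolding g_def abs_divide by simp
  qed
  have gi: "integrable lborel (g n)" for n
    by (rule integrable_dominated[OF integrable_inverse_1_plus_sq]) (use gb in auto)
  define G where "G n y = (LBINT u. of_real (g n u) * cis (y * p u))" for n y
  have gci: "integrable lborel (\<lambda>u. complex_of_real (g n u) * cis (y * p u))" for n y
    by (rule Bochner_Integration.integrable_bound[OF gi[of n]]) (auto simp: norm_mult cis_conv_exp)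
  have dG: "(G n has_vector_derivative \<i> * G (Suc n) y) (at y)" for n y
  proof -
    have "g n u * p u = g (Suc n) u" for u by (simp add: g_def)
    then have eq: "(LBINT u. \<i> * (of_real (g n u * p u) * cis (y * p u))) = \<i> * G (Suc n) y"
      by (simp only: integral_mult_right_zero G_def)
    have Geq: "G n = (\<lambda>y. LBINT u. of_real (g n u) * cis (y * p u))" by (rule ext) (rule G_def)
    show ?thesis unfolding Geq eq[symmetric]
      by (rule has_vector_derivative_integral_cis[OF gi _ p1]) simp
  qed
  have ReG: "Re (G n y) = (LBINT u. g n u * cos (y * p u))" for n y
    unfolding G_def using integral_Re[OF gci[of n y]] by simp
  have ImG: "Im (G n y) = (LBINT u. g n u * sin (y * p u))" for n y
    unfolding G_def using integral_Im[OF gci[of n y]] by simp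
  have am: "angular_mean v1 v2 = (\<lambda>y. Re (G 0 y))"
    by (rule ext) (simp add: angular_mean_def ReG g_def p_def)
  define w' where "w' y = - Im (G 1 y)" for y
  have dRe: "((\<lambda>y. Re (G n y)) has_real_derivative - Im (G (Suc n) x)) (at x)" for n x
    using bounded_linear.has_vector_derivative[OF bounded_linear_Re dG[of n x]]
    by (simp add: has_real_derivative_iff_has_vector_derivative)
  have dIm: "((\<lambda>y. Im (G n y)) has_real_derivative Re (G (Suc n) x)) (at x)" for n x
    using bounded_linear.has_vector_derivative[OF bounded_linear_Im dG[of n x]]
    by (simp add: has_real_derivative_iff_has_vector_derivative)
  have dw': "(w' has_real_derivative - Re (G 2 x)) (at x)" for x
    unfolding w'_def[abs_def] using DERIV_minus[OF dIm[of 1 x]] by (simp add: numeral_2_eq_2)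
  have ri: "integrable lborel (\<lambda>u. g n u * cos (y * p u))" "integrable lborel (\<lambda>u. g n u * sin (y * p u))" for n y
    using gci[of n y, THEN integrable_Re] gci[of n y, THEN integrable_Im] by simp_all
  show thesis
  proof (rule that[of w'])
    show "(angular_mean v1 v2 has_real_derivative w' x) (at x)" for x
      unfolding am w'_def using dRe[of 0 x] by simp
    show "continuous_on UNIV w'"
      using dw' by (meson DERIV_isCont continuous_at_imp_continuous_on)
    show "(w' has_real_derivative - w' x / x - angular_mean v1 v2 x) (at x)" if "x > 0" for x
    proof -
      have "0 = (LBINT u. x * (g 0 u * cos (x * p u) - g 2 u * cos (x * p u)) - g 1 u * sin (x * p u))"
        using integral_cot_proj_ode[OF v, of x]
        by (simp add: p_def[symmetric] g_def diff_divide_distrib add_divide_distrib algebra_simps)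
      also have "\<dots> = x * (Re (G 0 x) - Re (G 2 x)) - Im (G 1 x)"
      proof -
        have i: "integrable lborel (\<lambda>u. g 0 u * cos (x * p u) - g 2 u * cos (x * p u))"
          by (rule Bochner_Integration.integrable_diff[OF ri(1) ri(1)])
        show ?thesis
          unfolding ReG ImG Bochner_Integration.integral_diff[OF integrable_mult_right[OF i] ri(2)]
            integral_mult_right_zero Bochner_Integration.integral_diff[OF ri(1) ri(1)] ..
      qed
      finally have "Re (G 2 x) = Re (G 0 x) - Im (G 1 x) / x"
        using that by (simp add: field_simps)
      then show ?thesis using dw'[of x] by (simp add: am w'_def)
    qed
    have le: "\<bar>LBINT u. g n u * h u\<bar> \<le> pi * C" if "integrable lborel (\<lambda>u. g n u * h u)" "\<And>u. \<bar>h u\<bar> \<le> C" for n h C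
    proof -
      have "norm (LBINT u. g n u * h u) \<le> (LBINT u. 1 / (1 + u^2) * C)"
        using that integrable_inverse_1_plus_sq gb[of n]
        by (intro Bochner_Integration.integral_norm_bound_integral)
           (auto simp: abs_mult simp del: times_divide_eq_left intro!: mult_mono)
      also have "\<dots> = (LBINT u. 1 / (1 + u^2)) * C" by (rule integral_mult_left_zero)
      finally show ?thesis by (simp add: integral_inverse_1_plus_sq)
    qed
    show "\<bar>angular_mean v1 v2 x\<bar> \<le> pi" for x
      unfolding am ReG using le[OF ri(1)[of 0 x], of 1] by simp
    show "\<bar>w' x\<bar> \<le> pi" for x
      unfolding w'_def ImG using le[OF ri(2)[of 1 x], of 1] by simp
    show "\<bar>w' x\<bar> \<le> pi * \<bar>x\<bar>" for x
    proof -
      have "\<bar>sin (x * p u)\<bar> \<le> \<bar>x\<bar>" for u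
        using abs_sin_x_le_abs_x[of "x * p u"] mult_left_mono[OF p1[of u], of "\<bar>x\<bar>"] by (simp add: abs_mult)
      then show ?thesis unfolding w'_def ImG using le[OF ri(2)[of 1 x], of "\<bar>x\<bar>"] by simp
    qed
  qed
qed

lemma angular_mean_integral_bound:
  assumes v: "v1^2 + v2^2 = 1" and a: "a \<ge> 0" and s: "s \<ge> 0"
  shows "cmod (integral {0..a} (\<lambda>x. cis x * of_real (angular_mean v1 v2 (s * x))))
     \<le> 48 * pi * (1 + sqrt a) / sqrt (1 + s^2)"
proof -
  obtain w' where w: "\<And>x. (angular_mean v1 v2 has_real_derivative w' x) (at x)"
    "continuous_on UNIV w'"
    "\<And>x. x > 0 \<Longrightarrow> (w' has_real_derivative - w' x / x - angular_mean v1 v2 x) (at x)"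
    "\<And>x. \<bar>angular_mean v1 v2 x\<bar> \<le> pi" "\<And>x. \<bar>w' x\<bar> \<le> pi" "\<And>x. \<bar>w' x\<bar> \<le> pi * \<bar>x\<bar>"
    by (rule angular_mean_bessel[OF v]) (blast intro: that)
  \<comment> \<open>\<open>bessel_ode_decay\<close> with the initial bound pi yields 3 pi, which
    exceeds all other bounds needed; 16 times 3 pi is 48 pi.\<close>
  have "cmod (integral {0..a} (\<lambda>x. cis x * of_real (angular_mean v1 v2 (s * x))))
     \<le> 16 * (3 * pi) * (1 + sqrt a) / sqrt (1 + s^2)"
  proof (rule norm_integral_cis_bessel_le[OF w(1-3) _ _ _ _ a s])
    fix x :: real
    show "\<bar>angular_mean v1 v2 x\<bar> \<le> 3 * pi" using w(4)[of x] pi_gt_zero by linarith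
    show "\<bar>w' x\<bar> \<le> 3 * pi" using w(5)[of x] pi_gt_zero by linarith
    show "\<bar>w' x\<bar> \<le> 3 * pi * x" if "x \<ge> 0"
      using w(6)[of x] mult_nonneg_nonneg[OF _ that, of pi] that by simp
    show "\<bar>w' x\<bar> \<le> 3 * pi / sqrt x" if x: "x > 0"
    proof (cases "x \<le> 1")
      case True
      have "\<bar>w' x\<bar> \<le> 3 * pi / 1" using w(5)[of x] pi_gt_zero by linarith
      also have "\<dots> \<le> 3 * pi / sqrt x" using x True by (intro divide_left_mono) auto
      finally show ?thesis .
    next
      case False
      then show ?thesis
        by (intro bessel_ode_decay(2)[where w = "angular_mean v1 v2"] w) auto
    qed
  qed
  then show ?thesis by simp
qed

section \<open>The multiplier\<close>

lemma integral_half_line: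
  fixes h :: "real \<Rightarrow> complex"
  assumes h: "integrable lborel h"
  shows "(LBINT t. h t) = (LBINT t. indicator {0<..} t *\<^sub>R (h t + h (- t)))"
    and "integrable lborel (\<lambda>t. indicator {0<..} t *\<^sub>R (h t + h (- t)))"
proof -
  have h': "integrable lborel (\<lambda>t. h (- t))"
    using lborel_integrable_real_affine[OF h, of "-1" 0] by simp
  have i1: "integrable lborel (\<lambda>t. indicator {0<..} t *\<^sub>R h t)" and i1': "integrable lborel (\<lambda>t. indicator {0<..} t *\<^sub>R h (- t))"
    and i2: "integrable lborel (\<lambda>t. indicator {..0} t *\<^sub>R h t)"
    by (intro integrable_mult_indicator h h'; simp)+
  have "(LBINT t. h t) = (LBINT t. indicator {0<..} t *\<^sub>R h t + indicator {..0} t *\<^sub>R h t)"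
    by (intro Bochner_Integration.integral_cong) (auto simp: indicator_def)
  also have "\<dots> = (LBINT t. indicator {0<..} t *\<^sub>R h t) + (LBINT t. indicator {..0} t *\<^sub>R h t)"
    by (rule Bochner_Integration.integral_add[OF i1 i2])
  also have "(LBINT t. indicator {..0} t *\<^sub>R h t) = (LBINT t. indicator {..0} (- t) *\<^sub>R h (- t))"
    using lborel_integral_real_affine[of "-1" "\<lambda>t. indicator {..0} t *\<^sub>R h t" 0] by simp
  also have "\<dots> = (LBINT t. indicator {0<..} t *\<^sub>R h (- t))"
  proof (rule integral_cong_AE)
    show "AE t in lborel. indicator {..0} (- t) *\<^sub>R h (- t) = indicator {0<..} t *\<^sub>R h (- t)"
      using AE_lborel_singleton[of 0] by eventually_elim (auto simp: indicator_def)
    have "(\<lambda>t. h (- t)) \<in> borel_measurable borel" using h' by simp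
    then show "(\<lambda>t. indicator {0<..} t *\<^sub>R h (- t)) \<in> borel_measurable lborel"
      "(\<lambda>t. indicator {..0} (- t) *\<^sub>R h (- t)) \<in> borel_measurable lborel" by measurable
  qed
  also have "(LBINT t. indicator {0<..} t *\<^sub>R h t) + \<dots> = (LBINT t. indicator {0<..} t *\<^sub>R h t + indicator {0<..} t *\<^sub>R h (- t))"
    by (rule Bochner_Integration.integral_add[OF i1 i1', symmetric])
  finally show "(LBINT t. h t) = (LBINT t. indicator {0<..} t *\<^sub>R (h t + h (- t)))"
    by (simp add: scaleR_add_right)
  show "integrable lborel (\<lambda>t. indicator {0<..} t *\<^sub>R (h t + h (- t)))"
    using Bochner_Integration.integrable_add[OF i1 i1'] by (simp add: scaleR_add_right)
qed

text \<open>Common last step for both dimensions: only the even part of an integrand in the signed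
  coordinate counts, and x = k t turns the range into [0, kL] with a factor 1/k. It also passes from
  the Lebesgue integral to the gauge integral used for the oscillatory estimates.\<close>

lemma integral_half_line_scaled:
  fixes h g :: "real \<Rightarrow> complex"
  assumes h: "integrable lborel h" and k: "k > 0"
    and hg: "\<And>t. t > 0 \<Longrightarrow> h t + h (- t) = (if t \<le> L then g (k * t) else 0)"
  shows "(LBINT t. h t) = integral {0..k * L} g / of_real k"
    and "g integrable_on {0..k * L}"
proof -
  define f where "f t = indicator {0<..k * L} t *\<^sub>R g t" for t
  have "indicator {0<..} t *\<^sub>R (h t + h (- t)) = f (0 + k * t)" for t
    using k hg[of t] by (auto simp: f_def indicator_def zero_less_mult_iff)
  then have eq: "(\<lambda>t. indicator {0<..} t *\<^sub>R (h t + h (- t))) = (\<lambda>t. f (0 + k * t))" by (rule ext)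
  have fi: "integrable lborel f"
    using integral_half_line(2)[OF h] k unfolding eq by (subst (asm) lborel_integrable_real_affine_iff) auto
  have "(LBINT t. f t) = k *\<^sub>R (LBINT t. h t)"
    unfolding integral_half_line(1)[OF h] eq using k lborel_integral_real_affine[of k f 0] by simp
  moreover have si: "set_integrable lborel {0<..k * L} g" using fi by (simp add: set_integrable_def f_def[abs_def])
  have "(LBINT t. f t) = integral {0<..k * L} g"
    using set_borel_integral_eq_integral(2)[OF si] by (simp add: set_lebesgue_integral_def f_def)
  moreover have neg: "negligible {x \<in> {0<..k * L} - {0..k * L}. g x \<noteq> 0}" "negligible {x \<in> {0..k * L} - {0<..k * L}. g x \<noteq> 0}"
    by (auto intro: negligible_subset[of "{0}"])
  have "integral {0<..k * L} g = integral {0..k * L} g"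
    by (rule integral_spike_set[OF neg])
  ultimately show "(LBINT t. h t) = integral {0..k * L} g / of_real k"
    using k by (simp add: scaleR_conv_of_real field_simps)
  show "g integrable_on {0..k * L}"
    using set_borel_integral_eq_integral(1)[OF si] integrable_spike_set_eq[of "{0<..k * L}" "{0..k * L}" g] neg
    by (auto simp: Un_commute intro: integrable_spike_set)
qed

section \<open>The cut-off kernel and its multiplier\<close>

definition cut_kernel :: "real \<Rightarrow> real \<Rightarrow> 'a::euclidean_space \<Rightarrow> complex" where
  "cut_kernel k L z = (if norm z \<le> L then fund_sol k z 0 else 0)"

text \<open>There is no power of 2 pi here, in contrast to \<open>fourier\<close>: with the unitary
  normalisation, convolution with K multiplies Fourier transforms by exactly this integral.\<close>

definition symbol :: "real \<Rightarrow> real \<Rightarrow> 'a::euclidean_space \<Rightarrow> complex" where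
  "symbol k L \<xi> = (LBINT z. cut_kernel k L z * cis (- (\<xi> \<bullet> z)))"

lemma measurable_hankel10 [measurable]: "hankel10 \<in> borel_measurable borel"
  unfolding hankel10_def[abs_def] Complex_eq by measurable

lemma measurable_cis [measurable]: "cis \<in> borel_measurable borel"
  by (intro borel_measurable_continuous_onI continuous_intros)

lemma measurable_cut_kernel [measurable]: "cut_kernel k L \<in> borel_measurable borel"
  unfolding cut_kernel_def[abs_def] fund_sol_def dist_norm by measurable

text \<open>The factor 1/k from rescaling the integral turns the bound in s = |\<xi>| / k into the
  reciprocal root of the k-dependent weight.\<close>

lemma inverse_sqrt_scale:
  assumes "k > 0"
  shows "1 / sqrt (1 + (\<rho> / k)^2) / k = 1 / sqrt (k^2 + \<rho>^2)"
proof -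
  have "sqrt (k^2 + \<rho>^2) = sqrt (k^2 * (1 + (\<rho> / k)^2))" using assms by (simp add: field_simps)
  also have "\<dots> = k * sqrt (1 + (\<rho> / k)^2)" using assms by (simp add: real_sqrt_mult)
  finally show ?thesis by simp
qed

lemma integrable_inverse_sqrt_abs: "integrable lborel (\<lambda>t::real. indicator {-L..L} t / sqrt \<bar>t\<bar>)"
proof (cases "L \<ge> 0")
  case True
  define f :: "real \<Rightarrow> real" where "f t = indicator {0..L} t * (1 / sqrt t)" for t
  have [measurable]: "f \<in> borel_measurable borel" unfolding f_def by measurable
  have f0: "f t \<ge> 0" for t by (auto simp: f_def indicator_def)
  have "(f has_integral 2 * sqrt L) UNIV"
  proof -
    have "f = (\<lambda>t. if t \<in> {0..L} then 1 / sqrt t else 0)" by (rule ext) (simp add: f_def indicator_def)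
    then show ?thesis using has_integral_inverse_sqrt[OF True] by (simp only: has_integral_restrict_UNIV)
  qed
  then have "integral\<^sup>N lborel f = ennreal (2 * sqrt L)"
    by (intro nn_integral_has_integral_lborel f0) auto
  then have f: "integrable lborel f"
    using f0 by (intro integrableI_nonneg) auto
  have "integrable lborel (\<lambda>t. f t + f (- t))"
    using lborel_integrable_real_affine[OF f, of "-1" 0] f by simp
  moreover have "(\<lambda>t. f t + f (- t)) = (\<lambda>t. indicator {-L..L} t / sqrt \<bar>t\<bar>)"
    by (rule ext) (auto simp: f_def indicator_def real_sqrt_minus)
  ultimately show ?thesis by simp
qed auto

text \<open>Folding the line at 0 replaces the exponential by 2 cos, so the symbol is i / (2 k)
  times the integral of the Hankel function against cos (s x) over [0, kL]. Estimating the real and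
  imaginary parts J_0 and Y_0 separately costs a factor 2, which the 1/2 cancels.\<close>

lemma symbol_bound_DIM1:
  assumes dim: "DIM('a::euclidean_space) = 1"
  shows "\<exists>C>0. \<forall>k>0. \<forall>L>0. integrable lborel (cut_kernel k L :: 'a \<Rightarrow> complex) \<and>
     (\<forall>\<xi>::'a. cmod (symbol k L \<xi>) \<le> C * (ln (2 + 1 / (k * L)) * (1 + sqrt (k * L))) / sqrt (k^2 + (norm \<xi>)^2))"
proof -
  obtain b :: 'a where b: "Basis = {b}" and lb: "lborel = distr lborel borel (\<lambda>t::real. t *\<^sub>R b)"
    by (rule lborel_DIM1[OF dim]) (blast intro: that)
  have nb: "norm b = 1" by (rule norm_Basis) (simp add: b)
  have nx: "norm \<xi> = \<bar>\<xi> \<bullet> b\<bar>" for \<xi> :: 'a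
    unfolding euclidean_dist_l2[of \<xi> 0, simplified] L2_set_def b by simp
  obtain C1 C2 where C12: "log_bessel_bound C1 bessel_J0" "log_bessel_bound C2 bessel_Y0"
    using bessel_J0_bound bessel_Y0_bound by blast
  define C where "C = C1 + C2"
  have le: "C1 \<le> C" "C2 \<le> C" using C12 by (auto simp: C_def log_bessel_bound_def)
  note J = log_bessel_bound_mono[OF C12(1) le(1), unfolded log_bessel_bound_def]
  note Y = log_bessel_bound_mono[OF C12(2) le(2), unfolded log_bessel_bound_def]
  have C0: "C > 0" using J by blast
  show ?thesis
  proof (intro exI[of _ C] conjI allI impI C0)
    fix k L :: real assume k: "k > 0" and L: "L > 0"
    define a where "a = k * L"
    have a: "a > 0" using k L by (simp add: a_def)
    define h where "h \<xi> t = cut_kernel k L (t *\<^sub>R b) * cis (- (\<xi> \<bullet> (t *\<^sub>R b)))" for \<xi> t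
    have heq: "h \<xi> t = (if \<bar>t\<bar> \<le> L then \<i> / 4 * hankel10 (k * \<bar>t\<bar>) * cis (- (\<xi> \<bullet> b * t)) else 0)" for \<xi> t
      using nb dim by (simp add: h_def cut_kernel_def fund_sol_def mult.commute)
    have hm: "h \<xi> \<in> borel_measurable borel" for \<xi> unfolding heq[abs_def] by measurable
    have hb: "cmod (hankel10 x) \<le> 2 * (C / sqrt x)" if "x > 0" for x
      using J[THEN conjunct2, THEN conjunct1, rule_format, OF that] Y[THEN conjunct2, THEN conjunct1, rule_format, OF that] cmod_le[of "hankel10 x"] by (simp add: hankel10_def)
    have hi: "integrable lborel (h \<xi>)" for \<xi>
    proof (rule Bochner_Integration.integrable_bound)
      show "integrable lborel (\<lambda>t. (C / sqrt k) * (indicator {-L..L} t / sqrt \<bar>t\<bar>))"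
        by (intro integrable_mult_right integrable_inverse_sqrt_abs)
      show "h \<xi> \<in> borel_measurable lborel" using hm by simp
      \<comment> \<open>The origin must be excluded: there the majorant is 0, since division by 0
        gives 0, while the kernel need not vanish.\<close>
      show "AE t in lborel. norm (h \<xi> t) \<le> norm ((C / sqrt k) * (indicator {-L..L} t / sqrt \<bar>t\<bar>))"
        using AE_lborel_singleton[of 0]
      proof eventually_elim
        case (elim t)
        show ?case
        proof (cases "\<bar>t\<bar> \<le> L")
          case True
          have "norm (h \<xi> t) = 1 / 4 * cmod (hankel10 (k * \<bar>t\<bar>))"
            using True by (simp add: heq norm_mult norm_divide)
          also have "\<dots> \<le> 1 / 4 * (2 * (C / sqrt (k * \<bar>t\<bar>)))"
            by (intro mult_left_mono hb) (use elim k in auto)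
          also have "\<dots> \<le> C / sqrt (k * \<bar>t\<bar>)"
          proof -
            have "0 \<le> C / sqrt (k * \<bar>t\<bar>)" using C0 k by (intro divide_nonneg_nonneg) auto
            then show ?thesis by linarith
          qed
          also have "\<dots> = (C / sqrt k) * (indicator {-L..L} t / sqrt \<bar>t\<bar>)"
            using True by (auto simp: indicator_def real_sqrt_mult)
          also have "\<dots> \<le> norm \<dots>" unfolding real_norm_def by (rule abs_ge_self)
          finally show ?thesis .
        qed (simp add: heq)
      qed
    qed
    have int_iff: "integrable lborel (\<lambda>z. cut_kernel k L z * cis (- (\<xi> \<bullet> z)))" for \<xi> :: 'a
      using hi[of \<xi>] unfolding h_def by (subst lb, subst integrable_distr_eq) auto
    show "integrable lborel (cut_kernel k L :: 'a \<Rightarrow> complex)" using int_iff[of 0] by simp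
    show "cmod (symbol k L \<xi>) \<le> C * (ln (2 + 1 / (k * L)) * (1 + sqrt (k * L))) / sqrt (k^2 + (norm \<xi>)^2)" for \<xi> :: 'a
    proof -
      define s where "s = norm \<xi> / k"
      have s: "s \<ge> 0" using k by (simp add: s_def)
      define g where "g x = \<i> / 2 * (hankel10 x * cos (s * x))" for x
      have hg: "h \<xi> t + h \<xi> (- t) = (if t \<le> L then g (k * t) else 0)" if "t > 0" for t
      proof -
        have c: "cis x + cis (- x) = 2 * of_real (cos x)" for x by (simp add: complex_eq_iff)
        have "cos (\<xi> \<bullet> b * t) = cos (norm \<xi> * t)" unfolding nx by (cases "\<xi> \<bullet> b \<ge> 0") auto
        also have "norm \<xi> * t = s * (k * t)" using k by (simp add: s_def)
        finally have "cis (- (\<xi> \<bullet> b * t)) + cis (\<xi> \<bullet> b * t) = 2 * of_real (cos (s * (k * t)))"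
          using c[of "\<xi> \<bullet> b * t"] by (simp add: add.commute)
        then have "\<i> / 4 * hankel10 (k * t) * (cis (- (\<xi> \<bullet> b * t)) + cis (\<xi> \<bullet> b * t)) = g (k * t)"
          by (simp add: g_def)
        then show ?thesis using that by (simp add: heq distrib_left)
      qed
      note sc = integral_half_line_scaled[OF hi k hg]
      define I where "I = integral {0..a} (\<lambda>x. hankel10 x * cos (s * x))"
      have "(\<lambda>x. 2 / \<i> * g x) integrable_on {0..a}" using sc(2) unfolding a_def by (rule integrable_on_mult_right)
      then have ii: "(\<lambda>x. hankel10 x * cos (s * x)) integrable_on {0..a}" by (simp add: g_def)
      have hI: "((\<lambda>x. hankel10 x * cos (s * x)) has_integral I) {0..a}" using ii by (simp add: I_def integrable_integral)
      have "Re I = integral {0..a} (\<lambda>x. bessel_J0 x * cos (s * x))" "Im I = integral {0..a} (\<lambda>x. bessel_Y0 x * cos (s * x))"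
        using has_integral_linear[OF hI bounded_linear_Re] has_integral_linear[OF hI bounded_linear_Im]
        by (auto simp: o_def hankel10_def dest: integral_unique)
      then have Ile: "cmod I \<le> 2 * (C * (ln (2 + 1 / a) * (1 + sqrt a)) / sqrt (1 + s^2))"
        using J[THEN conjunct2, THEN conjunct2, rule_format, OF a s] Y[THEN conjunct2, THEN conjunct2, rule_format, OF a s] cmod_le[of I] by linarith
      have "integral {0..a} g = \<i> / 2 * I"
        using has_integral_mult_right[OF hI, of "\<i> / 2"] unfolding g_def[abs_def] by (rule integral_unique)
      moreover have "symbol k L \<xi> = (LBINT t. h \<xi> t)"
        unfolding symbol_def h_def by (subst lb, subst integral_distr) auto
      ultimately have "symbol k L \<xi> = \<i> / 2 * I / of_real k"
        using sc(1) by (simp only: a_def[symmetric])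
      then have "cmod (symbol k L \<xi>) = (1 / 2 * cmod I) / k"
        using k by (simp add: norm_mult norm_divide)
      also have "\<dots> \<le> (C * (ln (2 + 1 / a) * (1 + sqrt a)) / sqrt (1 + s^2)) / k"
        using Ile k by (intro divide_right_mono) linarith+
      also have "\<dots> = C * (ln (2 + 1 / a) * (1 + sqrt a)) * (1 / sqrt (1 + (norm \<xi> / k)^2) / k)"
        by (simp add: s_def)
      also have "\<dots> = C * (ln (2 + 1 / a) * (1 + sqrt a)) / sqrt (k^2 + (norm \<xi>)^2)"
        unfolding inverse_sqrt_scale[OF k] by simp
      finally show ?thesis by (simp add: a_def)
    qed
  qed
qed

text \<open>The Jacobian |r| cancels the singularity 1/|r| of the kernel. What is left is bounded in
  r on [-L, L] and carries the integrable factor 1 / (1 + u^2), so Fubini applies and the integral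
  over u can be done first.\<close>

lemma symbol_bound_DIM2:
  assumes dim: "DIM('a::euclidean_space) = 2" and k: "k > 0" and L: "L > 0"
  shows "integrable lborel (cut_kernel k L :: 'a \<Rightarrow> complex)"
    and "cmod (symbol k L (\<xi>::'a)) \<le> 24 * (1 + sqrt (k * L)) / sqrt (k^2 + (norm \<xi>)^2)"
proof -
  obtain b c :: 'a where b: "Basis = {b, c}" "b \<noteq> c" and
    lb: "lborel = distr (density (lborel \<Otimes>\<^sub>M lborel) (\<lambda>(u, r). ennreal (\<bar>r\<bar> / (1 + u^2)))) borel
       (\<lambda>(u::real, r::real). (r / sqrt (1 + u^2)) *\<^sub>R (u *\<^sub>R b + c))"
    by (rule lborel_polar[OF dim]) (blast intro: that)
  have "b \<in> Basis" "c \<in> Basis" unfolding b by auto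
  then have bb: "b \<bullet> b = 1" "c \<bullet> c = 1" "b \<bullet> c = 0" "c \<bullet> b = 0" using b(2) by (simp_all add: inner_Basis)
  have n2: "(norm \<xi>)^2 = (\<xi> \<bullet> b)^2 + (\<xi> \<bullet> c)^2" for \<xi> :: 'a
    unfolding euclidean_dist_l2[of \<xi> 0, simplified] L2_set_def b using b(2) by simp
  have pos: "1 + u^2 > 0" for u :: real by (simp add: add_pos_nonneg)
  have ne: "norm (u *\<^sub>R b + c) = sqrt (1 + u^2)" for u
    using n2[of "u *\<^sub>R b + c"] bb pos[of u] by (simp add: inner_add_left real_sqrt_unique add.commute)
  define e where "e = (\<lambda>(u::real, r::real). (r / sqrt (1 + u^2)) *\<^sub>R (u *\<^sub>R b + c))"
  have [measurable]: "e \<in> (lborel \<Otimes>\<^sub>M lborel) \<rightarrow>\<^sub>M borel" unfolding e_def by measurable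
  have norm_e: "norm (e (u, r)) = \<bar>r\<bar>" for u r
    using pos[of u] by (simp add: e_def ne)
  have main: "integrable lborel (\<lambda>z. cut_kernel k L z * cis (- (\<xi> \<bullet> z)))"
    "cmod (symbol k L \<xi>) \<le> 24 * (1 + sqrt (k * L)) / sqrt (k^2 + (norm \<xi>)^2)" for \<xi> :: 'a
  proof -
    define \<rho> where "\<rho> = norm \<xi>"
    \<comment> \<open>At \<xi> = 0 any unit vector will do, because \<rho> is 0.\<close>
    obtain v1 v2 where v: "v1^2 + v2^2 = 1" and xi: "\<xi> \<bullet> b = \<rho> * v1" "\<xi> \<bullet> c = \<rho> * v2"
    proof (cases "\<xi> = 0")
      case True then show thesis by (intro that[of 1 0]) (auto simp: \<rho>_def)
    next
      case False
      then show thesis using n2[of \<xi>]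
        by (intro that[of "(\<xi> \<bullet> b) / \<rho>" "(\<xi> \<bullet> c) / \<rho>"]) (auto simp: \<rho>_def power_divide add_divide_distrib[symmetric])
    qed
    define p where "p = cot_proj v1 v2"
    have [measurable]: "p \<in> borel_measurable borel" by (simp add: p_def)
    have inner_e: "\<xi> \<bullet> e (u, r) = \<rho> * r * p u" for u r
    proof -
      have "\<xi> \<bullet> e (u, r) = r / sqrt (1 + u^2) * (u * (\<rho> * v1) + \<rho> * v2)"
        by (simp add: e_def inner_add_right xi)
      also have "\<dots> = \<rho> * r * p u" by (simp add: p_def cot_proj_def algebra_simps add_divide_distrib)
      finally show ?thesis .
    qed
    \<comment> \<open>The value 0 at r = 0 agrees with the Jacobian, which vanishes there.\<close>
    define H where "H u r = (if \<bar>r\<bar> \<le> L \<and> r \<noteq> 0 then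
        of_real (1 / (4 * pi)) * cis (k * \<bar>r\<bar>) * (of_real (1 / (1 + u^2)) * cis (- (\<rho> * r * p u))) else 0)" for u r
    have [measurable]: "case_prod H \<in> borel_measurable (lborel \<Otimes>\<^sub>M lborel)" unfolding H_def by measurable
    have Heq: "(\<bar>r\<bar> / (1 + u^2)) *\<^sub>R (cut_kernel k L (e (u, r)) * cis (- (\<xi> \<bullet> e (u, r)))) = H u r" for u r
    proof (cases "r = 0")
      case True then show ?thesis by (simp add: H_def)
    next
      case False
      have ck: "cut_kernel k L (e (u, r)) = (if \<bar>r\<bar> \<le> L then cis (k * \<bar>r\<bar>) * of_real (1 / (4 * pi * \<bar>r\<bar>)) else 0)"
        using dim by (simp add: cut_kernel_def fund_sol_def norm_e)
      have "\<bar>r\<bar> / (1 + u^2) * (1 / (4 * pi * \<bar>r\<bar>)) = 1 / (4 * pi) * (1 / (1 + u^2))"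
        using False by simp
      then have c: "complex_of_real (\<bar>r\<bar> / (1 + u^2)) * of_real (1 / (4 * pi * \<bar>r\<bar>)) = of_real (1 / (4 * pi)) * of_real (1 / (1 + u^2))"
        by (simp only: of_real_mult[symmetric])
      have "complex_of_real (\<bar>r\<bar> / (1 + u^2)) * (A * of_real (1 / (4 * pi * \<bar>r\<bar>)) * B)
          = of_real (1 / (4 * pi)) * A * (of_real (1 / (1 + u^2)) * B)" for A B
        using arg_cong[OF c, of "\<lambda>x. x * (A * B)"] by (simp only: mult_ac)
      then show ?thesis using False by (simp only: H_def ck inner_e scaleR_conv_of_real) simp
    qed
    have Hn: "cmod (H u r) = (1 / (1 + u^2)) * (indicator ({-L..L} - {0}) r / (4 * pi))" for u r
      using pos[of u] by (auto simp: H_def norm_mult indicator_def simp del: of_real_divide of_real_add)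
    have ind: "integrable lborel (\<lambda>r::real. indicator ({-L..L} - {0}) r / (4 * pi) :: real)"
    proof (intro integrable_divide integrable_real_indicator)
      show "emeasure lborel ({-L..L} - {0::real}) < \<infinity>"
        by (rule le_less_trans[OF emeasure_mono[of _ "{-L..L}"]]) (use L in auto)
    qed simp
    have Hi: "integrable (lborel \<Otimes>\<^sub>M lborel) (case_prod H)"
    proof (rule lborel_pair.Fubini_integrable)
      show "case_prod H \<in> borel_measurable (lborel \<Otimes>\<^sub>M lborel)" by measurable
      show "integrable lborel (\<lambda>u. LBINT r. norm (case (u, r) of (u, r) \<Rightarrow> H u r))"
        by (simp only: prod.case Hn integral_mult_right_zero) (intro integrable_mult_left integrable_inverse_1_plus_sq)
      have "integrable lborel (H u)" for u
        by (rule integrable_dominated[OF integrable_mult_right[OF ind] _ eq_refl[OF Hn]]) (simp add: H_def[abs_def])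
      then show "AE u in lborel. integrable lborel (\<lambda>r. case (u, r) of (u, r) \<Rightarrow> H u r)" by simp
    qed
    have dens: "(\<lambda>(u, r). ennreal (\<bar>r\<bar> / (1 + u^2))) = (\<lambda>z. ennreal (case z of (u::real, r) \<Rightarrow> \<bar>r\<bar> / (1 + u^2)))"
      by auto
    have nn: "AE z in lborel \<Otimes>\<^sub>M lborel. 0 \<le> (case z of (u::real, r) \<Rightarrow> \<bar>r\<bar> / (1 + u^2))"
      by (intro AE_I2) auto
    have Hz: "(case z of (u, r) \<Rightarrow> \<bar>r\<bar> / (1 + u^2)) *\<^sub>R (cut_kernel k L (e z) * cis (- (\<xi> \<bullet> e z))) = case_prod H z" for z
      using Heq by (cases z) simp
    show "integrable lborel (\<lambda>z. cut_kernel k L z * cis (- (\<xi> \<bullet> z)))"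
      unfolding lb dens e_def[symmetric] using Hi
      by (subst integrable_distr_eq, measurable, subst integrable_density) (use nn in \<open>auto simp: Hz\<close>)
    have sym: "symbol k L \<xi> = integral\<^sup>L (lborel \<Otimes>\<^sub>M lborel) (case_prod H)"
      unfolding symbol_def lb dens e_def[symmetric]
      by (subst integral_distr, measurable, subst integral_density) (use nn in \<open>auto simp: Hz\<close>)
    define h where "h r = (LBINT u. H u r)" for r
    have hi: "integrable lborel h" unfolding h_def using lborel_pair.integrable_snd[OF Hi] by simp
    have sym': "symbol k L \<xi> = (LBINT r. h r)"
      unfolding sym h_def using lborel_pair.integral_snd[OF Hi] by simp
    define s where "s = \<rho> / k"
    have s: "s \<ge> 0" using k by (simp add: s_def \<rho>_def)
    define g where "g x = of_real (1 / (2 * pi)) * (cis x * of_real (angular_mean v1 v2 (s * x)))" for x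
    \<comment> \<open>W r integrates the plane wave over the half circle of signed radius r; r and
      -r together make up the full circle, on which the sine parts cancel.\<close>
    define W where "W r = (LBINT u. of_real (1 / (1 + u^2)) * cis (- (\<rho> * r * p u)))" for r
    have Wi: "integrable lborel (\<lambda>u. complex_of_real (1 / (1 + u^2)) * cis (- (\<rho> * r * p u)))" for r
    proof (rule integrable_dominated[OF integrable_inverse_1_plus_sq])
      show "norm (complex_of_real (1 / (1 + u^2)) * cis (- (\<rho> * r * p u))) \<le> 1 / (1 + u^2)" for u
        by (simp only: norm_mult norm_of_real norm_cis mult_1_right) simp
    qed measurable
    have Wsum: "W r + W (- r) = 2 * of_real (angular_mean v1 v2 (\<rho> * r))" for r
    proof -
      have "W r + W (- r) = (LBINT u. of_real (1 / (1 + u^2)) * cis (- (\<rho> * r * p u))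
          + of_real (1 / (1 + u^2)) * cis (- (\<rho> * (- r) * p u)))"
        unfolding W_def by (rule Bochner_Integration.integral_add[OF Wi Wi, symmetric])
      also have "\<dots> = (LBINT u. of_real (2 * (cos (\<rho> * r * p u) / (1 + u^2))))"
      proof (rule lint_cong)
        fix u
        have "cis (- (\<rho> * r * p u)) + cis (- (\<rho> * (- r) * p u)) = of_real (2 * cos (\<rho> * r * p u))"
          by (simp add: complex_eq_iff)
        then have "of_real (1 / (1 + u^2)) * (cis (- (\<rho> * r * p u)) + cis (- (\<rho> * (- r) * p u)))
            = complex_of_real (1 / (1 + u^2) * (2 * cos (\<rho> * r * p u)))"
          by (simp only: of_real_mult)
        then show "of_real (1 / (1 + u^2)) * cis (- (\<rho> * r * p u)) + of_real (1 / (1 + u^2)) * cis (- (\<rho> * (- r) * p u))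
            = complex_of_real (2 * (cos (\<rho> * r * p u) / (1 + u^2)))"
          by (simp only: distrib_left) simp
      qed
      also have "\<dots> = of_real (LBINT u. 2 * (cos (\<rho> * r * p u) / (1 + u^2)))"
      proof (intro integral_of_real integrable_mult_right integrable_dominated[OF integrable_inverse_1_plus_sq])
        show "norm (cos (\<rho> * r * p u) / (1 + u^2)) \<le> 1 / (1 + u^2)" for u
          using pos[of u] by (simp add: abs_divide divide_right_mono)
      qed measurable
      also have "(LBINT u. 2 * (cos (\<rho> * r * p u) / (1 + u^2))) = 2 * angular_mean v1 v2 (\<rho> * r)"
        unfolding angular_mean_def p_def by (rule integral_mult_right_zero)
      finally show ?thesis by simp
    qed
    have hW: "h r = (if \<bar>r\<bar> \<le> L \<and> r \<noteq> 0 then of_real (1 / (4 * pi)) * cis (k * \<bar>r\<bar>) * W r else 0)" for r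
      unfolding h_def H_def W_def by (cases "\<bar>r\<bar> \<le> L \<and> r \<noteq> 0") (simp_all only: integral_mult_right_zero if_True if_False Bochner_Integration.integral_zero not_False_eq_True simp_thms)
    have hg: "h r + h (- r) = (if r \<le> L then g (k * r) else 0)" if "r > 0" for r
    proof -
      have "s * (k * r) = \<rho> * r" using k by (simp add: s_def)
      then have "of_real (1 / (4 * pi)) * cis (k * r) * (W r + W (- r)) = g (k * r)"
        unfolding Wsum g_def by (simp only:) simp
      then show ?thesis using that by (simp add: hW distrib_left)
    qed
    note sc = integral_half_line_scaled[OF hi k hg]
    have "integral {0..k * L} g = of_real (1 / (2 * pi)) * integral {0..k * L} (\<lambda>x. cis x * of_real (angular_mean v1 v2 (s * x)))"
      unfolding g_def by (rule integral_mult_right)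
    then have gle: "cmod (integral {0..k * L} g) \<le> 1 / (2 * pi) * (48 * pi * (1 + sqrt (k * L)) / sqrt (1 + s^2))"
      using angular_mean_integral_bound[OF v _ s, of "k * L"] k L
      by (simp only: norm_mult norm_of_real) (intro mult_mono, auto)
    have "cmod (symbol k L \<xi>) = cmod (integral {0..k * L} g) / k"
      unfolding sym' using sc(1) k by (simp add: norm_divide)
    also have "\<dots> \<le> 1 / (2 * pi) * (48 * pi * (1 + sqrt (k * L)) / sqrt (1 + s^2)) / k"
      using gle k by (intro divide_right_mono) auto
    \<comment> \<open>The 24 is 48 pi / (2 pi), with 1 / (2 pi) = 2 / (4 pi) from the fundamental
      solution and the folding.\<close>
    also have "\<dots> = 24 * (1 + sqrt (k * L)) * (1 / sqrt (1 + (norm \<xi> / k)^2) / k)"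
    proof -
      have "1 / (2 * pi) * (48 * pi * X / S) / k = 24 * X * (1 / S / k)" for X S :: real by simp
      then show ?thesis by (simp only: s_def \<rho>_def)
    qed
    also have "\<dots> = 24 * (1 + sqrt (k * L)) / sqrt (k^2 + (norm \<xi>)^2)"
      unfolding inverse_sqrt_scale[OF k] by simp
    finally show "cmod (symbol k L \<xi>) \<le> 24 * (1 + sqrt (k * L)) / sqrt (k^2 + (norm \<xi>)^2)" .
  qed
  show "integrable lborel (cut_kernel k L :: 'a \<Rightarrow> complex)" using main(1)[of 0] by simp
  show "cmod (symbol k L \<xi>) \<le> 24 * (1 + sqrt (k * L)) / sqrt (k^2 + (norm \<xi>)^2)" by (rule main(2))
qed

section \<open>The Fourier transform of test functions\<close>

lemma lborel_integral_affine:
  fixes f :: "'a::euclidean_space \<Rightarrow> 'b::{banach, second_countable_topology}"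
  assumes c: "c \<noteq> 0" and [measurable]: "f \<in> borel_measurable borel"
  shows "(LBINT x. f x) = \<bar>c\<bar> ^ DIM('a) *\<^sub>R (LBINT x. f (t + c *\<^sub>R x))"
    and "integrable lborel (\<lambda>x. f (t + c *\<^sub>R x)) \<longleftrightarrow> integrable lborel f"
proof -
  show "(LBINT x. f x) = \<bar>c\<bar> ^ DIM('a) *\<^sub>R (LBINT x. f (t + c *\<^sub>R x))"
    by (subst lborel_affine[OF c, of t], subst integral_density)
       (auto simp: integral_distr)
  have "integrable lborel f \<longleftrightarrow> integrable lborel (\<lambda>x. \<bar>c\<bar> ^ DIM('a) *\<^sub>R f (t + c *\<^sub>R x))"
    by (subst lborel_affine[OF c, of t], subst integrable_density)
       (auto simp: integrable_distr_eq)
  moreover have "integrable lborel (\<lambda>x. f (t + c *\<^sub>R x))" if "integrable lborel (\<lambda>x. \<bar>c\<bar> ^ DIM('a) *\<^sub>R f (t + c *\<^sub>R x))"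
    using integrable_scaleR_right[of "1 / \<bar>c\<bar> ^ DIM('a)", OF that] c by simp
  ultimately show "integrable lborel (\<lambda>x. f (t + c *\<^sub>R x)) \<longleftrightarrow> integrable lborel f"
    by auto
qed

text \<open>Justifies the exchanges of integrals in the multiplication formula for Fourier
  transforms and in the convolution pairing.\<close>

lemma integrable_product_bounded:
  fixes f :: "'a::euclidean_space \<Rightarrow> complex" and g :: "'b::euclidean_space \<Rightarrow> complex"
  assumes f: "integrable lborel f" and g: "integrable lborel g"
    and [measurable]: "case_prod h \<in> borel_measurable (lborel \<Otimes>\<^sub>M lborel)" and h: "\<And>x y. cmod (h x y) \<le> B"
  shows "integrable (lborel \<Otimes>\<^sub>M lborel) (\<lambda>(x, y). f x * g y * h x y)"
proof -
  have [measurable]: "f \<in> borel_measurable borel" "g \<in> borel_measurable borel" using f g by auto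
  have B: "B \<ge> 0" using h norm_ge_zero order_trans by blast
  have gn: "integrable lborel (\<lambda>y. cmod (g y))" and fn: "integrable lborel (\<lambda>x. cmod (f x))" using f g by auto
  have "integrable (lborel \<Otimes>\<^sub>M lborel) (\<lambda>(x, y). B * (cmod (f x) * cmod (g y)))"
  proof (rule lborel_pair.Fubini_integrable)
    show "(\<lambda>(x, y). B * (cmod (f x) * cmod (g y))) \<in> borel_measurable (lborel \<Otimes>\<^sub>M lborel)" by measurable
    have "(LBINT y. norm (case (x, y) of (x, y) \<Rightarrow> B * (cmod (f x) * cmod (g y)))) = B * (LBINT y. cmod (g y)) * cmod (f x)" for x
      using B by (simp add: abs_mult)
    then show "integrable lborel (\<lambda>x. LBINT y. norm (case (x, y) of (x, y) \<Rightarrow> B * (cmod (f x) * cmod (g y))))"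
      using fn by simp
    show "AE x in lborel. integrable lborel (\<lambda>y. case (x, y) of (x, y) \<Rightarrow> B * (cmod (f x) * cmod (g y)))"
      using gn by (intro AE_I2) simp
  qed
  then show ?thesis
  proof (rule integrable_dominated)
    show "(\<lambda>(x, y). f x * g y * h x y) \<in> borel_measurable (lborel \<Otimes>\<^sub>M lborel)" by measurable
    show "norm (case z of (x, y) \<Rightarrow> f x * g y * h x y) \<le> (case z of (x, y) \<Rightarrow> B * (cmod (f x) * cmod (g y)))" for z
      using mult_left_mono[OF h[of "fst z" "snd z"], of "cmod (f (fst z)) * cmod (g (snd z))"]
      by (simp add: case_prod_beta norm_mult mult_ac)
  qed
qed

lemma integrable_continuous_compact_support:
  fixes f :: "'a::euclidean_space \<Rightarrow> complex"
  assumes "continuous_on UNIV f" "compact S" "\<And>x. x \<notin> S \<Longrightarrow> f x = 0"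
  shows "integrable lborel f"
proof -
  have "integrable lborel (\<lambda>x. indicator S x *\<^sub>R f x)"
    by (rule borel_integrable_compact[OF assms(2)]) (rule continuous_on_subset[OF assms(1)], simp)
  also have "(\<lambda>x. indicator S x *\<^sub>R f x) = f" using assms(3) by (auto simp: indicator_def)
  finally show ?thesis .
qed

text \<open>The integral of the derivative G does not change under translation, so it equals its
  average over the shifts t v with t in [0, 1]. Integrating in t first gives the integral of
  \<open>g (x + v) - g x\<close>, which is 0, again by translation. No coordinates adapted to v have
  to be chosen.\<close>

lemma integral_directional_derivative_eq_0:
  fixes g :: "'a::euclidean_space \<Rightarrow> complex"
  assumes d: "\<And>x. (g has_derivative g' x) (at x)" and c: "continuous_on UNIV (\<lambda>x. g' x v)"
    and S: "compact S" "\<And>x. x \<notin> S \<Longrightarrow> g x = 0" "\<And>x. x \<notin> S \<Longrightarrow> g' x v = 0"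
  shows "(LBINT x. g' x v) = 0"
proof -
  define G where "G x = g' x v" for x
  have [measurable]: "G \<in> borel_measurable borel"
    using borel_measurable_continuous_onI[OF c] by (simp add: G_def[abs_def])
  have cg: "continuous_on UNIV g" using d has_derivative_continuous continuous_at_imp_continuous_on by blast
  then have [measurable]: "g \<in> borel_measurable borel" by (rule borel_measurable_continuous_onI)
  have Gi: "integrable lborel G"
    using integrable_continuous_compact_support[OF c S(1,3)] by (simp add: G_def[abs_def])
  have gi: "integrable lborel g"
    by (rule integrable_continuous_compact_support[OF cg S(1,2)])
  define F where "F t x = indicator {0..1::real} t *\<^sub>R G (x + t *\<^sub>R v)" for t x
  have Gsh: "(LBINT x. G (x + a)) = (LBINT x. G x)" "(LBINT x. norm (G (x + a))) = (LBINT x. norm (G x))"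
    "integrable lborel (\<lambda>x. G (x + a))" for a
    using lborel_integral_affine(1)[of 1 G a] lborel_integral_affine(1)[of 1 "\<lambda>x. norm (G x)" a] lborel_integral_affine(2)[of 1 G a] Gi
    by (simp_all add: add.commute)
  have gsh: "(LBINT x. g (x + a)) = (LBINT x. g x)" "integrable lborel (\<lambda>x. g (x + a))" for a
    using lborel_integral_affine(1)[of 1 g a] lborel_integral_affine(2)[of 1 g a] gi
    by (simp_all add: add.commute)
  have Fi: "integrable (lborel \<Otimes>\<^sub>M lborel) (case_prod F)"
  proof (rule lborel_pair.Fubini_integrable)
    show "case_prod F \<in> borel_measurable (lborel \<Otimes>\<^sub>M lborel)" unfolding F_def by measurable
    have "(LBINT x. norm (case (t, x) of (t, x) \<Rightarrow> F t x)) = (LBINT x. norm (G x)) * indicator {0..1::real} t" for t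
      by (simp add: F_def Gsh)
    then show "integrable lborel (\<lambda>t. LBINT x. norm (case (t, x) of (t, x) \<Rightarrow> F t x))"
      by (simp add: integrable_real_indicator)
    show "AE t in lborel. integrable lborel (\<lambda>x. case (t, x) of (t, x) \<Rightarrow> F t x)"
      by (intro AE_I2) (simp add: F_def Gsh)
  qed
  have "(LBINT x. LBINT t. F t x) = (LBINT t. LBINT x. F t x)"
    by (rule lborel_pair.Fubini_integral[OF Fi])
  also have "\<dots> = (LBINT t. indicator {0..1::real} t *\<^sub>R (LBINT x. G x))"
    by (simp add: F_def Gsh)
  also have "\<dots> = (LBINT x. G x)"
    by (subst integral_scaleR_left) (auto simp: integrable_real_indicator)
  finally have eq: "(LBINT x. G x) = (LBINT x. LBINT t. F t x)" by simp
  have "(LBINT t. F t x) = g (x + v) - g x" for x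
  proof -
    have "(LBINT t. indicator {0..1} t *\<^sub>R G (x + t *\<^sub>R v)) = g (x + 1 *\<^sub>R v) - g (x + 0 *\<^sub>R v)"
    proof (rule integral_FTC_atLeastAtMost)
      fix t :: real
      have "((\<lambda>t. x + t *\<^sub>R v) has_derivative (\<lambda>h. h *\<^sub>R v)) (at t within {0..1})"
        by (auto intro!: derivative_eq_intros)
      from has_derivative_compose[OF this d]
      have "((\<lambda>t. g (x + t *\<^sub>R v)) has_derivative (\<lambda>h. g' (x + t *\<^sub>R v) (h *\<^sub>R v))) (at t within {0..1})" .
      moreover have "g' (x + t *\<^sub>R v) (h *\<^sub>R v) = h *\<^sub>R g' (x + t *\<^sub>R v) v" for h
        using has_derivative_linear[OF d] by (rule linear_cmul)
      ultimately show "((\<lambda>t. g (x + t *\<^sub>R v)) has_vector_derivative G (x + t *\<^sub>R v)) (at t within {0..1})"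
        by (simp add: has_vector_derivative_def G_def)
      show "continuous_on {0..1} (\<lambda>t. G (x + t *\<^sub>R v))"
        unfolding G_def by (rule continuous_on_compose2[OF c]) (auto intro!: continuous_intros)
    qed simp
    then show ?thesis by (simp add: F_def)
  qed
  then have "(LBINT x. G x) = (LBINT x. g (x + v) - g x)" using eq by simp
  also have "\<dots> = 0" using gsh[of v] gi by (subst Bochner_Integration.integral_diff) auto
  finally show ?thesis by (simp add: G_def)
qed

section \<open>Smooth functions of compact support\<close>

definition dir_deriv :: "'a::euclidean_space \<Rightarrow> ('a \<Rightarrow> complex) \<Rightarrow> 'a \<Rightarrow> complex" where
  "dir_deriv v f = (\<lambda>x. frechet_derivative f (at x) v)"

text \<open>\<open>iter_dderiv\<close> adds new directions on the outside, at the head of the list.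
  A derivative already taken is innermost and hence goes to the end, which shows that derivatives of
  smooth functions are smooth.\<close>

lemma iter_dderiv_append: "iter_dderiv vs (dir_deriv v f) = iter_dderiv (vs @ [v]) f"
  by (induction vs) (simp_all add: dir_deriv_def)

lemma smooth_dir_deriv: "smooth_fun f \<Longrightarrow> smooth_fun (dir_deriv v f)"
  by (simp add: smooth_fun_def iter_dderiv_append)

lemma smooth_fun_has_derivative:
  assumes "smooth_fun f"
  shows "(f has_derivative frechet_derivative f (at x)) (at x)"
proof -
  have "iter_dderiv [] f differentiable (at x)" using assms unfolding smooth_fun_def by (rule allE) (rule spec)
  then show ?thesis by (simp add: frechet_derivative_works[symmetric])
qed

lemma smooth_fun_continuous: "smooth_fun f \<Longrightarrow> continuous_on UNIV f"
  by (intro continuous_at_imp_continuous_on ballI has_derivative_continuous[OF smooth_fun_has_derivative])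

lemma smooth_fun_diff:
  assumes "smooth_fun f" "smooth_fun g"
  shows "smooth_fun (\<lambda>x. f x - g x)"
proof -
  have "iter_dderiv vs (\<lambda>x. f x - g x) = (\<lambda>x. iter_dderiv vs f x - iter_dderiv vs g x)" for vs
  proof (induction vs)
    case (Cons v vs)
    have "((\<lambda>x. iter_dderiv vs f x - iter_dderiv vs g x) has_derivative
       (\<lambda>h. frechet_derivative (iter_dderiv vs f) (at x) h - frechet_derivative (iter_dderiv vs g) (at x) h)) (at x)" for x
      using assms unfolding smooth_fun_def frechet_derivative_works by (intro has_derivative_diff) blast+
    from frechet_derivative_at[OF this, symmetric] show ?case by (simp add: Cons)
  qed simp
  then show ?thesis using assms unfolding smooth_fun_def by (auto intro!: differentiable_diff)
qed

text \<open>Test functions detached from \<Gamma>. Any compact set off which f vanishes replaces the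
  closed support, so closure under differences and derivatives requires no computation of
  supports.\<close>

definition cc_smooth :: "('a::euclidean_space \<Rightarrow> complex) set" where
  "cc_smooth = {f. smooth_fun f \<and> (\<exists>S. compact S \<and> (\<forall>x. x \<notin> S \<longrightarrow> f x = 0))}"

lemma test_funs_subset_cc_smooth: "test_funs \<Gamma> \<subseteq> cc_smooth"
proof
  fix f :: "'a \<Rightarrow> complex" assume f: "f \<in> test_funs \<Gamma>"
  have "\<forall>x. x \<notin> closure {x. f x \<noteq> 0} \<longrightarrow> f x = 0" using closure_subset[of "{x. f x \<noteq> 0}"] by blast
  then show "f \<in> cc_smooth" using f unfolding test_funs_def cc_smooth_def by blast
qed

lemma dir_deriv_eq_0:
  assumes "compact S" "\<And>x. x \<notin> S \<Longrightarrow> f x = 0" "x \<notin> S"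
  shows "dir_deriv v f x = 0"
proof -
  have "((\<lambda>x. 0) has_derivative (\<lambda>h. 0)) (at x)" by simp
  then have "(f has_derivative (\<lambda>h. 0)) (at x)"
    by (rule has_derivative_transform_within_open[of _ _ _ _ "- S"])
       (use assms in \<open>auto simp: compact_imp_closed open_Compl\<close>)
  from frechet_derivative_at[OF this] show ?thesis unfolding dir_deriv_def by metis
qed

lemma cc_smoothE:
  assumes "f \<in> cc_smooth"
  obtains S where "smooth_fun f" "compact S" "\<And>x. x \<notin> S \<Longrightarrow> f x = 0"
  using assms by (auto simp: cc_smooth_def)

lemma cc_smoothI: "smooth_fun f \<Longrightarrow> compact S \<Longrightarrow> (\<And>x. x \<notin> S \<Longrightarrow> f x = 0) \<Longrightarrow> f \<in> cc_smooth"
  by (auto simp: cc_smooth_def)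

lemma cc_smooth_dir_deriv:
  assumes "f \<in> cc_smooth"
  shows "dir_deriv v f \<in> cc_smooth"
  using assms by (rule cc_smoothE) (rule cc_smoothI[OF smooth_dir_deriv _ dir_deriv_eq_0])

lemma cc_smooth_diff:
  assumes "f \<in> cc_smooth" "g \<in> cc_smooth"
  shows "(\<lambda>x. f x - g x) \<in> cc_smooth"
proof -
  obtain S T where "compact S" "\<forall>x. x \<notin> S \<longrightarrow> f x = 0" "compact T" "\<forall>x. x \<notin> T \<longrightarrow> g x = 0"
    using assms unfolding cc_smooth_def by blast
  then have "compact (S \<union> T) \<and> (\<forall>x. x \<notin> S \<union> T \<longrightarrow> f x - g x = 0)" by auto
  then show ?thesis using assms smooth_fun_diff unfolding cc_smooth_def by blast
qed

lemma cc_smooth_integrable: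
  assumes "f \<in> cc_smooth"
  shows "integrable lborel f"
  using assms by (rule cc_smoothE) (rule integrable_continuous_compact_support[OF smooth_fun_continuous])

lemma cc_smooth_measurable:
  assumes "f \<in> cc_smooth"
  shows "f \<in> borel_measurable borel"
  using assms by (rule cc_smoothE) (rule borel_measurable_continuous_onI[OF smooth_fun_continuous])

lemma integrable_cis_mult:
  fixes f :: "'a::euclidean_space \<Rightarrow> complex"
  assumes "integrable lborel f"
  shows "integrable lborel (\<lambda>x. cis (- (\<xi> \<bullet> x)) * f x)"
  by (rule Bochner_Integration.integrable_bound[OF assms]) (use assms in \<open>auto simp: norm_mult\<close>)

lemma fourier_diff:
  assumes "integrable lborel f" "integrable lborel g"
  shows "fourier (\<lambda>x. f x - g x) \<xi> = fourier f \<xi> - fourier g \<xi>"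
  using Bochner_Integration.integral_diff[OF integrable_cis_mult[OF assms(1), of \<xi>] integrable_cis_mult[OF assms(2), of \<xi>]]
  by (simp add: fourier_def right_diff_distrib)

lemma fourier_dir_deriv:
  assumes f: "f \<in> cc_smooth"
  shows "fourier (dir_deriv v f) \<xi> = \<i> * of_real (\<xi> \<bullet> v) * fourier f \<xi>"
proof -
  obtain S where sm: "smooth_fun f" and S: "compact S" "\<And>x. x \<notin> S \<Longrightarrow> f x = 0"
    using f unfolding cc_smooth_def by blast
  define g where "g x = cis (- (\<xi> \<bullet> x)) * f x" for x
  define g' where "g' x h = cis (- (\<xi> \<bullet> x)) * frechet_derivative f (at x) h
      + (- (\<xi> \<bullet> h)) *\<^sub>R (\<i> * cis (- (\<xi> \<bullet> x))) * f x" for x h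
  have "(g has_derivative g' x) (at x)" for x
    unfolding g_def g'_def
    by (rule derivative_eq_intros smooth_fun_has_derivative[OF sm] refl | simp)+
  moreover have "continuous_on UNIV (\<lambda>x. g' x v)"
    using smooth_fun_continuous[OF smooth_dir_deriv[OF sm, of v]] smooth_fun_continuous[OF sm]
    unfolding g'_def dir_deriv_def by (auto intro!: continuous_intros)
  moreover have "g x = 0" "g' x v = 0" if "x \<notin> S" for x
    using S(2)[OF that] dir_deriv_eq_0[OF S that, where v = v] by (simp_all add: g_def g'_def dir_deriv_def)
  ultimately have 0: "(LBINT x. g' x v) = 0"
    by (intro integral_directional_derivative_eq_0[OF _ _ S(1)])
  have i1: "integrable lborel (\<lambda>x. cis (- (\<xi> \<bullet> x)) * dir_deriv v f x)"
    by (intro integrable_cis_mult cc_smooth_integrable cc_smooth_dir_deriv f)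
  have i2: "integrable lborel (\<lambda>x. \<i> * of_real (\<xi> \<bullet> v) * (cis (- (\<xi> \<bullet> x)) * f x))"
    by (intro integrable_mult_right integrable_cis_mult cc_smooth_integrable f)
  have "g' x v = cis (- (\<xi> \<bullet> x)) * dir_deriv v f x - \<i> * of_real (\<xi> \<bullet> v) * (cis (- (\<xi> \<bullet> x)) * f x)" for x
    by (simp add: g'_def dir_deriv_def scaleR_conv_of_real)
  then have "(LBINT x. cis (- (\<xi> \<bullet> x)) * dir_deriv v f x) = (LBINT x. \<i> * of_real (\<xi> \<bullet> v) * (cis (- (\<xi> \<bullet> x)) * f x))"
    using 0 Bochner_Integration.integral_diff[OF i1 i2] by simp
  also have "\<dots> = \<i> * of_real (\<xi> \<bullet> v) * (LBINT x. cis (- (\<xi> \<bullet> x)) * f x)" by (rule integral_mult_right_zero)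
  finally show ?thesis by (simp add: fourier_def)
qed

text \<open>A product replaces the powers of 1 + |\<xi>|^2: it dominates that weight, its reciprocal
  is integrable in every dimension as a product of one-dimensional functions, and it is the symbol
  of a product of operators 1 - d_b^2, one for each basis vector b.\<close>

definition basis_weight :: "'a::euclidean_space \<Rightarrow> real" where
  "basis_weight \<xi> = (\<Prod>b\<in>Basis. 1 + (\<xi> \<bullet> b)^2)"

lemma fourier_mult_list:
  assumes f: "f \<in> cc_smooth"
  shows "\<exists>g\<in>cc_smooth. \<forall>\<xi>. fourier g \<xi> = of_real (\<Prod>b\<leftarrow>bs. 1 + (\<xi> \<bullet> b)^2) * fourier f \<xi>"
proof (induction bs)
  case Nil
  show ?case using f by (intro bexI[of _ f]) auto
next
  case (Cons b bs)
  then obtain g where g: "g \<in> cc_smooth" "\<And>\<xi>. fourier g \<xi> = of_real (\<Prod>b\<leftarrow>bs. 1 + (\<xi> \<bullet> b)^2) * fourier f \<xi>" by blast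
  \<comment> \<open>The operator 1 - d_b^2 has the symbol 1 + (\<xi> \<bullet> b)^2.\<close>
  define h where "h x = g x - dir_deriv b (dir_deriv b g) x" for x
  have "h \<in> cc_smooth" unfolding h_def[abs_def] by (intro cc_smooth_diff cc_smooth_dir_deriv g)
  moreover have "fourier h \<xi> = of_real (1 + (\<xi> \<bullet> b)^2) * fourier g \<xi>" for \<xi>
  proof -
    have "fourier h \<xi> = fourier g \<xi> - fourier (dir_deriv b (dir_deriv b g)) \<xi>"
      unfolding h_def[abs_def] by (intro fourier_diff cc_smooth_integrable cc_smooth_dir_deriv g)
    also have "fourier (dir_deriv b (dir_deriv b g)) \<xi> = \<i> * of_real (\<xi> \<bullet> b) * (\<i> * of_real (\<xi> \<bullet> b) * fourier g \<xi>)"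
      by (simp only: fourier_dir_deriv cc_smooth_dir_deriv g)
    finally show ?thesis by (simp add: algebra_simps power2_eq_square)
  qed
  ultimately show ?case using g by (intro bexI[of _ h]) auto
qed

lemma fourier_mult_weight:
  assumes f: "f \<in> cc_smooth"
  shows "\<exists>g\<in>cc_smooth. \<forall>\<xi>::'a::euclidean_space. fourier g \<xi> = of_real (basis_weight \<xi> ^ N) * fourier f \<xi>"
proof (induction N)
  case 0
  show ?case using f by (intro bexI[of _ f]) auto
next
  case (Suc N)
  then obtain g where g: "g \<in> cc_smooth" "\<And>\<xi>::'a. fourier g \<xi> = of_real (basis_weight \<xi> ^ N) * fourier f \<xi>" by blast
  obtain bs :: "'a list" where bs: "set bs = Basis" "distinct bs" using finite_distinct_list[OF finite_Basis] by blast
  have "(\<Prod>b\<leftarrow>bs. 1 + (\<xi> \<bullet> b)^2) = basis_weight \<xi>" for \<xi> :: 'a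
    unfolding basis_weight_def using bs by (metis prod.distinct_set_conv_list)
  with fourier_mult_list[OF g(1), of bs] g(2) show ?case by (simp add: mult_ac)
qed

lemma norm_fourier_le:
  "cmod (fourier f \<xi>) \<le> (2 * pi) powr (- real DIM('a) / 2) * (LBINT x. cmod (f x))"
  for f :: "'a::euclidean_space \<Rightarrow> complex"
proof -
  have "cmod (LBINT x. cis (- (\<xi> \<bullet> x)) * f x) \<le> (LBINT x. cmod (cis (- (\<xi> \<bullet> x)) * f x))"
    by (rule integral_norm_bound)
  then show ?thesis by (simp add: fourier_def norm_mult mult_left_mono)
qed

lemma basis_weight_ge:
  "1 + (norm \<xi>)^2 \<le> basis_weight \<xi>"
proof -
  have *: "1 + (\<Sum>b\<in>A. (\<xi> \<bullet> b)^2) \<le> (\<Prod>b\<in>A. 1 + (\<xi> \<bullet> b)^2)" if "finite A" for A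
    using that
  proof (induction A)
    case (insert b A)
    have "0 \<le> (\<Sum>b\<in>A. (\<xi> \<bullet> b)^2)" by (simp add: sum_nonneg)
    then have "1 + (\<Sum>b\<in>insert b A. (\<xi> \<bullet> b)^2) \<le> (1 + (\<xi> \<bullet> b)^2) * (1 + (\<Sum>b\<in>A. (\<xi> \<bullet> b)^2))"
      using insert by (simp add: algebra_simps)
    also have "\<dots> \<le> (1 + (\<xi> \<bullet> b)^2) * (\<Prod>b\<in>A. 1 + (\<xi> \<bullet> b)^2)"
      using insert by (intro mult_left_mono) auto
    finally show ?case using insert by simp
  qed simp
  have "(norm \<xi>)^2 = (\<Sum>b\<in>Basis. (\<xi> \<bullet> b)^2)"
    unfolding power2_norm_eq_inner by (subst euclidean_inner) (simp add: power2_eq_square)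
  then show ?thesis using *[OF finite_Basis] by (simp add: basis_weight_def)
qed

lemma basis_weight_ge_1: "basis_weight \<xi> \<ge> 1"
  using basis_weight_ge[of \<xi>] by (smt (verit) zero_le_power2)

lemma measurable_basis_weight [measurable]: "basis_weight \<in> borel_measurable borel"
  unfolding basis_weight_def[abs_def] by measurable

lemma lborel_integral_prod:
  fixes f :: "'a::euclidean_space \<Rightarrow> real \<Rightarrow> 'b::{real_normed_field, banach, second_countable_topology}"
  assumes f: "\<And>b. b \<in> Basis \<Longrightarrow> integrable lborel (f b)"
  shows "integrable lborel (\<lambda>x::'a. \<Prod>b\<in>Basis. f b (x \<bullet> b))"
    and "(LBINT x. (\<Prod>b\<in>Basis. f b (x \<bullet> b))) = (\<Prod>b\<in>Basis. integral\<^sup>L lborel (f b))"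
proof -
  interpret product_sigma_finite "\<lambda>b::'a. lborel :: real measure" by standard
  have [measurable]: "f b \<in> borel_measurable borel" if "b \<in> Basis" for b using f[OF that] by auto
  have m: "(\<lambda>x::'a. \<Prod>b\<in>Basis. f b (x \<bullet> b)) \<in> borel_measurable borel" by measurable
  have s: "(\<lambda>f. \<Sum>b\<in>Basis. f b *\<^sub>R b) \<in> (\<Pi>\<^sub>M b\<in>Basis. lborel) \<rightarrow>\<^sub>M (borel :: 'a measure)" by measurable
  have eq: "(\<Prod>b\<in>Basis. f b ((\<Sum>c\<in>Basis. y c *\<^sub>R c) \<bullet> b)) = (\<Prod>b\<in>Basis. f b (y b))" for y :: "'a \<Rightarrow> real"
    by (intro prod.cong) auto
  show "integrable lborel (\<lambda>x::'a. \<Prod>b\<in>Basis. f b (x \<bullet> b))"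
    unfolding lborel_eq[where 'a='a] integrable_distr_eq[OF s m] eq by (intro product_integrable_prod f) auto
  show "(LBINT x. (\<Prod>b\<in>Basis. f b (x \<bullet> b))) = (\<Prod>b\<in>Basis. integral\<^sup>L lborel (f b))"
    unfolding lborel_eq[where 'a='a] integral_distr[OF s m] eq by (intro product_integral_prod f) auto
qed

lemma integrable_inverse_basis_weight:
  "integrable lborel (\<lambda>\<xi>::'a::euclidean_space. 1 / basis_weight \<xi>)"
proof -
  have "(\<Prod>b\<in>Basis. 1 / (1 + (\<xi> \<bullet> b)^2)) = 1 / basis_weight \<xi>" for \<xi> :: 'a
    unfolding basis_weight_def prod_dividef by (simp only: prod.neutral_const)
  then show ?thesis
    using lborel_integral_prod(1)[OF integrable_inverse_1_plus_sq, where 'a='a] by (simp only:)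
qed

lemma measurable_fourier:
  fixes f :: "'a::euclidean_space \<Rightarrow> complex"
  assumes [measurable]: "f \<in> borel_measurable borel"
  shows "fourier f \<in> borel_measurable borel"
proof -
  have "(\<lambda>\<xi>. LBINT x. cis (- (\<xi> \<bullet> x)) * f x) \<in> borel_measurable (borel :: 'a measure)" by measurable
  then show ?thesis unfolding fourier_def[abs_def] by measurable
qed

lemma measurable_cnj [measurable]: "cnj \<in> borel_measurable borel"
  by (intro borel_measurable_continuous_onI continuous_intros)

lemma integrable_mult_fourier:
  fixes f g :: "'a::euclidean_space \<Rightarrow> complex"
  assumes f: "integrable lborel f" and g: "integrable lborel g"
  shows "integrable lborel (\<lambda>\<xi>. f \<xi> * cnj (fourier g \<xi>))"
proof (rule integrable_dominated)
  define B where "B = (2 * pi) powr (- real DIM('a) / 2) * (LBINT x. cmod (g x))"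
  have [measurable]: "f \<in> borel_measurable borel" "g \<in> borel_measurable borel" using f g by auto
  note [measurable] = measurable_fourier[of g]
  show "integrable lborel (\<lambda>\<xi>. B * cmod (f \<xi>))" using f by auto
  show "(\<lambda>\<xi>. f \<xi> * cnj (fourier g \<xi>)) \<in> borel_measurable lborel" by measurable
  show "norm (f \<xi> * cnj (fourier g \<xi>)) \<le> B * cmod (f \<xi>)" for \<xi>
    using mult_right_mono[OF norm_fourier_le[of g \<xi>, folded B_def] norm_ge_zero[of "f \<xi>"]]
    by (simp add: norm_mult mult.commute)
qed

lemma fourier_rapid_decay:
  fixes f :: "'a::euclidean_space \<Rightarrow> complex"
  assumes f: "f \<in> cc_smooth"
  shows "\<exists>C\<ge>0. \<forall>\<xi>. cmod (fourier f \<xi>) \<le> C / basis_weight \<xi> ^ N"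
proof -
  obtain g where g: "g \<in> cc_smooth" "\<And>\<xi>::'a. fourier g \<xi> = of_real (basis_weight \<xi> ^ N) * fourier f \<xi>"
    using fourier_mult_weight[OF f] by blast
  define C where "C = (2 * pi) powr (- real DIM('a) / 2) * (LBINT x. cmod (g x))"
  have "cmod (fourier f \<xi>) \<le> C / basis_weight \<xi> ^ N" for \<xi>
  proof -
    have p: "basis_weight \<xi> ^ N > 0" using basis_weight_ge_1[of \<xi>] by simp
    have "basis_weight \<xi> ^ N * cmod (fourier f \<xi>) = cmod (fourier g \<xi>)"
      using p by (simp add: g(2) norm_mult abs_of_pos del: of_real_power)
    also have "\<dots> \<le> C" unfolding C_def by (rule norm_fourier_le)
    finally show ?thesis using p by (simp add: field_simps)
  qed
  moreover have "C \<ge> 0" unfolding C_def by simp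
  ultimately show ?thesis by blast
qed

section \<open>The Parseval identity\<close>

lemma integrable_weighted_fourier_sq:
  fixes f :: "'a::euclidean_space \<Rightarrow> complex"
  assumes f: "f \<in> cc_smooth"
  shows "integrable lborel (\<lambda>\<xi>. (1 + (norm \<xi>)^2) powr s * (cmod (fourier f \<xi>))^2)"
proof -
  note [measurable] = measurable_fourier[OF cc_smooth_measurable[OF f]]
  \<comment> \<open>n \<ge> |s| bounds the weight by P^n. Decay of order n + 1, squared, then leaves
    at most the integrable factor 1/P.\<close>
  define n where "n = nat \<lceil>\<bar>s\<bar>\<rceil>"
  obtain C where C0: "C \<ge> 0" and Call: "\<forall>\<xi>. cmod (fourier f \<xi>) \<le> C / basis_weight \<xi> ^ Suc n"
    using fourier_rapid_decay[OF f, of "Suc n"] by (elim exE conjE)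
  note C = C0 Call[THEN spec]
  show ?thesis
  proof (rule integrable_dominated)
    show "integrable lborel (\<lambda>\<xi>::'a. C^2 * (1 / basis_weight \<xi>))"
      by (intro integrable_mult_right integrable_inverse_basis_weight)
    show "(\<lambda>\<xi>. (1 + (norm \<xi>)^2) powr s * (cmod (fourier f \<xi>))^2) \<in> borel_measurable lborel" by measurable
    show "norm ((1 + (norm \<xi>)^2) powr s * (cmod (fourier f \<xi>))^2) \<le> C^2 * (1 / basis_weight \<xi>)" for \<xi>
    proof -
      define P where "P = basis_weight \<xi>"
      have P: "P \<ge> 1" unfolding P_def by (rule basis_weight_ge_1)
      have "(1 + (norm \<xi>)^2) powr s \<le> (1 + (norm \<xi>)^2) powr real n"
        by (intro powr_mono) (auto simp: n_def, linarith)
      also have "\<dots> = (1 + (norm \<xi>)^2) ^ n" by (rule powr_realpow) (simp add: add_pos_nonneg)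
      also have "\<dots> \<le> P ^ n" unfolding P_def by (intro power_mono basis_weight_ge) auto
      finally have 1: "(1 + (norm \<xi>)^2) powr s \<le> P ^ n" .
      have "(cmod (fourier f \<xi>))^2 \<le> (C / P ^ Suc n)^2" unfolding P_def by (intro power_mono C) auto
      then have "(1 + (norm \<xi>)^2) powr s * (cmod (fourier f \<xi>))^2 \<le> P ^ n * (C / P ^ Suc n)^2"
        using 1 P by (intro mult_mono) auto
      also have "\<dots> = C^2 * (1 / P) * (1 / P ^ Suc n)"
        using P by (simp add: power2_eq_square field_simps)
      also have "\<dots> \<le> C^2 * (1 / P) * 1"
        using P one_le_power[OF P, of "Suc n"] by (intro mult_left_mono) (auto simp del: power_Suc)
      finally show ?thesis by (simp add: P_def)
    qed
  qed
qed

lemma integrable_fourier: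
  fixes f :: "'a::euclidean_space \<Rightarrow> complex"
  assumes f: "f \<in> cc_smooth"
  shows "integrable lborel (fourier f)"
proof -
  obtain C where C0: "C \<ge> 0" and Call: "\<forall>\<xi>. cmod (fourier f \<xi>) \<le> C / basis_weight \<xi> ^ 1"
    using fourier_rapid_decay[OF f, of 1] by (elim exE conjE)
  note C = C0 Call[THEN spec]
  show ?thesis
  proof (rule integrable_dominated)
    show "integrable lborel (\<lambda>\<xi>::'a. C * (1 / basis_weight \<xi>))"
      by (intro integrable_mult_right integrable_inverse_basis_weight)
    show "fourier f \<in> borel_measurable lborel" using measurable_fourier[OF cc_smooth_measurable[OF f]] by simp
    show "norm (fourier f \<xi>) \<le> C * (1 / basis_weight \<xi>)" for \<xi> using C(2)[of \<xi>] by simp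
  qed
qed

section \<open>Gaussian regularisation\<close>

definition gauss :: "'a::euclidean_space \<Rightarrow> real" where
  "gauss x = exp (- (norm x)\<^sup>2 / 2)"

lemma measurable_gauss [measurable]: "gauss \<in> borel_measurable borel"
  unfolding gauss_def[abs_def] by measurable

lemma gauss_bounds: "0 \<le> gauss x" "gauss x \<le> 1" "gauss (- x) = gauss x" "gauss 0 = 1"
  by (simp_all add: gauss_def)

text \<open>Up to the factor sqrt (2 pi) this is the characteristic function of the standard normal
  distribution.\<close>

lemma exp_square_cis:
  "integrable lborel (\<lambda>t. complex_of_real (exp (- t\<^sup>2 / 2)) * cis (t * s))"
  "(LBINT t. complex_of_real (exp (- t\<^sup>2 / 2)) * cis (t * s)) = of_real (sqrt (2 * pi) * exp (- s\<^sup>2 / 2))"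
proof -
  have e: "exp (- t\<^sup>2 / 2) = sqrt (2 * pi) * std_normal_density t" for t
    by (simp add: std_normal_density_def)
  have i: "integrable lborel (\<lambda>t. std_normal_density t)"
    by (rule integrable_normal_density) simp
  then have i': "integrable lborel (\<lambda>t. complex_of_real (std_normal_density t) * cis (t * s))"
    by (rule Bochner_Integration.integrable_bound) (auto simp: norm_mult)
  have eq: "complex_of_real (exp (- t\<^sup>2 / 2)) * cis (t * s) = of_real (sqrt (2 * pi)) * (complex_of_real (std_normal_density t) * cis (t * s))" for t
    unfolding e by simp
  show "integrable lborel (\<lambda>t. complex_of_real (exp (- t\<^sup>2 / 2)) * cis (t * s))"
    unfolding eq by (rule integrable_mult_right[OF i'])
  have "(LBINT t. complex_of_real (std_normal_density t) * cis (t * s)) = char std_normal_distribution s"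
    unfolding char_def
    by (subst integral_density) (auto simp: normal_density_nonneg scaleR_conv_of_real cis_conv_exp mult_ac)
  then show "(LBINT t. complex_of_real (exp (- t\<^sup>2 / 2)) * cis (t * s)) = of_real (sqrt (2 * pi) * exp (- s\<^sup>2 / 2))"
    unfolding eq integral_mult_right_zero char_std_normal_distribution by simp
qed

lemma gauss_fourier:
  fixes z :: "'a::euclidean_space"
  shows "integrable lborel (\<lambda>x. complex_of_real (gauss x) * cis (x \<bullet> z))"
    and "(LBINT x. complex_of_real (gauss x) * cis (x \<bullet> z)) = of_real ((2 * pi) powr (real DIM('a) / 2) * gauss z)"
proof -
  have n2: "(norm x)^2 = (\<Sum>b\<in>Basis. (x \<bullet> b)^2)" for x :: 'a
    unfolding power2_norm_eq_inner by (subst euclidean_inner) (simp add: power2_eq_square)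
  have g: "gauss x = (\<Prod>b\<in>Basis. exp (- (x \<bullet> b)\<^sup>2 / 2))" for x :: 'a
    unfolding gauss_def n2 by (simp add: exp_sum[symmetric] sum_negf[symmetric] sum_divide_distrib)
  have c: "cis (x \<bullet> z) = (\<Prod>b\<in>Basis. cis ((x \<bullet> b) * (z \<bullet> b)))" for x
    unfolding cis_conv_exp by (subst euclidean_inner) (simp add: exp_sum[symmetric] sum_distrib_left)
  have eq: "complex_of_real (gauss x) * cis (x \<bullet> z) = (\<Prod>b\<in>Basis. complex_of_real (exp (- (x \<bullet> b)\<^sup>2 / 2)) * cis ((x \<bullet> b) * (z \<bullet> b)))" for x
    unfolding g c of_real_prod by (rule prod.distrib[symmetric])
  show "integrable lborel (\<lambda>x. complex_of_real (gauss x) * cis (x \<bullet> z))"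
    unfolding eq by (rule lborel_integral_prod(1)[where f = "\<lambda>b t. complex_of_real (exp (- t\<^sup>2 / 2)) * cis (t * (z \<bullet> b))"])
      (rule exp_square_cis)
  have "(LBINT x. complex_of_real (gauss x) * cis (x \<bullet> z))
      = (\<Prod>b\<in>(Basis::'a set). of_real (sqrt (2 * pi) * exp (- (z \<bullet> b)\<^sup>2 / 2)))"
    unfolding eq exp_square_cis(2)[symmetric]
    by (rule lborel_integral_prod(2)[where f = "\<lambda>b t. complex_of_real (exp (- t\<^sup>2 / 2)) * cis (t * (z \<bullet> b))"])
      (rule exp_square_cis)
  also have "\<dots> = of_real (sqrt (2 * pi) ^ DIM('a) * gauss z)"
    unfolding g of_real_prod[symmetric] by (simp only: prod.distrib prod_constant)
  also have "sqrt (2 * pi) ^ DIM('a) = (2 * pi) powr (real DIM('a) / 2)"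
    by (simp add: powr_half_sqrt[symmetric] powr_powr powr_realpow[symmetric])
  finally show "(LBINT x. complex_of_real (gauss x) * cis (x \<bullet> z)) = of_real ((2 * pi) powr (real DIM('a) / 2) * gauss z)" .
qed

lemma integrable_gauss: "integrable lborel (\<lambda>x::'a::euclidean_space. complex_of_real (gauss x))"
  using gauss_fourier(1)[of 0] by simp

lemma integral_gauss: "(LBINT x. complex_of_real (gauss (x::'a::euclidean_space))) = of_real ((2 * pi) powr (real DIM('a) / 2))"
  using gauss_fourier(2)[of "0::'a"] by (simp add: gauss_bounds)

lemma gauss_scaled_fourier:
  fixes w :: "'a::euclidean_space"
  assumes e: "\<epsilon> > 0"
  shows "(LBINT \<xi>. complex_of_real (gauss (\<epsilon> *\<^sub>R \<xi>)) * cis (- (\<xi> \<bullet> w)))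
     = of_real ((1 / \<epsilon>) ^ DIM('a) * ((2 * pi) powr (real DIM('a) / 2) * gauss ((1 / \<epsilon>) *\<^sub>R w)))"
    and "integrable lborel (\<lambda>\<xi>::'a. complex_of_real (gauss (\<epsilon> *\<^sub>R \<xi>)))"
proof -
  have "(LBINT \<xi>. complex_of_real (gauss (\<epsilon> *\<^sub>R \<xi>)) * cis (- (\<xi> \<bullet> w)))
    = \<bar>1 / \<epsilon>\<bar> ^ DIM('a) *\<^sub>R (LBINT x. complex_of_real (gauss (\<epsilon> *\<^sub>R (0 + (1 / \<epsilon>) *\<^sub>R x))) * cis (- ((0 + (1 / \<epsilon>) *\<^sub>R x) \<bullet> w)))"
    by (rule lborel_integral_affine(1)) (use e in auto)
  also have "\<dots> = (1 / \<epsilon>) ^ DIM('a) *\<^sub>R (LBINT x. complex_of_real (gauss x) * cis (x \<bullet> (- ((1 / \<epsilon>) *\<^sub>R w))))"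
    using e by (simp add: inner_simps)
  finally show "(LBINT \<xi>. complex_of_real (gauss (\<epsilon> *\<^sub>R \<xi>)) * cis (- (\<xi> \<bullet> w)))
     = of_real ((1 / \<epsilon>) ^ DIM('a) * ((2 * pi) powr (real DIM('a) / 2) * gauss ((1 / \<epsilon>) *\<^sub>R w)))"
    unfolding gauss_fourier(2) gauss_bounds(3) by (simp add: scaleR_conv_of_real)
  show "integrable lborel (\<lambda>\<xi>::'a. complex_of_real (gauss (\<epsilon> *\<^sub>R \<xi>)))"
    using lborel_integral_affine(2)[of \<epsilon> "\<lambda>x::'a. complex_of_real (gauss x)" 0] e integrable_gauss by simp
qed

text \<open>The multiplication formula is Fubini's theorem for the symmetric kernel
  \<open>cis (- (\<xi> \<bullet> x))\<close>, and integrability of both functions is enough for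
  it.\<close>

lemma integral_fourier_mult:
  fixes f h :: "'a::euclidean_space \<Rightarrow> complex"
  assumes f: "integrable lborel f" and h: "integrable lborel h"
  shows "(LBINT \<xi>. fourier f \<xi> * h \<xi>) = (LBINT x. f x * fourier h x)"
proof -
  define c where "c = complex_of_real ((2 * pi) powr (- real DIM('a) / 2))"
  have p: "integrable (lborel \<Otimes>\<^sub>M lborel) (\<lambda>(x, \<xi>). f x * h \<xi> * cis (- (\<xi> \<bullet> x)))"
    by (rule integrable_product_bounded[OF f h, of "\<lambda>x \<xi>. cis (- (\<xi> \<bullet> x))" 1]) auto
  have 1: "fourier f \<xi> * h \<xi> = c * (LBINT x. f x * h \<xi> * cis (- (\<xi> \<bullet> x)))" for \<xi>
  proof -
    have "(LBINT x. f x * h \<xi> * cis (- (\<xi> \<bullet> x))) = (LBINT x. h \<xi> * (cis (- (\<xi> \<bullet> x)) * f x))" by (simp only: mult_ac)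
    then show ?thesis by (simp add: fourier_def c_def)
  qed
  have 2: "f x * fourier h x = c * (LBINT \<xi>. f x * h \<xi> * cis (- (\<xi> \<bullet> x)))" for x
  proof -
    have "(LBINT \<xi>. f x * h \<xi> * cis (- (\<xi> \<bullet> x))) = (LBINT \<xi>. f x * (cis (- (x \<bullet> \<xi>)) * h \<xi>))"
      by (simp only: mult_ac inner_commute)
    then show ?thesis by (simp add: fourier_def c_def)
  qed
  show ?thesis unfolding 1 2 integral_mult_right_zero lborel_pair.Fubini_integral[OF p] ..
qed

text \<open>\<open>fourier g\<close> is bounded but perhaps not integrable; the Gaussian factor
  makes the product \<open>G\<close> integrable, so that the multiplication formula moves the
  transform from f to \<open>G\<close>. A second use of the formula evaluates
  \<open>fourier G\<close> as an average of g around x at scale \<epsilon>.\<close>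

lemma parseval_regularised:
  fixes f g :: "'a::euclidean_space \<Rightarrow> complex"
  assumes f: "integrable lborel f" and g: "integrable lborel g" and e: "\<epsilon> > 0"
  shows "(LBINT \<xi>. fourier f \<xi> * cnj (fourier g \<xi>) * of_real (gauss (\<epsilon> *\<^sub>R \<xi>)))
    = of_real ((2 * pi) powr (- real DIM('a) / 2)) * (LBINT x. f x * (LBINT z. cnj (g (x - \<epsilon> *\<^sub>R z)) * of_real (gauss z)))"
proof -
  define c where "c = complex_of_real ((2 * pi) powr (- real DIM('a) / 2))"
  define d where "d = complex_of_real ((2 * pi) powr (real DIM('a) / 2))"
  have cd: "c * d = 1" unfolding c_def d_def of_real_mult[symmetric] by (simp add: powr_add[symmetric])
  have gm [measurable]: "g \<in> borel_measurable borel" using g by auto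
  define \<gamma> where "\<gamma> \<xi> = complex_of_real (gauss (\<epsilon> *\<^sub>R \<xi>))" for \<xi> :: 'a
  have gi: "integrable lborel \<gamma>" unfolding \<gamma>_def by (rule gauss_scaled_fourier(2)[OF e])
  define G where "G \<xi> = cnj (fourier g \<xi>) * \<gamma> \<xi>" for \<xi>
  have Gi: "integrable lborel G"
    using integrable_mult_fourier[OF gi g] by (simp add: G_def[abs_def] mult.commute)
  have FG: "fourier G x = c * (LBINT z. cnj (g (x - \<epsilon> *\<^sub>R z)) * of_real (gauss z))" for x
  proof -
    \<comment> \<open>The transform of this modulated Gaussian is a Gaussian of width \<epsilon>
      centred at x. The substitution y = x - \<epsilon> z then cancels the powers of
      \<epsilon>.\<close>
    define h where "h \<xi> = cis (x \<bullet> \<xi>) * \<gamma> \<xi>" for \<xi>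
    have hi: "integrable lborel h" using integrable_cis_mult[OF gi, of "- x"] by (simp add: h_def[abs_def])
    then have hm: "h \<in> borel_measurable borel" by simp
    note [measurable] = measurable_fourier[OF hm]
    have fh: "fourier h y = of_real ((1 / \<epsilon>) ^ DIM('a) * gauss ((1 / \<epsilon>) *\<^sub>R (y - x)))" for y
    proof -
      have "(LBINT \<xi>. cis (- (y \<bullet> \<xi>)) * h \<xi>) = (LBINT \<xi>. \<gamma> \<xi> * cis (- (\<xi> \<bullet> (y - x))))"
        by (rule lint_cong) (simp add: h_def cis_mult mult.assoc[symmetric] inner_diff_right inner_commute mult.commute[of "\<gamma> _"])
      then have "fourier h y = c * (d * of_real ((1 / \<epsilon>) ^ DIM('a) * gauss ((1 / \<epsilon>) *\<^sub>R (y - x))))"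
        unfolding fourier_def \<gamma>_def gauss_scaled_fourier(1)[OF e] c_def d_def by (simp add: mult_ac)
      then show ?thesis by (simp only: mult.assoc[symmetric] cd mult_1)
    qed
    have "cnj (LBINT \<xi>. cis (- (x \<bullet> \<xi>)) * G \<xi>) = (LBINT \<xi>. cnj (cis (- (x \<bullet> \<xi>)) * G \<xi>))"
      by (rule Bochner_Integration.integral_cnj[symmetric])
    also have "\<dots> = (LBINT \<xi>. fourier g \<xi> * h \<xi>)"
      by (rule lint_cong) (simp add: G_def h_def \<gamma>_def cis_cnj mult_ac)
    also have "\<dots> = (LBINT y. g y * fourier h y)" by (rule integral_fourier_mult[OF g hi])
    also have "\<dots> = \<bar>- \<epsilon>\<bar> ^ DIM('a) *\<^sub>R (LBINT z. g (x + (- \<epsilon>) *\<^sub>R z) * fourier h (x + (- \<epsilon>) *\<^sub>R z))"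
      by (rule lborel_integral_affine(1)) (use e in auto)
    also have "\<dots> = (LBINT z. of_real (\<epsilon> ^ DIM('a)) * (g (x - \<epsilon> *\<^sub>R z) * (of_real ((1 / \<epsilon>) ^ DIM('a)) * of_real (gauss z))))"
      unfolding fh integral_mult_right_zero using e by (simp add: scaleR_conv_of_real gauss_bounds)
    also have "\<dots> = (LBINT z. g (x - \<epsilon> *\<^sub>R z) * of_real (gauss z))"
      using e by (intro lint_cong) (simp add: power_divide)
    finally have "(LBINT \<xi>. cis (- (x \<bullet> \<xi>)) * G \<xi>) = cnj (LBINT z. g (x - \<epsilon> *\<^sub>R z) * of_real (gauss z))"
      by (metis complex_cnj_cnj)
    also have "\<dots> = (LBINT z. cnj (g (x - \<epsilon> *\<^sub>R z) * of_real (gauss z)))" by (rule Bochner_Integration.integral_cnj[symmetric])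
    finally show ?thesis by (simp add: fourier_def c_def)
  qed
  have "(LBINT \<xi>. fourier f \<xi> * cnj (fourier g \<xi>) * of_real (gauss (\<epsilon> *\<^sub>R \<xi>))) = (LBINT \<xi>. fourier f \<xi> * G \<xi>)"
    by (simp only: G_def \<gamma>_def mult.assoc)
  also have "\<dots> = (LBINT x. c * (f x * (LBINT z. cnj (g (x - \<epsilon> *\<^sub>R z)) * of_real (gauss z))))"
    unfolding integral_fourier_mult[OF f Gi] FG by (simp only: mult_ac)
  finally show ?thesis unfolding integral_mult_right_zero c_def .
qed

text \<open>As \<epsilon> tends to 0, the averages of g converge pointwise by continuity and are
  dominated because g is bounded; on the other side the assumed integrability of the product
  dominates. The mass of the Gaussian cancels the remaining power of 2 pi. Neither Fourier inversion
  nor an L^2 theory is involved.\<close>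

lemma parseval:
  fixes f g :: "'a::euclidean_space \<Rightarrow> complex"
  assumes f: "integrable lborel f" and g: "integrable lborel g" and cg: "continuous_on UNIV g" and B: "\<And>x. cmod (g x) \<le> B"
    and fg: "integrable lborel (\<lambda>\<xi>. fourier f \<xi> * cnj (fourier g \<xi>))"
  shows "(LBINT \<xi>. fourier f \<xi> * cnj (fourier g \<xi>)) = (LBINT x. f x * cnj (g x))"
proof -
  have fm [measurable]: "f \<in> borel_measurable borel" and gm [measurable]: "g \<in> borel_measurable borel"
    using f g by auto
  note [measurable] = measurable_fourier[OF fm] measurable_fourier[OF gm]
  define c where "c = complex_of_real ((2 * pi) powr (- real DIM('a) / 2))"
  define e where "e n = inverse (real (Suc n))" for n
  have e0: "e n > 0" for n by (simp add: e_def)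
  have el: "e \<longlonglongrightarrow> 0" unfolding e_def by (rule LIMSEQ_inverse_real_of_nat)
  define I where "I n x = (LBINT z. cnj (g (x - e n *\<^sub>R z)) * of_real (gauss z))" for n x
  have gn: "integrable lborel (\<lambda>z::'a. B * gauss z)"
    using integrable_norm[OF integrable_gauss[where 'a='a]] by (simp add: gauss_bounds)
  have bnd: "cmod (cnj (g (x - e n *\<^sub>R z)) * of_real (gauss z)) \<le> B * gauss z" for n x z
    using B[of "x - e n *\<^sub>R z"] by (simp add: norm_mult gauss_bounds mult_right_mono)
  have Ilim: "(\<lambda>n. I n x) \<longlonglongrightarrow> (LBINT z. cnj (g x) * of_real (gauss (z::'a)))" for x
    unfolding I_def
  proof (rule Bochner_Integration.integral_dominated_convergence[where w = "\<lambda>z. B * gauss (z::'a)"])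
    show "AE z in lborel. (\<lambda>n. cnj (g (x - e n *\<^sub>R z)) * of_real (gauss z)) \<longlonglongrightarrow> cnj (g x) * of_real (gauss z)"
    proof (intro AE_I2 tendsto_intros)
      fix z
      have "(\<lambda>n. x - e n *\<^sub>R z) \<longlonglongrightarrow> x - 0 *\<^sub>R z" by (intro tendsto_intros el)
      then have "(\<lambda>n. x - e n *\<^sub>R z) \<longlonglongrightarrow> x" by simp
      moreover have "isCont g x" using cg by (simp add: continuous_on_eq_continuous_at)
      ultimately show "(\<lambda>n. g (x - e n *\<^sub>R z)) \<longlonglongrightarrow> g x" by (rule isCont_tendsto_compose[rotated])
    qed
    show "AE z in lborel. norm (cnj (g (x - e n *\<^sub>R z)) * of_real (gauss z)) \<le> B * gauss z" for n
      using bnd by simp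
    show "integrable lborel (\<lambda>z::'a. B * gauss z)" by (rule gn)
  qed measurable
  have Ib: "cmod (I n x) \<le> (LBINT z. B * gauss (z::'a))" for n x
  proof -
    have "integrable lborel (\<lambda>z. cnj (g (x - e n *\<^sub>R z)) * of_real (gauss z))"
      by (rule integrable_dominated[OF gn _ bnd]) measurable
    then show ?thesis unfolding I_def using bnd gn by (intro Bochner_Integration.integral_norm_bound_integral) auto
  qed
  have Im: "I n \<in> borel_measurable borel" for n unfolding I_def[abs_def] by measurable
  have "(\<lambda>n. LBINT x. f x * I n x) \<longlonglongrightarrow> (LBINT x. f x * (LBINT z. cnj (g x) * of_real (gauss (z::'a))))"
  proof (rule Bochner_Integration.integral_dominated_convergence[where w = "\<lambda>x. cmod (f x) * (LBINT z. B * gauss (z::'a))"])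
    show "AE x in lborel. (\<lambda>n. f x * I n x) \<longlonglongrightarrow> f x * (LBINT z. cnj (g x) * of_real (gauss (z::'a)))"
      by (intro AE_I2 tendsto_intros Ilim)
    show "AE x in lborel. norm (f x * I n x) \<le> cmod (f x) * (LBINT z. B * gauss (z::'a))" for n
      using Ib by (intro AE_I2) (simp add: norm_mult mult_left_mono)
    show "integrable lborel (\<lambda>x. cmod (f x) * (LBINT z. B * gauss (z::'a)))" using f by (intro integrable_mult_left) auto
    show "(\<lambda>x. f x * I n x) \<in> borel_measurable lborel" for n using Im by measurable
    show "(\<lambda>x. f x * (LBINT z. cnj (g x) * of_real (gauss (z::'a)))) \<in> borel_measurable lborel" by simp
  qed
  then have r: "(\<lambda>n. c * (LBINT x. f x * I n x)) \<longlonglongrightarrow> c * (LBINT x. f x * (LBINT z. cnj (g x) * of_real (gauss (z::'a))))"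
    by (rule tendsto_mult_left)
  have "(\<lambda>n. LBINT \<xi>. fourier f \<xi> * cnj (fourier g \<xi>) * of_real (gauss (e n *\<^sub>R \<xi>))) \<longlonglongrightarrow> (LBINT \<xi>. fourier f \<xi> * cnj (fourier g \<xi>) * 1)"
  proof (rule Bochner_Integration.integral_dominated_convergence[where w = "\<lambda>\<xi>. cmod (fourier f \<xi> * cnj (fourier g \<xi>))"])
    show "AE \<xi> in lborel. (\<lambda>n. fourier f \<xi> * cnj (fourier g \<xi>) * of_real (gauss (e n *\<^sub>R \<xi>))) \<longlonglongrightarrow> fourier f \<xi> * cnj (fourier g \<xi>) * 1"
    proof (intro AE_I2 tendsto_mult_left)
      fix \<xi> :: 'a
      have "(\<lambda>n. complex_of_real (gauss (e n *\<^sub>R \<xi>))) \<longlonglongrightarrow> of_real (exp (- (norm (0 *\<^sub>R \<xi>))\<^sup>2 / 2))"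
        unfolding gauss_def by (intro tendsto_intros el) auto
      then show "(\<lambda>n. complex_of_real (gauss (e n *\<^sub>R \<xi>))) \<longlonglongrightarrow> 1" by simp
    qed
    have "cmod (fourier f \<xi> * cnj (fourier g \<xi>)) * gauss (e n *\<^sub>R \<xi>) \<le> cmod (fourier f \<xi> * cnj (fourier g \<xi>)) * 1" for n \<xi>
      by (intro mult_left_mono gauss_bounds) auto
    then show "AE \<xi> in lborel. norm (fourier f \<xi> * cnj (fourier g \<xi>) * of_real (gauss (e n *\<^sub>R \<xi>))) \<le> cmod (fourier f \<xi> * cnj (fourier g \<xi>))" for n
      by (intro AE_I2) (simp add: norm_mult gauss_bounds)
    show "integrable lborel (\<lambda>\<xi>. cmod (fourier f \<xi> * cnj (fourier g \<xi>)))" by (rule integrable_norm[OF fg])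
  qed measurable
  also have "(\<lambda>n. LBINT \<xi>. fourier f \<xi> * cnj (fourier g \<xi>) * of_real (gauss (e n *\<^sub>R \<xi>))) = (\<lambda>n. c * (LBINT x. f x * I n x))"
    unfolding parseval_regularised[OF f g e0] c_def I_def ..
  finally have "(LBINT \<xi>. fourier f \<xi> * cnj (fourier g \<xi>) * 1) = c * (LBINT x. f x * (LBINT z. cnj (g x) * of_real (gauss (z::'a))))"
    using r by (rule LIMSEQ_unique)
  also have "(LBINT x. f x * (LBINT z. cnj (g x) * of_real (gauss (z::'a))))
      = (LBINT x. of_real ((2 * pi) powr (real DIM('a) / 2)) * (f x * cnj (g x)))"
  proof (rule lint_cong)
    fix x :: 'a
    have "(LBINT z. cnj (g x) * of_real (gauss (z::'a))) = cnj (g x) * of_real ((2 * pi) powr (real DIM('a) / 2))"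
      unfolding integral_mult_right_zero integral_gauss ..
    then show "f x * (LBINT z. cnj (g x) * of_real (gauss (z::'a))) = of_real ((2 * pi) powr (real DIM('a) / 2)) * (f x * cnj (g x))"
      by (simp only: mult_ac)
  qed
  also have "\<dots> = of_real ((2 * pi) powr (real DIM('a) / 2)) * (LBINT x. f x * cnj (g x))"
    by (rule integral_mult_right_zero)
  also have "c * \<dots> = (LBINT x. f x * cnj (g x))"
    unfolding c_def mult.assoc[symmetric] of_real_mult[symmetric] by (simp add: powr_add[symmetric])
  finally show ?thesis by simp
qed

section \<open>The single-layer operator\<close>

lemma cc_smooth_bounded:
  assumes "f \<in> cc_smooth"
  obtains B where "\<And>x. cmod (f x) \<le> B"
proof -
  obtain S where S: "smooth_fun f" "compact S" "\<And>x. x \<notin> S \<Longrightarrow> f x = 0"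
    using assms by (rule cc_smoothE) (blast intro: that)
  have "compact (f ` S)"
    by (rule compact_continuous_image[OF continuous_on_subset[OF smooth_fun_continuous[OF S(1)]] S(2)]) simp
  then obtain B where B: "\<And>y. y \<in> f ` S \<Longrightarrow> norm y \<le> B" using compact_imp_bounded bounded_iff by metis
  show thesis
  proof (rule that[of "\<bar>B\<bar>"])
    fix x show "cmod (f x) \<le> \<bar>B\<bar>"
      using B[of "f x"] S(3)[of x] by (cases "x \<in> S") auto
  qed
qed

lemma measurable_symbol [measurable]: "symbol k L \<in> borel_measurable borel"
  unfolding symbol_def[abs_def] by measurable

lemma fourier_translate:
  assumes [measurable]: "f \<in> borel_measurable borel"
  shows "fourier (\<lambda>x. f (x - z)) \<xi> = cis (- (\<xi> \<bullet> z)) * fourier f \<xi>"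
proof -
  have "(LBINT x. cis (- (\<xi> \<bullet> x)) * f (x - z)) = \<bar>1\<bar> ^ DIM('a) *\<^sub>R (LBINT x. cis (- (\<xi> \<bullet> (z + 1 *\<^sub>R x))) * f ((z + 1 *\<^sub>R x) - z))"
    by (rule lborel_integral_affine(1)) auto
  also have "\<dots> = (LBINT x. cis (- (\<xi> \<bullet> z)) * (cis (- (\<xi> \<bullet> x)) * f x))"
    by (simp add: inner_add_right cis_mult mult.assoc[symmetric])
  also have "\<dots> = cis (- (\<xi> \<bullet> z)) * (LBINT x. cis (- (\<xi> \<bullet> x)) * f x)" by (rule integral_mult_right_zero)
  finally show ?thesis by (simp add: fourier_def)
qed

text \<open>The convolution itself is never transformed. Parseval is applied, for each z, to the
  translate of f by z, whose transform carries the factor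
  \<open>cis (- (\<xi> \<bullet> z))\<close>, and the resulting identities are integrated against
  K.\<close>

lemma integral_multiplier_pairing:
  fixes K f g :: "'a::euclidean_space \<Rightarrow> complex"
  assumes K: "integrable lborel K" and f: "f \<in> cc_smooth" and g: "g \<in> cc_smooth"
  shows "(LBINT \<xi>. (LBINT z. K z * cis (- (\<xi> \<bullet> z))) * fourier f \<xi> * cnj (fourier g \<xi>))
     = (LBINT x. (LBINT y. K (x - y) * f y) * cnj (g x))"
proof -
  have Km [measurable]: "K \<in> borel_measurable borel" using K by auto
  have fm [measurable]: "f \<in> borel_measurable borel" and gm [measurable]: "g \<in> borel_measurable borel"
    using f g by (auto intro: cc_smooth_measurable)
  note [measurable] = measurable_fourier[OF fm] measurable_fourier[OF gm]
  have fi: "integrable lborel f" and gi: "integrable lborel g" using f g by (auto intro: cc_smooth_integrable)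
  obtain Bf where Bf: "\<And>x. cmod (f x) \<le> Bf" using f by (rule cc_smooth_bounded) (rule that)
  obtain Bg where Bg: "\<And>x. cmod (g x) \<le> Bg" using g by (rule cc_smooth_bounded) (rule that)
  have cg: "continuous_on UNIV g" using g by (rule cc_smoothE) (rule smooth_fun_continuous)
  define H where "H \<xi> = fourier f \<xi> * cnj (fourier g \<xi>)" for \<xi>
  have Hm [measurable]: "H \<in> borel_measurable borel" unfolding H_def[abs_def] by measurable
  have Hi: "integrable lborel H"
    unfolding H_def[abs_def] by (rule integrable_mult_fourier[OF integrable_fourier[OF f] gi])
  have p1: "integrable (lborel \<Otimes>\<^sub>M lborel) (\<lambda>(z, \<xi>). K z * H \<xi> * cis (- (\<xi> \<bullet> z)))"
    by (rule integrable_product_bounded[OF K Hi, of "\<lambda>z \<xi>. cis (- (\<xi> \<bullet> z))" 1]) auto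
  have p2: "integrable (lborel \<Otimes>\<^sub>M lborel) (\<lambda>(z, x). K z * cnj (g x) * f (x - z))"
    by (rule integrable_product_bounded[OF K _ _ Bf]) (use gi in auto)
  have "(LBINT \<xi>. (LBINT z. K z * cis (- (\<xi> \<bullet> z))) * fourier f \<xi> * cnj (fourier g \<xi>))
     = (LBINT \<xi>. (LBINT z. K z * H \<xi> * cis (- (\<xi> \<bullet> z))))"
  proof (rule lint_cong)
    fix \<xi> :: 'a
    have "(LBINT z. K z * H \<xi> * cis (- (\<xi> \<bullet> z))) = (LBINT z. H \<xi> * (K z * cis (- (\<xi> \<bullet> z))))"
      by (simp only: mult_ac)
    also have "\<dots> = H \<xi> * (LBINT z. K z * cis (- (\<xi> \<bullet> z)))" by (rule integral_mult_right_zero)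
    finally show "(LBINT z. K z * cis (- (\<xi> \<bullet> z))) * fourier f \<xi> * cnj (fourier g \<xi>) = (LBINT z. K z * H \<xi> * cis (- (\<xi> \<bullet> z)))"
      by (simp only: H_def mult_ac)
  qed
  also have "\<dots> = (LBINT z. (LBINT \<xi>. K z * H \<xi> * cis (- (\<xi> \<bullet> z))))"
    by (rule lborel_pair.Fubini_integral[OF p1])
  also have "\<dots> = (LBINT z. (LBINT x. K z * cnj (g x) * f (x - z)))"
  proof (rule lint_cong)
    fix z :: 'a
    define fz where "fz x = f (x - z)" for x
    have ft: "fourier fz \<xi> = cis (- (\<xi> \<bullet> z)) * fourier f \<xi>" for \<xi> unfolding fz_def[abs_def] by (rule fourier_translate[OF fm])
    have fzi: "integrable lborel fz"
      using lborel_integral_affine(2)[of 1 f "- z"] fi by (simp add: fz_def[abs_def] add.commute[of "- z"])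
    have "integrable lborel (\<lambda>\<xi>. cis (- (z \<bullet> \<xi>)) * H \<xi>)" by (rule integrable_cis_mult[OF Hi])
    then have "integrable lborel (\<lambda>\<xi>. fourier fz \<xi> * cnj (fourier g \<xi>))" by (simp add: ft H_def inner_commute mult_ac)
    then have P: "(LBINT \<xi>. fourier fz \<xi> * cnj (fourier g \<xi>)) = (LBINT x. fz x * cnj (g x))"
      by (rule parseval[OF fzi gi cg Bg])
    have "(LBINT \<xi>. K z * H \<xi> * cis (- (\<xi> \<bullet> z))) = (LBINT \<xi>. K z * (fourier fz \<xi> * cnj (fourier g \<xi>)))"
      unfolding ft H_def by (simp only: mult_ac)
    also have "\<dots> = K z * (LBINT x. fz x * cnj (g x))" unfolding integral_mult_right_zero P ..
    also have "\<dots> = (LBINT x. K z * (fz x * cnj (g x)))" by (rule integral_mult_right_zero[symmetric])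
    also have "\<dots> = (LBINT x. K z * cnj (g x) * f (x - z))" by (simp only: fz_def mult_ac)
    finally show "(LBINT \<xi>. K z * H \<xi> * cis (- (\<xi> \<bullet> z))) = (LBINT x. K z * cnj (g x) * f (x - z))" .
  qed
  also have "\<dots> = (LBINT x. (LBINT z. K z * cnj (g x) * f (x - z)))"
    by (rule lborel_pair.Fubini_integral[OF p2, symmetric])
  also have "\<dots> = (LBINT x. (LBINT y. K (x - y) * f y) * cnj (g x))"
  proof (rule lint_cong)
    fix x :: 'a
    have "(LBINT z. K z * cnj (g x) * f (x - z)) = (LBINT z. cnj (g x) * (K z * f (x - z)))" by (simp only: mult_ac)
    also have "\<dots> = cnj (g x) * (LBINT z. K z * f (x - z))" by (rule integral_mult_right_zero)
    also have "(LBINT z. K z * f (x - z)) = \<bar>-1\<bar> ^ DIM('a) *\<^sub>R (LBINT y. K (x + (-1) *\<^sub>R y) * f (x - (x + (-1) *\<^sub>R y)))"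
      by (rule lborel_integral_affine(1)) auto
    finally show "(LBINT z. K z * cnj (g x) * f (x - z)) = (LBINT y. K (x - y) * f y) * cnj (g x)"
      by (simp add: mult.commute)
  qed
  finally show ?thesis .
qed

lemma test_funs_eq_0:
  assumes "f \<in> test_funs \<Gamma>" "x \<notin> \<Gamma>"
  shows "f x = 0"
  using assms closure_subset[of "{x. f x \<noteq> 0}"] unfolding test_funs_def by blast

text \<open>For x and y in \<Gamma> the cut-off at the diameter changes nothing, and outside
  \<Gamma> the test functions vanish; hence both integrals may run over the whole space and the
  operator becomes a convolution.\<close>

lemma fun_distr_single_layer:
  fixes \<Gamma> :: "'a::euclidean_space set"
  assumes f: "f \<in> test_funs \<Gamma>" and g: "g \<in> test_funs \<Gamma>" and b: "bounded \<Gamma>"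
  shows "fun_distr \<Gamma> (single_layer k \<Gamma> f) g
     = (LBINT x. (LBINT y. cut_kernel k (diameter \<Gamma>) (x - y) * f y) * cnj (g x))"
  unfolding fun_distr_def set_lebesgue_integral_def
proof (rule lint_cong)
  fix x :: 'a
  show "indicator \<Gamma> x *\<^sub>R (single_layer k \<Gamma> f x * cnj (g x))
     = (LBINT y. cut_kernel k (diameter \<Gamma>) (x - y) * f y) * cnj (g x)"
  proof (cases "x \<in> \<Gamma>")
    case True
    have "single_layer k \<Gamma> f x = (LBINT y. cut_kernel k (diameter \<Gamma>) (x - y) * f y)"
      unfolding single_layer_def set_lebesgue_integral_def
    proof (rule lint_cong)
      fix y :: 'a
      show "indicator \<Gamma> y *\<^sub>R (fund_sol k x y * f y) = cut_kernel k (diameter \<Gamma>) (x - y) * f y"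
      proof (cases "y \<in> \<Gamma>")
        case y: True
        have "norm (x - y) \<le> diameter \<Gamma>"
          using diameter_bounded_bound[OF b True y] by (simp add: dist_norm)
        then show ?thesis using y by (simp add: cut_kernel_def fund_sol_def dist_norm)
      qed (simp add: test_funs_eq_0[OF f])
    qed
    with True show ?thesis by simp
  qed (simp add: test_funs_eq_0[OF g])
qed

text \<open>\<open>Hs_space\<close> is defined with the weight for k = 1, so changing k needs
  equivalent weights. The ratio of the bases lies between \<open>lo\<close> and \<open>hi\<close>;
  the sum of both powers is a bound for either sign of s.\<close>

lemma powr_weight_comparison:
  assumes k: "k > 0" and l: "l > (0::real)"
  obtains c where "c \<ge> 0" "\<And>n. (k^2 + n^2) powr s \<le> c * (l^2 + n^2) powr s"
proof -
  define lo where "lo = min (k^2 / l^2) 1"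
  define hi where "hi = max (k^2 / l^2) 1"
  have lo: "lo > 0" and lh: "lo \<le> 1" "1 \<le> hi" and kl: "lo * l^2 \<le> k^2" "k^2 \<le> hi * l^2"
    using k l by (auto simp: lo_def hi_def min_def max_def divide_simps split: if_splits)
  show thesis
  proof (rule that[of "hi powr s + lo powr s"])
    fix n :: real
    define a where "a = k^2 + n^2"
    define b where "b = l^2 + n^2"
    have ab: "a > 0" "b > 0" using k l by (auto simp: a_def b_def add_pos_nonneg)
    have "lo * n^2 \<le> 1 * n^2" "1 * n^2 \<le> hi * n^2" using lh by (intro mult_right_mono; simp)+
    then have "lo * b \<le> a" "a \<le> hi * b" using kl by (auto simp: a_def b_def distrib_left)
    then have q: "lo \<le> a / b" "a / b \<le> hi" using ab by (auto simp: field_simps)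
    have "(a / b) powr s \<le> hi powr s + lo powr s"
    proof (cases "s \<ge> 0")
      case True
      have "(a / b) powr s \<le> hi powr s" using q ab True by (intro powr_mono2) auto
      then show ?thesis using powr_ge_zero[of lo s] by linarith
    next
      case False
      have "(a / b) powr s \<le> lo powr s" using q lo False by (intro powr_mono2') auto
      then show ?thesis using powr_ge_zero[of hi s] by linarith
    qed
    then have "(a / b) powr s * b powr s \<le> (hi powr s + lo powr s) * b powr s"
      by (intro mult_right_mono) auto
    moreover have "(a / b) powr s * b powr s = a powr s" using ab by (simp add: powr_divide)
    ultimately show "(k^2 + n^2) powr s \<le> (hi powr s + lo powr s) * (l^2 + n^2) powr s"
      by (simp add: a_def b_def)
  qed simp
qed

lemma integrable_weight_change:
  fixes U :: "'a::euclidean_space \<Rightarrow> complex"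
  assumes i: "integrable lborel (\<lambda>\<xi>. (l^2 + (norm \<xi>)^2) powr s * (cmod (U \<xi>))^2)" and [measurable]: "U \<in> borel_measurable borel"
    and k: "k > 0" and l: "l > 0"
  shows "integrable lborel (\<lambda>\<xi>. (k^2 + (norm \<xi>)^2) powr s * (cmod (U \<xi>))^2)"
proof -
  obtain c where c: "c \<ge> 0" "\<And>n. (k^2 + n^2) powr s \<le> c * (l^2 + n^2) powr s"
    using k l by (rule powr_weight_comparison) (rule that)
  show ?thesis
  proof (rule integrable_dominated)
    show "integrable lborel (\<lambda>\<xi>. c * ((l^2 + (norm \<xi>)^2) powr s * (cmod (U \<xi>))^2))" by (rule integrable_mult_right[OF i])
    show "norm ((k^2 + (norm \<xi>)^2) powr s * (cmod (U \<xi>))^2) \<le> c * ((l^2 + (norm \<xi>)^2) powr s * (cmod (U \<xi>))^2)" for \<xi>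
      using mult_right_mono[OF c(2)[of "norm \<xi>"], of "(cmod (U \<xi>))^2"] by (simp add: abs_mult mult.assoc)
  qed measurable
qed

lemma Hs_spaceD:
  assumes "U \<in> Hs_space s"
  shows "U \<in> borel_measurable borel"
    and "k > 0 \<Longrightarrow> integrable lborel (\<lambda>\<xi>. (k^2 + (norm \<xi>)^2) powr s * (cmod (U \<xi>))^2)"
proof -
  show m: "U \<in> borel_measurable borel" using assms by (simp add: Hs_space_def)
  show "integrable lborel (\<lambda>\<xi>. (k^2 + (norm \<xi>)^2) powr s * (cmod (U \<xi>))^2)" if "k > 0"
    by (rule integrable_weight_change[where l = 1]) (use assms m that in \<open>auto simp: Hs_space_def\<close>)
qed

text \<open>The extra factor k^2 + |\<xi>|^2 in the target weight is absorbed by |m|^2. The norm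
  estimate thus involves M alone; the comparison of weights serves only for membership.\<close>

lemma Hs_space_multiplier:
  fixes U m :: "'a::euclidean_space \<Rightarrow> complex"
  assumes U: "U \<in> Hs_space s" and mm [measurable]: "m \<in> borel_measurable borel" and k: "k > 0" and M: "M \<ge> 0"
    and m: "\<And>\<xi>. cmod (m \<xi>) \<le> M / sqrt (k^2 + (norm \<xi>)^2)"
  shows "(\<lambda>\<xi>. m \<xi> * U \<xi>) \<in> Hs_space (s + 1)"
    and "Hs_norm k (s + 1) (\<lambda>\<xi>. m \<xi> * U \<xi>) \<le> M * Hs_norm k s U"
proof -
  note Um [measurable] = Hs_spaceD(1)[OF U]
  note Ui = Hs_spaceD(2)[OF U k]
  have le: "(k^2 + (norm \<xi>)^2) powr (s + 1) * (cmod (m \<xi> * U \<xi>))^2 \<le> M^2 * ((k^2 + (norm \<xi>)^2) powr s * (cmod (U \<xi>))^2)" for \<xi>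
  proof -
    define a where "a = k^2 + (norm \<xi>)^2"
    have a: "a > 0" using k by (simp add: a_def add_pos_nonneg)
    have "(cmod (m \<xi>))^2 \<le> (M / sqrt a)^2" unfolding a_def by (intro power_mono m) simp
    then have "a * (cmod (m \<xi>))^2 \<le> M^2" using a by (simp add: power_divide field_simps)
    then have "a powr s * (cmod (U \<xi>))^2 * (a * (cmod (m \<xi>))^2) \<le> a powr s * (cmod (U \<xi>))^2 * M^2"
      by (intro mult_left_mono) auto
    then show ?thesis using a by (simp add: powr_add norm_mult power_mult_distrib a_def[symmetric] mult_ac)
  qed
  have i: "integrable lborel (\<lambda>\<xi>. (k^2 + (norm \<xi>)^2) powr (s + 1) * (cmod (m \<xi> * U \<xi>))^2)"
  proof (rule integrable_dominated)
    show "integrable lborel (\<lambda>\<xi>. M^2 * ((k^2 + (norm \<xi>)^2) powr s * (cmod (U \<xi>))^2))" by (rule integrable_mult_right[OF Ui])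
    show "norm ((k^2 + (norm \<xi>)^2) powr (s + 1) * (cmod (m \<xi> * U \<xi>))^2) \<le> M^2 * ((k^2 + (norm \<xi>)^2) powr s * (cmod (U \<xi>))^2)" for \<xi>
      using le[of \<xi>] by (simp only: real_norm_def abs_mult abs_of_nonneg[OF powr_ge_zero] abs_of_nonneg[OF zero_le_power2])
  qed measurable
  have "integrable lborel (\<lambda>\<xi>. (1^2 + (norm \<xi>)^2) powr (s + 1) * (cmod (m \<xi> * U \<xi>))^2)"
    by (rule integrable_weight_change[OF i _ _ k]) auto
  then show "(\<lambda>\<xi>. m \<xi> * U \<xi>) \<in> Hs_space (s + 1)" by (simp add: Hs_space_def)
  have "(LBINT \<xi>. (k^2 + (norm \<xi>)^2) powr (s + 1) * (cmod (m \<xi> * U \<xi>))^2)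
      \<le> (LBINT \<xi>. M^2 * ((k^2 + (norm \<xi>)^2) powr s * (cmod (U \<xi>))^2))"
    by (rule integral_mono[OF i integrable_mult_right[OF Ui] le])
  also have "\<dots> = M^2 * (LBINT \<xi>. (k^2 + (norm \<xi>)^2) powr s * (cmod (U \<xi>))^2)" by (rule integral_mult_right_zero)
  finally have "sqrt (LBINT \<xi>. (k^2 + (norm \<xi>)^2) powr (s + 1) * (cmod (m \<xi> * U \<xi>))^2)
      \<le> sqrt (M^2 * (LBINT \<xi>. (k^2 + (norm \<xi>)^2) powr s * (cmod (U \<xi>))^2))"
    by (rule real_sqrt_le_mono)
  then show "Hs_norm k (s + 1) (\<lambda>\<xi>. m \<xi> * U \<xi>) \<le> M * Hs_norm k s U"
    using M by (simp add: Hs_norm_def real_sqrt_mult)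
qed

text \<open>The duality of the orders s and -s. It is needed for linearity of the extended operator,
  since the integral of a non-integrable function is 0 by convention.\<close>

lemma integrable_Hs_pairing:
  fixes W :: "'a::euclidean_space \<Rightarrow> complex"
  assumes W: "W \<in> Hs_space s" and g: "g \<in> cc_smooth"
  shows "integrable lborel (\<lambda>\<xi>. W \<xi> * cnj (fourier g \<xi>))"
proof (rule integrable_dominated)
  note [measurable] = Hs_spaceD(1)[OF W] measurable_fourier[OF cc_smooth_measurable[OF g]]
  show "integrable lborel (\<lambda>\<xi>. (1 + (norm \<xi>)^2) powr s * (cmod (W \<xi>))^2 + (1 + (norm \<xi>)^2) powr (- s) * (cmod (fourier g \<xi>))^2)"
    using Hs_spaceD(2)[OF W, of 1] integrable_weighted_fourier_sq[OF g, of "- s"]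
    by (intro Bochner_Integration.integrable_add) auto
  show "(\<lambda>\<xi>. W \<xi> * cnj (fourier g \<xi>)) \<in> borel_measurable lborel" by measurable
  show "norm (W \<xi> * cnj (fourier g \<xi>)) \<le> (1 + (norm \<xi>)^2) powr s * (cmod (W \<xi>))^2 + (1 + (norm \<xi>)^2) powr (- s) * (cmod (fourier g \<xi>))^2" for \<xi>
  proof -
    \<comment> \<open>The inequality 2 u v \<le> u^2 + v^2 is applied to u = c x and v = y and
      divided by c, which distributes the weight over the two factors.\<close>
    define c where "c = (1 + (norm \<xi>)^2) powr s"
    have c: "c > 0" unfolding c_def by (smt (verit) powr_gt_zero zero_le_power2)
    define x y where "x = cmod (W \<xi>)" and "y = cmod (fourier g \<xi>)"
    have xy: "x \<ge> 0" "y \<ge> 0" by (simp_all add: x_def y_def)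
    have "2 * (c * x) * y \<le> (c * x)^2 + y^2" by (rule sum_squares_bound)
    moreover have "0 \<le> c * x * y" using c xy by simp
    ultimately have "c * x * y \<le> (c * x)^2 + y^2" by linarith
    also have "\<dots> = c * (c * x^2 + inverse c * y^2)" using c by (simp add: field_simps power2_eq_square)
    finally have "c * (x * y) \<le> c * (c * x^2 + inverse c * y^2)" by (simp only: mult.assoc)
    then have "x * y \<le> c * x^2 + inverse c * y^2" using c by (simp only: mult_le_cancel_left_pos)
    moreover have "inverse c = (1 + (norm \<xi>)^2) powr (- s)" by (simp add: c_def powr_minus)
    ultimately show ?thesis
      unfolding norm_mult complex_mod_cnj c_def[symmetric] x_def[symmetric] y_def[symmetric] by simp
  qed
qed

text \<open>The multiplier bounds require L > 0; openness places a segment inside \<Gamma>.\<close>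

lemma diameter_open_pos:
  fixes \<Gamma> :: "'a::euclidean_space set"
  assumes "open \<Gamma>" "\<Gamma> \<noteq> {}" "bounded \<Gamma>"
  shows "diameter \<Gamma> > 0"
proof -
  obtain x e where e: "e > 0" "ball x e \<subseteq> \<Gamma>" using assms(1,2) by (meson all_not_in_conv openE)
  obtain b :: 'a where b: "b \<in> Basis" using nonempty_Basis by blast
  have d: "dist x (x + (e / 2) *\<^sub>R b) = e / 2" using e(1) b by (simp add: dist_norm)
  then have "x \<in> \<Gamma>" "x + (e / 2) *\<^sub>R b \<in> \<Gamma>" using e by (auto simp: subset_iff mem_ball)
  then have "dist x (x + (e / 2) *\<^sub>R b) \<le> diameter \<Gamma>" by (rule diameter_bounded_bound[OF assms(3)])
  then show ?thesis using d e(1) by linarith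
qed

lemma symbol_bound:
  assumes "DIM('a::euclidean_space) \<in> {1, 2}"
  shows "\<exists>C>0. \<forall>k>0. \<forall>L>0. integrable lborel (cut_kernel k L :: 'a \<Rightarrow> complex) \<and>
     (\<forall>\<xi>::'a. cmod (symbol k L \<xi>) \<le>
        (if DIM('a) = 2 then C * (1 + (k * L) powr (1/2))
         else C * ln (2 + 1 / (k * L)) * (1 + (k * L) powr (1/2))) / sqrt (k^2 + (norm \<xi>)^2))"
proof (cases "DIM('a) = 2")
  case True
  show ?thesis
  proof (intro exI[of _ 24] conjI allI impI)
    fix k L :: real assume "k > 0" "L > 0"
    then show "integrable lborel (cut_kernel k L :: 'a \<Rightarrow> complex)"
      and "cmod (symbol k L \<xi>) \<le> (if DIM('a) = 2 then 24 * (1 + (k * L) powr (1/2))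
         else 24 * ln (2 + 1 / (k * L)) * (1 + (k * L) powr (1/2))) / sqrt (k^2 + (norm \<xi>)^2)" for \<xi> :: 'a
      using symbol_bound_DIM2[OF True, of k L] True by (simp_all add: powr_half_sqrt)
  qed simp
next
  case False
  then have d: "DIM('a) = 1" using assms by simp
  obtain C where C: "C > 0" and all: "\<forall>k>0. \<forall>L>0. integrable lborel (cut_kernel k L :: 'a \<Rightarrow> complex) \<and>
     (\<forall>\<xi>::'a. cmod (symbol k L \<xi>) \<le> C * (ln (2 + 1 / (k * L)) * (1 + sqrt (k * L))) / sqrt (k^2 + (norm \<xi>)^2))"
    using symbol_bound_DIM1[OF d] by (elim exE conjE)
  show ?thesis
  proof (intro exI[of _ C] conjI allI impI C)
    fix k L :: real assume kL: "k > 0" "L > 0"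
    note a = all[rule_format, OF kL]
    show "integrable lborel (cut_kernel k L :: 'a \<Rightarrow> complex)" using a by (rule conjunct1)
    have "(k * L) powr (1/2) = sqrt (k * L)" using kL by (simp add: powr_half_sqrt)
    then show "cmod (symbol k L \<xi>) \<le> (if DIM('a) = 2 then C * (1 + (k * L) powr (1/2))
         else C * ln (2 + 1 / (k * L)) * (1 + (k * L) powr (1/2))) / sqrt (k^2 + (norm \<xi>)^2)" for \<xi> :: 'a
      using a[THEN conjunct2, rule_format, of \<xi>] False by (simp only: if_False mult.assoc)
  qed
qed

text \<open>The constant comes from \<open>symbol_bound\<close>, which is uniform in k and L and
  does not mention s; \<Gamma> enters afterwards, through its diameter.\<close>

theorem theorem1p3:
  fixes s :: real
  assumes "DIM('a::euclidean_space) \<in> {1, 2}"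
  shows "\<exists>C>0. \<forall>(\<Gamma>::'a set) (k::real).
     open \<Gamma> \<and> \<Gamma> \<noteq> {} \<and> bounded \<Gamma> \<and> k > 0 \<longrightarrow>
     (\<exists>T :: ('a \<Rightarrow> complex) \<Rightarrow> (('a \<Rightarrow> complex) \<Rightarrow> complex).
        (\<forall>U\<in>tHs s \<Gamma>. T U \<in> HsG (s + 1) \<Gamma>)
      \<and> (\<forall>U\<in>tHs s \<Gamma>. \<forall>V\<in>tHs s \<Gamma>. \<forall>a b::complex. \<forall>\<psi>\<in>test_funs \<Gamma>.
            T (\<lambda>\<xi>. a * U \<xi> + b * V \<xi>) \<psi> = a * T U \<psi> + b * T V \<psi>)
      \<and> (\<forall>\<phi>\<in>test_funs \<Gamma>. \<forall>\<psi>\<in>test_funs \<Gamma>.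
            T (fourier \<phi>) \<psi> = fun_distr \<Gamma> (single_layer k \<Gamma> \<phi>) \<psi>)
      \<and> (\<forall>U\<in>tHs s \<Gamma>. HsG_norm k (s + 1) \<Gamma> (T U) \<le>
            (if DIM('a) = 2
             then C * (1 + (k * diameter \<Gamma>) powr (1/2))
             else C * ln (2 + 1 / (k * diameter \<Gamma>)) * (1 + (k * diameter \<Gamma>) powr (1/2)))
            * Hs_norm k s U))"
proof -
  define M where "M C x = (if DIM('a) = 2 then C * (1 + x powr (1/2)) else C * ln (2 + 1 / x) * (1 + x powr (1/2)))"
    for C x :: real
  have "\<exists>C>0. \<forall>k>0. \<forall>L>0. integrable lborel (cut_kernel k L :: 'a \<Rightarrow> complex) \<and>
     (\<forall>\<xi>::'a. cmod (symbol k L \<xi>) \<le> M C (k * L) / sqrt (k^2 + (norm \<xi>)^2))"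
    unfolding M_def by (rule symbol_bound[OF assms])
  then obtain C where C: "C > 0" and all: "\<forall>k>0. \<forall>L>0. integrable lborel (cut_kernel k L :: 'a \<Rightarrow> complex) \<and>
     (\<forall>\<xi>::'a. cmod (symbol k L \<xi>) \<le> M C (k * L) / sqrt (k^2 + (norm \<xi>)^2))"
    by (elim exE conjE)
  show ?thesis
    unfolding M_def[symmetric]
  proof (intro exI[of _ C] conjI[OF C] allI impI, goal_cases)
    case (1 \<Gamma> k)
    then have G: "open \<Gamma>" "\<Gamma> \<noteq> {}" "bounded \<Gamma>" and k: "k > 0" by auto
    define L where "L = diameter \<Gamma>"
    have L: "L > 0" unfolding L_def by (rule diameter_open_pos[OF G])
    define m where "m = (symbol k L :: 'a \<Rightarrow> complex)"
    have mm: "m \<in> borel_measurable borel" unfolding m_def by (rule measurable_symbol)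
    have Ki: "integrable lborel (cut_kernel k L :: 'a \<Rightarrow> complex)" using all k L by blast
    have mb: "cmod (m \<xi>) \<le> M C (k * L) / sqrt (k^2 + (norm \<xi>)^2)" for \<xi> using all k L unfolding m_def by blast
    have M0: "M C (k * L) \<ge> 0"
      unfolding M_def using C k L by (auto intro!: mult_nonneg_nonneg add_nonneg_nonneg ln_ge_zero)
    \<comment> \<open>One formula defines \<open>T\<close> for every U, so the extension from test
      functions is a verification on the Fourier side and not a limit.\<close>
    define T where "T U = restr_Hs (\<lambda>\<xi>. m \<xi> * U \<xi>)" for U :: "'a \<Rightarrow> complex"
    have sub: "U \<in> Hs_space s" if "U \<in> tHs s \<Gamma>" for U using that unfolding tHs_def by simp
    note mult = Hs_space_multiplier[OF sub mm k M0 mb]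
    have ext: "(\<lambda>\<xi>. m \<xi> * U \<xi>) \<in> extensions (s + 1) \<Gamma> (T U)" if "U \<in> tHs s \<Gamma>" for U
      using mult(1)[OF that] by (simp add: extensions_def T_def)
    have cc: "\<psi> \<in> cc_smooth" if "\<psi> \<in> test_funs \<Gamma>" for \<psi> using that test_funs_subset_cc_smooth by blast
    show ?case
    proof (intro exI[of _ T] conjI ballI allI)
      fix U assume U: "U \<in> tHs s \<Gamma>"
      show "T U \<in> HsG (s + 1) \<Gamma>" using ext[OF U] by (auto simp: HsG_def)
      \<comment> \<open>The quotient norm is an infimum over extensions, so the particular extension
        m U bounds it from above.\<close>
      have "bdd_below (Hs_norm k (s + 1) ` extensions (s + 1) \<Gamma> (T U))"
        by (rule bdd_belowI2[of _ 0]) (simp add: Hs_norm_def)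
      then have "HsG_norm k (s + 1) \<Gamma> (T U) \<le> Hs_norm k (s + 1) (\<lambda>\<xi>. m \<xi> * U \<xi>)"
        unfolding HsG_norm_def by (intro cInf_lower imageI ext U)
      also have "\<dots> \<le> M C (k * diameter \<Gamma>) * Hs_norm k s U" using mult(2)[OF U] by (simp add: L_def)
      finally show "HsG_norm k (s + 1) \<Gamma> (T U) \<le> M C (k * diameter \<Gamma>) * Hs_norm k s U" .
    next
      fix U V a b \<psi> assume U: "U \<in> tHs s \<Gamma>" and V: "V \<in> tHs s \<Gamma>" and psi: "\<psi> \<in> test_funs \<Gamma>"
      have i: "integrable lborel (\<lambda>\<xi>. m \<xi> * U \<xi> * cnj (fourier \<psi> \<xi>))" "integrable lborel (\<lambda>\<xi>. m \<xi> * V \<xi> * cnj (fourier \<psi> \<xi>))"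
        by (rule integrable_Hs_pairing[OF mult(1)[OF U] cc[OF psi]], rule integrable_Hs_pairing[OF mult(1)[OF V] cc[OF psi]])
      have "T (\<lambda>\<xi>. a * U \<xi> + b * V \<xi>) \<psi> = (LBINT \<xi>. a * (m \<xi> * U \<xi> * cnj (fourier \<psi> \<xi>)) + b * (m \<xi> * V \<xi> * cnj (fourier \<psi> \<xi>)))"
        unfolding T_def restr_Hs_def by (simp add: algebra_simps)
      also have "\<dots> = (LBINT \<xi>. a * (m \<xi> * U \<xi> * cnj (fourier \<psi> \<xi>))) + (LBINT \<xi>. b * (m \<xi> * V \<xi> * cnj (fourier \<psi> \<xi>)))"
        by (intro Bochner_Integration.integral_add integrable_mult_right i)
      also have "\<dots> = a * T U \<psi> + b * T V \<psi>"
        unfolding T_def restr_Hs_def integral_mult_right_zero ..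
      finally show "T (\<lambda>\<xi>. a * U \<xi> + b * V \<xi>) \<psi> = a * T U \<psi> + b * T V \<psi>" .
    next
      fix \<phi> \<psi> assume phi: "\<phi> \<in> test_funs \<Gamma>" and psi: "\<psi> \<in> test_funs \<Gamma>"
      show "T (fourier \<phi>) \<psi> = fun_distr \<Gamma> (single_layer k \<Gamma> \<phi>) \<psi>"
        unfolding fun_distr_single_layer[OF phi psi G(3)] T_def restr_Hs_def m_def symbol_def L_def[symmetric]
        by (rule integral_multiplier_pairing[OF Ki cc[OF phi] cc[OF psi]])
    qed
  qed
qed

end
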